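(* Let $J\subset I$. If $x \in W_{\mathrm{af}}$ and $y \in (W^{J})_{\mathrm{af}}$ satisfy the condition that $y \succeq \Pi^{J}(x)$, then the set $$\mathrm{Lift}_{\succeq x}(y) := \{ y' \in W_{\mathrm{af}} \mid \Pi^{J}(y')=y \text{ and } y' \succeq x \}$$ has the minimum element with respect to the semi-infinite Bruhat order on $W_{\mathrm{af}}$.
   Context: Let $\mathfrak g$ be a finite-dimensional simple Lie algebra over $\mathbb{C}$ with simple roots $\alpha_i$, simple coroots $\alpha_i^\vee$ ($i\in I$), roots $\Delta$, positive roots $\Delta^+$, $\rho=\frac12\sum_{\alpha\in\Delta^+}\alpha$, $Q^\vee=\bigoplus_i\mathbb{Z}\alpha_i^\vee$, Weyl group $W$ with length $\ell$. For the untwisted affine Lie algebra with null root $\delta$: $\Delta_{\mathrm{af}}^+=\Delta^+\sqcup\{\alpha+n\delta\mid\alpha\in\Delta,n>0\}$ (positive real roots), $W_{\mathrm{af}}=W\ltimes\{t_\xi\mid\xi\in Q^\vee\}$, $s_{\alpha+n\delta}=s_\alpha t_{n\alpha^\vee}$, acting on real roots by $wt_\xi(\alpha+n\delta)=w\alpha+(n-\langle\alpha,\xi\rangle)\delta$. For $J\subset I$: $\Delta_J=\Delta\cap\bigoplus_{i\in J}\mathbb{Z}\alpha_i$, $\Delta_J^+=\Delta_J\cap\Delta^+$, $Q_J^\vee=\bigoplus_{i\in J}\mathbb{Z}\alpha_i^\vee$, $W_J=\langle s_i\mid i\in J\rangle$, $(\Delta_J)^+_{\mathrm{af}}=\Delta_J^+\sqcup\{\alpha+n\delta\mid\alpha\in\Delta_J,n>0\}$,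 $(W_J)_{\mathrm{af}}=W_J\ltimes\{t_\xi\mid\xi\in Q_J^\vee\}$, $(W^J)_{\mathrm{af}}=\{x\in W_{\mathrm{af}}\mid x\beta\in\Delta_{\mathrm{af}}^+\ \forall\beta\in(\Delta_J)^+_{\mathrm{af}}\}$. Each $x\in W_{\mathrm{af}}$ is uniquely $x_1x_2$ with $x_1\in(W^J)_{\mathrm{af}}$, $x_2\in(W_J)_{\mathrm{af}}$; $\Pi^J(x):=x_1$. The semi-infinite length is $\ell^{\frac\infty2}(wt_\xi)=\ell(w)+2\langle\rho,\xi\rangle$. The directed graph $\mathrm{BG}^{\frac\infty2}((W^J)_{\mathrm{af}})$ has vertices $(W^J)_{\mathrm{af}}$ and edges $x\xrightarrow{\beta}s_\beta x$ with $\beta\in\Delta_{\mathrm{af}}^+$, $s_\beta x\in(W^J)_{\mathrm{af}}$, $\ell^{\frac\infty2}(s_\beta x)=\ell^{\frac\infty2}(x)+1$. The semi-infinite Bruhat order on $(W^J)_{\mathrm{af}}$: $x\preceq y$ (equivalently $y\succeq x$) iff there is a directed path from $x$ to $y$. The case $J=\emptyset$, where $(W^\emptyset)_{\mathrm{af}}=W_{\mathrm{af}}$, gives the order on $W_{\mathrm{af}}$. *)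

theory Defs
  imports "HOL-Analysis.Analysis"
begin

text \<open>
  The ambient Euclidean space is the real form \<open>\<real> \<otimes> Q\<close> of the dual of the Cartan subalgebra,
  with a Weyl-invariant inner product. The dual space, which contains the coroots, is identified
  with it through this inner product; the pairing of weights and coweights is then \<open>\<bullet>\<close>, and the
  contragredient Weyl group action on coweights is given by the same orthogonal maps.
\<close>

definition coroot :: "'a::real_inner \<Rightarrow> 'a" where
  "coroot \<alpha> = (2 / (\<alpha> \<bullet> \<alpha>)) *\<^sub>R \<alpha>"

definition reflection :: "'a::real_inner \<Rightarrow> 'a \<Rightarrow> 'a" where
  "reflection \<alpha> v = v - (v \<bullet> coroot \<alpha>) *\<^sub>R \<alpha>"

definition int_span :: "('i \<Rightarrow> 'a::real_vector) \<Rightarrow> 'i set \<Rightarrow> 'a set" where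
  "int_span v J = {\<Sum>i\<in>J. real_of_int (c i) *\<^sub>R v i | c. True}"

definition nonneg_int_span :: "('i \<Rightarrow> 'a::real_vector) \<Rightarrow> 'i set \<Rightarrow> 'a set" where
  "nonneg_int_span v J = {\<Sum>i\<in>J. real (c i) *\<^sub>R v i | c. True}"

text \<open>
  The root data of a finite-dimensional simple complex Lie algebra: an irreducible reduced
  crystallographic root system \<open>\<Delta>\<close> with a base of simple roots indexed by \<open>I\<close>.
\<close>

locale simple_root_datum =
  fixes \<Delta> :: "'a::euclidean_space set"
    and I :: "'i set"
    and \<alpha> :: "'i \<Rightarrow> 'a"
  assumes finite_roots: "finite \<Delta>"
    and zero_not_root: "0 \<notin> \<Delta>"
    and span_roots: "span \<Delta> = UNIV"
    and reduced: "\<And>\<beta> c. \<beta> \<in> \<Delta> \<Longrightarrow> c *\<^sub>R \<beta> \<in> \<Delta> \<Longrightarrow> c = 1 \<or> c = - 1"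
    and reflection_root: "\<And>\<beta> \<gamma>. \<beta> \<in> \<Delta> \<Longrightarrow> \<gamma> \<in> \<Delta> \<Longrightarrow> reflection \<beta> \<gamma> \<in> \<Delta>"
    and crystallographic: "\<And>\<beta> \<gamma>. \<beta> \<in> \<Delta> \<Longrightarrow> \<gamma> \<in> \<Delta> \<Longrightarrow> \<gamma> \<bullet> coroot \<beta> \<in> \<int>"
    and irreducible: "\<And>A B. A \<union> B = \<Delta> \<Longrightarrow> (\<forall>\<beta>\<in>A. \<forall>\<gamma>\<in>B. \<beta> \<bullet> \<gamma> = 0) \<Longrightarrow> A = {} \<or> B = {}"
    and finite_index: "finite I"
    and simple_root: "\<alpha> ` I \<subseteq> \<Delta>"
    and inj_simple: "inj_on \<alpha> I"
    and independent_simple: "independent (\<alpha> ` I)"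
    and base: "\<And>\<beta>. \<beta> \<in> \<Delta> \<Longrightarrow> \<beta> \<in> nonneg_int_span \<alpha> I \<or> - \<beta> \<in> nonneg_int_span \<alpha> I"
begin

definition pos_roots :: "'a set" where
  "pos_roots = \<Delta> \<inter> nonneg_int_span \<alpha> I"

definition \<rho> :: 'a where
  "\<rho> = (1/2) *\<^sub>R (\<Sum>\<beta>\<in>pos_roots. \<beta>)"

definition word :: "'i list \<Rightarrow> 'a \<Rightarrow> 'a" where
  "word is = foldr (\<lambda>i w. reflection (\<alpha> i) \<circ> w) is id"

text \<open>Products of simple reflections already form a group, as reflections are involutions.\<close>

definition weyl :: "'i set \<Rightarrow> ('a \<Rightarrow> 'a) set" where
  "weyl J = word ` lists J"

definition len :: "('a \<Rightarrow> 'a) \<Rightarrow> nat" where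
  "len w = (LEAST n. \<exists>is\<in>lists I. length is = n \<and> word is = w)"

definition roots_of :: "'i set \<Rightarrow> 'a set" where
  "roots_of J = \<Delta> \<inter> int_span \<alpha> J"

definition coroot_lattice :: "'i set \<Rightarrow> 'a set" where
  "coroot_lattice J = int_span (\<lambda>i. coroot (\<alpha> i)) J"

text \<open>
  The pair \<open>(\<beta>, n)\<close> stands for the affine real root \<open>\<beta> + n\<delta>\<close>; the coefficient is a real number, so
  that the action below needs no rounding. For \<open>J = I\<close> this is the set of all positive real roots.
\<close>

definition aff_pos_roots :: "'i set \<Rightarrow> ('a \<times> real) set" where
  "aff_pos_roots J =
     {(\<beta>, 0) | \<beta>. \<beta> \<in> roots_of J \<inter> pos_roots} \<union>
     {(\<beta>, real_of_int n) | \<beta> n. \<beta> \<in> roots_of J \<and> n > 0}"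

text \<open>
  The pair \<open>(w, \<xi>)\<close> stands for \<open>w t\<^sub>\<xi>\<close>. The product is read off from \<open>t\<^sub>\<xi> v = v t\<^sub>\<zeta>\<close> with
  \<open>\<zeta> = v\<inverse> \<xi>\<close>.
\<close>

definition aff_weyl :: "'i set \<Rightarrow> (('a \<Rightarrow> 'a) \<times> 'a) set" where
  "aff_weyl J = weyl J \<times> coroot_lattice J"

definition aff_mult :: "('a \<Rightarrow> 'a) \<times> 'a \<Rightarrow> ('a \<Rightarrow> 'a) \<times> 'a \<Rightarrow> ('a \<Rightarrow> 'a) \<times> 'a" where
  "aff_mult x y = (fst x \<circ> fst y, inv (fst y) (snd x) + snd y)"

definition aff_act :: "('a \<Rightarrow> 'a) \<times> 'a \<Rightarrow> 'a \<times> real \<Rightarrow> 'a \<times> real" where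
  "aff_act x \<beta> = (fst x (fst \<beta>), snd \<beta> - fst \<beta> \<bullet> snd x)"

definition aff_reflection :: "'a \<times> real \<Rightarrow> ('a \<Rightarrow> 'a) \<times> 'a" where
  "aff_reflection \<beta> = (reflection (fst \<beta>), snd \<beta> *\<^sub>R coroot (fst \<beta>))"

definition aff_min_reps :: "'i set \<Rightarrow> (('a \<Rightarrow> 'a) \<times> 'a) set" where
  "aff_min_reps J = {x \<in> aff_weyl I. \<forall>\<beta>\<in>aff_pos_roots J. aff_act x \<beta> \<in> aff_pos_roots I}"

definition proj :: "'i set \<Rightarrow> ('a \<Rightarrow> 'a) \<times> 'a \<Rightarrow> ('a \<Rightarrow> 'a) \<times> 'a" where
  "proj J x = (THE x\<^sub>1. x\<^sub>1 \<in> aff_min_reps J \<and> (\<exists>x\<^sub>2\<in>aff_weyl J. x = aff_mult x\<^sub>1 x\<^sub>2))"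

definition si_len :: "('a \<Rightarrow> 'a) \<times> 'a \<Rightarrow> real" where
  "si_len x = real (len (fst x)) + 2 * (\<rho> \<bullet> snd x)"

definition si_edges :: "'i set \<Rightarrow> ((('a \<Rightarrow> 'a) \<times> 'a) \<times> (('a \<Rightarrow> 'a) \<times> 'a)) set" where
  "si_edges J = {(x, aff_mult (aff_reflection \<beta>) x) | x \<beta>.
     x \<in> aff_min_reps J \<and> \<beta> \<in> aff_pos_roots I \<and>
     aff_mult (aff_reflection \<beta>) x \<in> aff_min_reps J \<and>
     si_len (aff_mult (aff_reflection \<beta>) x) = si_len x + 1}"

definition si_le :: "'i set \<Rightarrow> ('a \<Rightarrow> 'a) \<times> 'a \<Rightarrow> ('a \<Rightarrow> 'a) \<times> 'a \<Rightarrow> bool" where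
  "si_le J x y \<longleftrightarrow> x \<in> aff_min_reps J \<and> y \<in> aff_min_reps J \<and> (x, y) \<in> (si_edges J)\<^sup>*"

text \<open>\<open>aff_min_reps {}\<close> is \<open>aff_weyl I\<close>, so \<open>si_le {}\<close> is the order on the full affine Weyl group.\<close>

definition lift_set ::
  "'i set \<Rightarrow> ('a \<Rightarrow> 'a) \<times> 'a \<Rightarrow> ('a \<Rightarrow> 'a) \<times> 'a \<Rightarrow> (('a \<Rightarrow> 'a) \<times> 'a) set" where
  "lift_set J x y = {y' \<in> aff_weyl I. proj J y' = y \<and> si_le {} x y'}"

end

end

theory Submission
  imports Defs
begin

text \<open>
  Left multiplication by a simple affine reflection \<open>s\<close> preserves the semi-infinite order up to
  exchanging \<open>x\<close> and \<open>s x\<close> (the lifting property), and it maps cosets of \<open>(W\<^sub>J)\<^sub>a\<^sub>f\<close> to cosets,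
  raising all elements of a coset, lowering all of them, or mapping the coset to itself. If \<open>x < s x\<close>,
  the minimal lift of \<open>x\<close> to a coset can therefore be read off from a minimal lift of \<open>s x\<close>
  or, when \<open>s\<close> lowers the coset, from that of \<open>x\<close> to the lowered coset, which is closer
  to \<open>x\<close> in length. Raising \<open>x\<close> in this way one reaches a translation \<open>t\<^sub>\<mu>\<close>. Since \<open>t\<^sub>\<mu> \<le> w t\<^sub>\<nu>\<close> forces
  \<open>\<nu> - \<mu>\<close> to be a nonnegative combination of simple coroots, the minimal lift of \<open>t\<^sub>\<mu>\<close> is explicit: its
  finite part is minimal in its coset of \<open>W\<^sub>J\<close> and its translation part agrees with \<open>\<mu>\<close> at the
  simple coroots indexed by \<open>J\<close>.
\<close>

text \<open>The semi-infinite length is unbounded below, so no bottom element exists from which an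
  induction on length could start; this is why x is moved up, and why length alone is no induction
  measure. Positions of alcoves supply one: the squared distance to an interior point of the
  fundamental alcove drops by a fixed amount whenever a reflection moves towards that point. This
  measure gives both the existence of minimal representatives and the walk from x to a translation.
  Whether s_\<beta> raises x, for a positive affine root \<beta>, is read off from one sign, that of
  the finite part of x^{-1} \<beta>. An edge also demands that the length grow by exactly one, which
  conjugation and passage to cosets do not preserve; the lifting property is what turns every
  reflection in a raising direction into a comparison. Positivity of finite and affine roots is
  expressed as the sign of a linear height, so that it can be tracked through the reflection
  formula.\<close>

lemma linear_reflection: "linear (reflection a)"
  by (rule linearI) (simp_all add: reflection_def algebra_simps inner_add_left scaleR_add_left)

lemma inner_coroot_self: "a \<noteq> 0 \<Longrightarrow> a \<bullet> coroot a = 2"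
  by (simp add: coroot_def)

lemma coroot_minus: "coroot (- a) = - coroot a"
  by (simp add: coroot_def)

lemma reflection_minus: "reflection (- a) = reflection a"
  by (simp add: reflection_def coroot_minus fun_eq_iff)

lemma reflection_zero: "reflection 0 = id"
  by (simp add: reflection_def fun_eq_iff)

lemma reflection_self: "reflection a a = - a"
proof (cases "a = 0")
  case False
  then show ?thesis
    by (simp add: reflection_def inner_coroot_self scaleR_2)
qed (simp add: reflection_zero)

lemma reflection_inner: "reflection a u \<bullet> reflection a v = u \<bullet> v"
proof (cases "a = 0")
  case False
  then have "a \<bullet> a \<noteq> 0" by simp
  then show ?thesis
    by (simp add: reflection_def coroot_def inner_diff_left inner_diff_right inner_commute field_simps)
qed (simp add: reflection_zero)

lemma reflection_reflection [simp]: "reflection a (reflection a v) = v"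
proof (cases "a = 0")
  case False
  have "reflection a (reflection a v) = reflection a v - (v \<bullet> coroot a) *\<^sub>R reflection a a"
    using linear_reflection[of a] by (simp add: reflection_def[of a v] linear_diff linear_scale)
  then show ?thesis by (simp add: reflection_self) (simp add: reflection_def)
qed (simp add: reflection_zero)

lemma reflection_comp_reflection [simp]: "reflection a \<circ> reflection a = id"
  by (simp add: fun_eq_iff)

lemma orthogonal_reflection: "orthogonal_transformation (reflection a)"
  by (simp add: orthogonal_transformation_def linear_reflection reflection_inner)

lemma coroot_orthogonal:
  assumes "orthogonal_transformation f"
  shows "coroot (f a) = f (coroot a)"
  using assms by (simp add: orthogonal_transformation_def coroot_def linear_scale)

lemma reflection_orthogonal:
  assumes "orthogonal_transformation f"
  shows "reflection (f a) (f v) = f (reflection a v)"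
proof -
  have "f v \<bullet> coroot (f a) = v \<bullet> coroot a"
    using assms by (simp add: coroot_orthogonal) (simp add: orthogonal_transformation_def)
  then show ?thesis
    using assms unfolding orthogonal_transformation_def
    by (simp add: reflection_def linear_diff linear_scale)
qed

lemma reflection_comp_orthogonal:
  assumes "orthogonal_transformation f"
  shows "reflection (f a) \<circ> f = f \<circ> reflection a"
  using assms by (simp add: fun_eq_iff reflection_orthogonal)

lemma inv_orthogonal_inner:
  fixes f :: "'a::euclidean_space \<Rightarrow> 'a"
  assumes "orthogonal_transformation f"
  shows "inv f u \<bullet> v = u \<bullet> f v"
proof -
  have "f (inv f u) = u"
    using orthogonal_transformation_surj[OF assms] by (rule surj_f_inv_f)
  then show ?thesis
    using assms unfolding orthogonal_transformation_def by metis
qed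

lemma inner_coroot_nonneg_iff: "b \<noteq> 0 \<Longrightarrow> v \<bullet> coroot b \<ge> 0 \<longleftrightarrow> v \<bullet> b \<ge> 0"
  and inner_coroot_pos_iff: "b \<noteq> 0 \<Longrightarrow> v \<bullet> coroot b > 0 \<longleftrightarrow> v \<bullet> b > 0"
  and inner_coroot_nonpos_iff: "b \<noteq> 0 \<Longrightarrow> v \<bullet> coroot b \<le> 0 \<longleftrightarrow> v \<bullet> b \<le> 0"
proof -
  assume "b \<noteq> 0"
  then have "b \<bullet> b > 0" by simp
  moreover have "v \<bullet> coroot b = 2 * (v \<bullet> b) / (b \<bullet> b)" by (simp add: coroot_def)
  ultimately show "v \<bullet> coroot b \<ge> 0 \<longleftrightarrow> v \<bullet> b \<ge> 0" "v \<bullet> coroot b > 0 \<longleftrightarrow> v \<bullet> b > 0"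
    "v \<bullet> coroot b \<le> 0 \<longleftrightarrow> v \<bullet> b \<le> 0"
    by (simp_all add: zero_le_divide_iff zero_less_divide_iff divide_le_0_iff del: inner_gt_zero_iff)
qed

lemma inv_reflection: "inv (reflection a) = reflection a"
  by (rule inv_unique_comp) simp_all

lemma sum_list_replicate_scaleR: "sum_list (replicate n v) = real n *\<^sub>R (v :: 'b::real_vector)"
  by (induction n) (simp_all add: algebra_simps)

context simple_root_datum
begin

section \<open>Fundamental coweights, heights and positive roots\<close>

definition fund_coweight :: "'i \<Rightarrow> 'a" where
  "fund_coweight i = (SOME v. \<forall>j\<in>I. v \<bullet> \<alpha> j = (if i = j then 1 else 0))"

lemma fund_coweight_simple:
  assumes "i \<in> I" "j \<in> I"
  shows "fund_coweight i \<bullet> \<alpha> j = (if i = j then 1 else 0)"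
proof -
  obtain f :: "'a \<Rightarrow> real" where f: "linear f"
    "\<forall>x\<in>\<alpha> ` I. f x = (if x = \<alpha> i then 1 else 0)"
    using linear_independent_extend[OF independent_simple, of "\<lambda>x. if x = \<alpha> i then 1 else 0"] by blast
  \<comment> \<open>The functional dual to \<open>\<alpha> i\<close> becomes a vector:
    \<open>adjoint f 1\<close> is its Riesz representative.\<close>
  have "adjoint f 1 \<bullet> v = f v" for v
    using adjoint_works[OF f(1), of v 1] by (simp add: inner_commute)
  then have "\<forall>j\<in>I. adjoint f 1 \<bullet> \<alpha> j = (if i = j then 1 else 0)"
    using f(2) assms(1) inj_simple by (auto dest: inj_onD)
  then have "\<forall>j\<in>I. fund_coweight i \<bullet> \<alpha> j = (if i = j then 1 else 0)"
    unfolding fund_coweight_def by (rule someI)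
  then show ?thesis using assms by blast
qed

text \<open>This is half the sum of the positive coroots, as \<open>root_two_rho_check\<close> shows
  later. Divided by the Coxeter number it is the interior point of the fundamental alcove behind
  \<open>alcove_dist\<close>.\<close>

definition hvec :: 'a where
  "hvec = (\<Sum>i\<in>I. fund_coweight i)"

definition ht :: "'a \<Rightarrow> real" where
  "ht v = hvec \<bullet> v"

lemma ht_sum: "ht v = (\<Sum>i\<in>I. fund_coweight i \<bullet> v)"
  by (simp add: ht_def hvec_def inner_sum_left)

lemma ht_minus [simp]: "ht (- v) = - ht v"
  and ht_diff: "ht (u - v) = ht u - ht v"
  and ht_add: "ht (u + v) = ht u + ht v"
  and ht_scale: "ht (c *\<^sub>R v) = c * ht v"
  by (simp_all add: ht_def inner_diff_right inner_add_right)

lemma simple_in_roots: "i \<in> I \<Longrightarrow> \<alpha> i \<in> \<Delta>"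
  using simple_root by blast

lemma fund_coweight_sum:
  assumes "i \<in> I" "K \<subseteq> I"
  shows "fund_coweight i \<bullet> (\<Sum>j\<in>K. c j *\<^sub>R \<alpha> j) = (if i \<in> K then c i else 0)"
proof -
  have "fund_coweight i \<bullet> (\<Sum>j\<in>K. c j *\<^sub>R \<alpha> j) = (\<Sum>j\<in>K. if i = j then c j else 0)"
    unfolding inner_sum_right using assms by (intro sum.cong) (auto simp: fund_coweight_simple)
  also have "\<dots> = (if i \<in> K then c i else 0)"
    using assms finite_index by (simp add: finite_subset)
  finally show ?thesis .
qed

lemma ht_simple [simp]: "i \<in> I \<Longrightarrow> ht (\<alpha> i) = 1"
  using finite_index by (simp add: ht_sum fund_coweight_simple)

lemma minus_root: "\<beta> \<in> \<Delta> \<Longrightarrow> - \<beta> \<in> \<Delta>"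
  using reflection_root[of \<beta> \<beta>] by (simp add: reflection_self)

lemma root_nonzero: "\<beta> \<in> \<Delta> \<Longrightarrow> \<beta> \<noteq> 0"
  using zero_not_root by blast

lemma nonneg_int_span_fund_coweight:
  assumes "v \<in> nonneg_int_span \<alpha> I" "i \<in> I"
  shows "fund_coweight i \<bullet> v \<ge> 0" "fund_coweight i \<bullet> v \<in> \<int>"
  using assms fund_coweight_sum[OF assms(2) order_refl] by (auto simp: nonneg_int_span_def)

lemma root_fund_coweight_int: "\<beta> \<in> \<Delta> \<Longrightarrow> i \<in> I \<Longrightarrow> fund_coweight i \<bullet> \<beta> \<in> \<int>"
  using base[of \<beta>] nonneg_int_span_fund_coweight(2)[of \<beta> i] nonneg_int_span_fund_coweight(2)[of "- \<beta>" i] by auto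

lemma ht_root_int: "\<beta> \<in> \<Delta> \<Longrightarrow> ht \<beta> \<in> \<int>"
  unfolding ht_sum by (intro Ints_sum root_fund_coweight_int)

lemma span_simple: "span (\<alpha> ` I) = UNIV"
proof -
  have "v \<in> span (\<alpha> ` I)" if "v \<in> nonneg_int_span \<alpha> I" for v
    using that by (auto simp: nonneg_int_span_def intro!: span_sum intro: span_scale span_base)
  then have "\<Delta> \<subseteq> span (\<alpha> ` I)"
    using base span_neg by (metis minus_minus subsetI)
  then have "span \<Delta> \<subseteq> span (\<alpha> ` I)"
    by (simp add: span_minimal)
  then show ?thesis using span_roots by blast
qed

lemma simple_expansion: "v = (\<Sum>i\<in>I. (fund_coweight i \<bullet> v) *\<^sub>R \<alpha> i)"
proof -
  have "v \<in> span (\<alpha> ` I)" using span_simple by blast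
  then obtain u where u: "v = (\<Sum>a\<in>\<alpha> ` I. u a *\<^sub>R a)"
    using finite_index by (auto simp: span_finite)
  then have v: "v = (\<Sum>i\<in>I. u (\<alpha> i) *\<^sub>R \<alpha> i)"
    by (simp add: sum.reindex[OF inj_simple])
  have "fund_coweight i \<bullet> v = u (\<alpha> i)" if "i \<in> I" for i
    using fund_coweight_sum[OF that order_refl, of "\<lambda>i. u (\<alpha> i)"] that unfolding v by simp
  then have "(\<Sum>i\<in>I. (fund_coweight i \<bullet> v) *\<^sub>R \<alpha> i) = (\<Sum>i\<in>I. u (\<alpha> i) *\<^sub>R \<alpha> i)"
    by (intro sum.cong) simp_all
  with v show ?thesis by (rule trans[OF _ sym])
qed

lemma pos_roots_fund_coweight:
  assumes "\<beta> \<in> pos_roots" "i \<in> I"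
  shows "fund_coweight i \<bullet> \<beta> \<ge> 0"
  using assms nonneg_int_span_fund_coweight by (auto simp: pos_roots_def)

lemma fund_coweight_zero: "(\<And>i. i \<in> I \<Longrightarrow> fund_coweight i \<bullet> v = 0) \<Longrightarrow> v = 0"
  by (subst simple_expansion) simp

lemma pos_root_ht:
  assumes "\<beta> \<in> pos_roots"
  shows "ht \<beta> > 0"
proof -
  have "\<beta> \<noteq> 0" using assms root_nonzero by (auto simp: pos_roots_def)
  then obtain i where "i \<in> I" "fund_coweight i \<bullet> \<beta> \<noteq> 0" using fund_coweight_zero by blast
  moreover have "ht \<beta> \<ge> 0"
    unfolding ht_sum using assms by (intro sum_nonneg) (rule pos_roots_fund_coweight)
  moreover have "ht \<beta> \<noteq> 0"
    unfolding ht_sum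
    using calculation finite_index pos_roots_fund_coweight[OF assms] by (subst sum_nonneg_eq_0_iff) auto
  ultimately show ?thesis by linarith
qed

text \<open>The two alternatives in \<open>base\<close> have heights of opposite sign. From here on
  positivity is the sign of one linear function, which can be evaluated on images under
  reflections.\<close>

lemma pos_roots_iff: "\<beta> \<in> pos_roots \<longleftrightarrow> \<beta> \<in> \<Delta> \<and> ht \<beta> > 0"
proof -
  have "\<beta> \<in> pos_roots" if "\<beta> \<in> \<Delta>" "ht \<beta> > 0"
  proof (rule ccontr)
    assume "\<beta> \<notin> pos_roots"
    then have "- \<beta> \<in> pos_roots" using that base[of \<beta>] minus_root by (auto simp: pos_roots_def)
    from pos_root_ht[OF this] that show False by simp
  qed
  then show ?thesis using pos_root_ht by (auto simp: pos_roots_def)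
qed

lemma pos_or_neg: "\<beta> \<in> \<Delta> \<Longrightarrow> \<beta> \<in> pos_roots \<or> - \<beta> \<in> pos_roots"
  using base[of \<beta>] minus_root by (auto simp: pos_roots_def)

lemma ht_root_nonzero: "\<beta> \<in> \<Delta> \<Longrightarrow> ht \<beta> \<noteq> 0"
  using pos_or_neg[of \<beta>] by (auto simp: pos_roots_iff)

lemma root_proportional:
  assumes "\<beta> \<in> \<Delta>" "\<gamma> \<in> \<Delta>" "\<gamma> = c *\<^sub>R \<beta>" "ht \<beta> > 0" "ht \<gamma> > 0"
  shows "\<gamma> = \<beta>"
  using reduced[of \<beta> c] assms by (auto simp: ht_scale)

text \<open>The reflection changes only the coefficient at \<open>\<alpha> i\<close>. Since \<gamma>
  is not proportional to \<open>\<alpha> i\<close>, another coefficient is positive, and a root with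
  one positive coefficient is positive.\<close>

lemma simple_reflection_pos:
  assumes i: "i \<in> I" and g: "\<gamma> \<in> \<Delta>" "ht \<gamma> > 0" "\<gamma> \<noteq> \<alpha> i"
  shows "ht (reflection (\<alpha> i) \<gamma>) > 0"
proof -
  have gp: "\<gamma> \<in> pos_roots" using g by (simp add: pos_roots_iff)
  have "\<exists>j\<in>I. j \<noteq> i \<and> fund_coweight j \<bullet> \<gamma> \<noteq> 0"
  proof (rule ccontr)
    assume "\<not> ?thesis"
    then have "\<gamma> - (fund_coweight i \<bullet> \<gamma>) *\<^sub>R \<alpha> i = 0"
      using i by (intro fund_coweight_zero) (auto simp: inner_diff_right fund_coweight_simple)
    then have "\<gamma> = (fund_coweight i \<bullet> \<gamma>) *\<^sub>R \<alpha> i" by (simp only: right_minus_eq)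
    then have "\<gamma> = \<alpha> i"
      by (rule root_proportional[OF simple_in_roots[OF i] g(1)]) (simp_all add: i g(2))
    with g show False by simp
  qed
  then obtain j where j: "j \<in> I" "j \<noteq> i" "fund_coweight j \<bullet> \<gamma> > 0"
    using pos_roots_fund_coweight[OF gp] by (metis less_le)
  have jr: "fund_coweight j \<bullet> reflection (\<alpha> i) \<gamma> > 0"
    using j i by (simp add: reflection_def inner_diff_right fund_coweight_simple)
  have "reflection (\<alpha> i) \<gamma> \<in> \<Delta>" using g i by (simp add: reflection_root simple_in_roots)
  then have "reflection (\<alpha> i) \<gamma> \<in> pos_roots"
    using pos_or_neg[of "reflection (\<alpha> i) \<gamma>"] pos_roots_fund_coweight[of "- reflection (\<alpha> i) \<gamma>" j] jr j by auto
  then show ?thesis by (simp add: pos_roots_iff)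
qed

subsection \<open>The finite Weyl group\<close>

lemma roots_of_iff:
  assumes "J \<subseteq> I"
  shows "\<gamma> \<in> roots_of J \<longleftrightarrow> \<gamma> \<in> \<Delta> \<and> (\<forall>i\<in>I - J. fund_coweight i \<bullet> \<gamma> = 0)"
proof
  assume "\<gamma> \<in> roots_of J"
  then show "\<gamma> \<in> \<Delta> \<and> (\<forall>i\<in>I - J. fund_coweight i \<bullet> \<gamma> = 0)"
    using fund_coweight_sum[OF _ assms] by (auto simp: roots_of_def int_span_def)
next
  assume g: "\<gamma> \<in> \<Delta> \<and> (\<forall>i\<in>I - J. fund_coweight i \<bullet> \<gamma> = 0)"
  have "\<gamma> = (\<Sum>i\<in>J. (fund_coweight i \<bullet> \<gamma>) *\<^sub>R \<alpha> i)"
    using g assms finite_index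
    by (subst simple_expansion, intro sum.mono_neutral_right) auto
  also have "\<dots> = (\<Sum>i\<in>J. real_of_int \<lfloor>fund_coweight i \<bullet> \<gamma>\<rfloor> *\<^sub>R \<alpha> i)"
    using g assms root_fund_coweight_int by (intro sum.cong) auto
  finally have "\<exists>c. \<gamma> = (\<Sum>i\<in>J. real_of_int (c i) *\<^sub>R \<alpha> i)"
    by (rule exI[of _ "\<lambda>i. \<lfloor>fund_coweight i \<bullet> \<gamma>\<rfloor>"])
  with g show "\<gamma> \<in> roots_of J"
    by (auto simp: roots_of_def int_span_def)
qed

lemma roots_of_I [simp]: "roots_of I = \<Delta>"
  using roots_of_iff[of I] by auto

lemma roots_of_subset: "roots_of J \<subseteq> \<Delta>"
  by (auto simp: roots_of_def)

lemma roots_of_empty [simp]: "roots_of {} = {}"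
  using zero_not_root by (auto simp: roots_of_def int_span_def)

lemma minus_roots_of: "J \<subseteq> I \<Longrightarrow> \<gamma> \<in> roots_of J \<Longrightarrow> - \<gamma> \<in> roots_of J"
  by (simp add: roots_of_iff minus_root)

lemma simple_in_roots_of: "J \<subseteq> I \<Longrightarrow> j \<in> J \<Longrightarrow> \<alpha> j \<in> roots_of J"
  by (auto simp: roots_of_iff simple_in_roots fund_coweight_simple subset_iff)

lemma reflection_roots_of:
  assumes "J \<subseteq> I" "\<beta> \<in> roots_of J" "\<gamma> \<in> \<Delta>"
  shows "reflection \<beta> \<gamma> \<in> roots_of J \<longleftrightarrow> \<gamma> \<in> roots_of J"
  using assms by (auto simp: roots_of_iff reflection_root) (auto simp: reflection_def inner_diff_right)

text \<open>Expanding \<gamma> \<bullet> \<gamma> > 0 in simple roots gives nonnegative coefficients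
  supported on J, so one of the pairings must be positive.\<close>

lemma pos_root_exists_simple:
  assumes "J \<subseteq> I" "\<gamma> \<in> roots_of J" "ht \<gamma> > 0"
  shows "\<exists>j\<in>J. \<gamma> \<bullet> coroot (\<alpha> j) > 0"
proof (rule ccontr)
  assume neg: "\<not> ?thesis"
  have g: "\<gamma> \<in> pos_roots" using assms roots_of_subset by (auto simp: pos_roots_iff)
  have "\<gamma> \<bullet> \<gamma> = \<gamma> \<bullet> (\<Sum>i\<in>I. (fund_coweight i \<bullet> \<gamma>) *\<^sub>R \<alpha> i)"
    using simple_expansion[of \<gamma>] by simp
  also have "\<dots> = (\<Sum>i\<in>I. (fund_coweight i \<bullet> \<gamma>) * (\<gamma> \<bullet> \<alpha> i))"
    by (simp add: inner_sum_right)
  also have "\<dots> \<le> 0"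
  proof (rule sum_nonpos)
    fix i assume i: "i \<in> I"
    show "(fund_coweight i \<bullet> \<gamma>) * (\<gamma> \<bullet> \<alpha> i) \<le> 0"
    proof (cases "i \<in> J")
      case True
      then have "\<gamma> \<bullet> coroot (\<alpha> i) \<le> 0" using neg by force
      moreover have "\<alpha> i \<bullet> \<alpha> i > 0" using i root_nonzero simple_in_roots by simp
      ultimately have "\<gamma> \<bullet> \<alpha> i \<le> 0"
        by (simp add: coroot_def mult_le_0_iff divide_le_0_iff)
      then show ?thesis using pos_roots_fund_coweight[OF g i] by (simp add: mult_nonneg_nonpos)
    next
      case False
      then show ?thesis using assms i by (simp add: roots_of_iff)
    qed
  qed
  finally have "\<gamma> = 0" by (metis inner_ge_zero inner_eq_zero_iff order_antisym)
  then show False using assms roots_of_subset zero_not_root by blast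
qed

text \<open>The integral height is the measure: reflecting in a simple root that pairs positively
  with \<gamma> lowers it, and the result is positive unless \<gamma> is that simple root. Staying
  inside \<open>roots_of J\<close> lets the same rule serve all parabolic subsystems.\<close>

lemma pos_root_induct [consumes 3, case_names simple step]:
  assumes "J \<subseteq> I" "\<gamma> \<in> roots_of J" "ht \<gamma> > 0"
  and simple: "\<And>j. j \<in> J \<Longrightarrow> P (\<alpha> j)"
  and step: "\<And>j \<gamma>. j \<in> J \<Longrightarrow> \<gamma> \<in> roots_of J \<Longrightarrow> ht \<gamma> > 0 \<Longrightarrow> \<gamma> \<bullet> coroot (\<alpha> j) > 0 \<Longrightarrow>
     reflection (\<alpha> j) \<gamma> \<in> roots_of J \<Longrightarrow> ht (reflection (\<alpha> j) \<gamma>) > 0 \<Longrightarrow>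
     P (reflection (\<alpha> j) \<gamma>) \<Longrightarrow> P \<gamma>"
  shows "P \<gamma>"
  using assms(2,3)
proof (induction "nat \<lfloor>ht \<gamma>\<rfloor>" arbitrary: \<gamma> rule: less_induct)
  case less
  obtain j where j: "j \<in> J" "\<gamma> \<bullet> coroot (\<alpha> j) > 0"
    using pos_root_exists_simple[OF assms(1) less.prems] by blast
  have jI: "j \<in> I" using j assms(1) by blast
  have gd: "\<gamma> \<in> \<Delta>" using less.prems roots_of_subset by blast
  show ?case
  proof (cases "\<gamma> = \<alpha> j")
    case True
    then show ?thesis using simple j by simp
  next
    case False
    let ?g = "reflection (\<alpha> j) \<gamma>"
    have g: "?g \<in> roots_of J" "ht ?g > 0"
      using reflection_roots_of[OF assms(1) simple_in_roots_of[OF assms(1) j(1)] gd] less.prems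
        simple_reflection_pos[OF jI gd _ False] by auto
    have gd': "?g \<in> \<Delta>" using g roots_of_subset by blast
    have "ht ?g < ht \<gamma>" using j jI by (simp add: reflection_def ht_diff ht_scale)
    moreover obtain m n where "ht ?g = of_int m" "ht \<gamma> = of_int n"
      using ht_root_int[OF gd] ht_root_int[OF gd'] by (auto elim!: Ints_cases)
    ultimately have "nat \<lfloor>ht ?g\<rfloor> < nat \<lfloor>ht \<gamma>\<rfloor>" using g(2) by simp
    from less.hyps[OF this g] show ?thesis using step j less.prems g by blast
  qed
qed

section \<open>The coroot lattice in coordinates given by the fundamental weights\<close>

definition fund_weight :: "'i \<Rightarrow> 'a" where
  "fund_weight i = (\<alpha> i \<bullet> \<alpha> i / 2) *\<^sub>R fund_coweight i"

lemma fund_weight_coroot: "i \<in> I \<Longrightarrow> j \<in> I \<Longrightarrow> fund_weight i \<bullet> coroot (\<alpha> j) = (if i = j then 1 else 0)"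
  using root_nonzero simple_in_roots by (auto simp: fund_weight_def coroot_def fund_coweight_simple)

lemma fund_weight_sum:
  assumes "i \<in> I" "K \<subseteq> I"
  shows "fund_weight i \<bullet> (\<Sum>j\<in>K. c j *\<^sub>R coroot (\<alpha> j)) = (if i \<in> K then c i else 0)"
proof -
  have "fund_weight i \<bullet> (\<Sum>j\<in>K. c j *\<^sub>R coroot (\<alpha> j)) = (\<Sum>j\<in>K. if i = j then c j else 0)"
    unfolding inner_sum_right using assms by (intro sum.cong) (auto simp: fund_weight_coroot)
  also have "\<dots> = (if i \<in> K then c i else 0)"
    using assms finite_index by (simp add: finite_subset)
  finally show ?thesis .
qed

lemma coroot_expansion: "v = (\<Sum>i\<in>I. (fund_weight i \<bullet> v) *\<^sub>R coroot (\<alpha> i))"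
proof -
  have "(\<Sum>i\<in>I. (fund_weight i \<bullet> v) *\<^sub>R coroot (\<alpha> i)) = (\<Sum>i\<in>I. (fund_coweight i \<bullet> v) *\<^sub>R \<alpha> i)"
    using root_nonzero simple_in_roots by (intro sum.cong) (auto simp: fund_weight_def coroot_def)
  then show ?thesis using simple_expansion[of v] by simp
qed

lemma coroot_lattice_iff:
  assumes "J \<subseteq> I"
  shows "v \<in> coroot_lattice J \<longleftrightarrow> (\<forall>i\<in>I. fund_weight i \<bullet> v \<in> \<int>) \<and> (\<forall>i\<in>I - J. fund_weight i \<bullet> v = 0)"
proof
  assume "v \<in> coroot_lattice J"
  then show "(\<forall>i\<in>I. fund_weight i \<bullet> v \<in> \<int>) \<and> (\<forall>i\<in>I - J. fund_weight i \<bullet> v = 0)"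
    using fund_weight_sum[OF _ assms] by (auto simp: coroot_lattice_def int_span_def)
next
  assume g: "(\<forall>i\<in>I. fund_weight i \<bullet> v \<in> \<int>) \<and> (\<forall>i\<in>I - J. fund_weight i \<bullet> v = 0)"
  have "v = (\<Sum>i\<in>J. (fund_weight i \<bullet> v) *\<^sub>R coroot (\<alpha> i))"
    using g assms finite_index
    by (subst coroot_expansion, intro sum.mono_neutral_right) auto
  also have "\<dots> = (\<Sum>i\<in>J. real_of_int \<lfloor>fund_weight i \<bullet> v\<rfloor> *\<^sub>R coroot (\<alpha> i))"
    using g assms by (intro sum.cong) auto
  finally have "\<exists>c. v = (\<Sum>i\<in>J. real_of_int (c i) *\<^sub>R coroot (\<alpha> i))"
    by (rule exI[of _ "\<lambda>i. \<lfloor>fund_weight i \<bullet> v\<rfloor>"])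
  then show "v \<in> coroot_lattice J"
    by (auto simp: coroot_lattice_def int_span_def)
qed

lemma coroot_lattice_add: "J \<subseteq> I \<Longrightarrow> u \<in> coroot_lattice J \<Longrightarrow> v \<in> coroot_lattice J \<Longrightarrow> u + v \<in> coroot_lattice J"
  and coroot_lattice_minus: "J \<subseteq> I \<Longrightarrow> v \<in> coroot_lattice J \<Longrightarrow> - v \<in> coroot_lattice J"
  and coroot_lattice_diff: "J \<subseteq> I \<Longrightarrow> u \<in> coroot_lattice J \<Longrightarrow> v \<in> coroot_lattice J \<Longrightarrow> u - v \<in> coroot_lattice J"
  and coroot_lattice_scale: "J \<subseteq> I \<Longrightarrow> m \<in> \<int> \<Longrightarrow> v \<in> coroot_lattice J \<Longrightarrow> m *\<^sub>R v \<in> coroot_lattice J"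
  and coroot_lattice_zero: "J \<subseteq> I \<Longrightarrow> 0 \<in> coroot_lattice J"
  by (simp_all add: coroot_lattice_iff inner_add_right inner_diff_right)

lemma coroot_lattice_mono: "J \<subseteq> I \<Longrightarrow> v \<in> coroot_lattice J \<Longrightarrow> v \<in> coroot_lattice I"
  by (simp add: coroot_lattice_iff)

lemma coroot_lattice_sum:
  assumes "J \<subseteq> I" "\<And>k. k \<in> K \<Longrightarrow> f k \<in> coroot_lattice J"
  shows "(\<Sum>k\<in>K. f k) \<in> coroot_lattice J"
  using assms(2)
  by (induction K rule: infinite_finite_induct) (auto simp: coroot_lattice_zero coroot_lattice_add assms(1))

lemma simple_coroot_lattice: "J \<subseteq> I \<Longrightarrow> j \<in> J \<Longrightarrow> coroot (\<alpha> j) \<in> coroot_lattice J"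
  by (auto simp: coroot_lattice_iff fund_weight_coroot subset_iff)

lemma root_coroot_lattice_int:
  assumes "\<gamma> \<in> \<Delta>" "v \<in> coroot_lattice I"
  shows "\<gamma> \<bullet> v \<in> \<int>"
proof -
  obtain c where "v = (\<Sum>i\<in>I. real_of_int (c i) *\<^sub>R coroot (\<alpha> i))"
    using assms by (auto simp: coroot_lattice_def int_span_def)
  then show ?thesis
    using assms simple_in_roots crystallographic
    by (auto simp: inner_sum_right intro!: Ints_sum Ints_mult)
qed

lemma coroot_reflection: "coroot (reflection a b) = reflection a (coroot b)"
  by (rule coroot_orthogonal[OF orthogonal_reflection])

lemma reflection_coroot: "reflection a v = v - (a \<bullet> v) *\<^sub>R coroot a"
  by (simp add: reflection_def coroot_def inner_commute)

lemma reflection_coroot_lattice: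
  assumes "J \<subseteq> I" "j \<in> J" "v \<in> coroot_lattice I"
  shows "reflection (\<alpha> j) v - v \<in> coroot_lattice J"
proof -
  have "(\<alpha> j \<bullet> v) *\<^sub>R coroot (\<alpha> j) \<in> coroot_lattice J"
    using assms by (intro coroot_lattice_scale root_coroot_lattice_int simple_in_roots simple_coroot_lattice) auto
  then have "- ((\<alpha> j \<bullet> v) *\<^sub>R coroot (\<alpha> j)) \<in> coroot_lattice J"
    using assms(1) coroot_lattice_minus by blast
  then show ?thesis by (simp add: reflection_coroot)
qed

section \<open>Words, parabolic subgroups and the exchange condition\<close>

lemma word_Nil [simp]: "word [] = id"
  and word_Cons [simp]: "word (i # is) = reflection (\<alpha> i) \<circ> word is"
  by (simp_all add: word_def)

lemma word_append: "word (is @ js) = word is \<circ> word js"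
  by (induction "is") (simp_all add: comp_assoc)

lemma word_orthogonal: "orthogonal_transformation (word is)"
  by (induction "is")
    (simp_all only: word_Nil word_Cons orthogonal_transformation_compose orthogonal_reflection
      orthogonal_transformation_id[folded id_def])

lemma word_rev_word: "word (rev is) (word is v) = v"
  by (induction "is" arbitrary: v) (simp_all add: word_append)

lemma word_rev: "word (rev is) \<circ> word is = id" "word is \<circ> word (rev is) = id"
  using word_rev_word[of "is"] word_rev_word[of "rev is"] by (auto simp: fun_eq_iff)

lemma inv_word: "inv (word is) = word (rev is)"
  by (rule inv_unique_comp) (rule word_rev)+

lemma weyl_orthogonal: "w \<in> weyl J \<Longrightarrow> orthogonal_transformation w"
  by (auto simp: weyl_def word_orthogonal)

lemma weyl_linear: "w \<in> weyl J \<Longrightarrow> linear w"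
  by (simp add: weyl_orthogonal orthogonal_transformation_linear)

lemma weyl_bij: "w \<in> weyl J \<Longrightarrow> bij w"
  by (simp add: weyl_orthogonal orthogonal_transformation_bij)

lemma weyl_inner: "w \<in> weyl J \<Longrightarrow> w u \<bullet> w v = u \<bullet> v"
  using weyl_orthogonal by (auto simp: orthogonal_transformation_def)

lemma weyl_inv_inner: "w \<in> weyl J \<Longrightarrow> inv w u \<bullet> v = u \<bullet> w v"
  using weyl_orthogonal inv_orthogonal_inner by blast

lemma weyl_inv_f [simp]: "w \<in> weyl J \<Longrightarrow> inv w (w v) = v"
  and weyl_f_inv [simp]: "w \<in> weyl J \<Longrightarrow> w (inv w v) = v"
  using weyl_bij by (auto simp: bij_def inv_f_f surj_f_inv_f)

lemma weyl_id [simp]: "id \<in> weyl J"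
  unfolding weyl_def by (rule image_eqI[of _ _ "[]"]) simp_all

lemma weyl_comp: "u \<in> weyl J \<Longrightarrow> v \<in> weyl J \<Longrightarrow> u \<circ> v \<in> weyl J"
proof -
  assume "u \<in> weyl J" "v \<in> weyl J"
  then obtain us vs where "us \<in> lists J" "vs \<in> lists J" "u = word us" "v = word vs"
    by (auto simp: weyl_def)
  then show ?thesis
    unfolding weyl_def by (intro image_eqI[of _ _ "us @ vs"]) (auto simp: word_append)
qed

lemma weyl_inv: "u \<in> weyl J \<Longrightarrow> inv u \<in> weyl J"
proof -
  assume "u \<in> weyl J"
  then obtain us where "us \<in> lists J" "u = word us"
    by (auto simp: weyl_def)
  then show ?thesis
    unfolding weyl_def by (intro image_eqI[of _ _ "rev us"]) (auto simp: inv_word)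
qed

lemma weyl_simple: "j \<in> J \<Longrightarrow> reflection (\<alpha> j) \<in> weyl J"
  unfolding weyl_def by (rule image_eqI[of _ _ "[j]"]) simp_all

lemma weyl_mono: "J \<subseteq> I \<Longrightarrow> w \<in> weyl J \<Longrightarrow> w \<in> weyl I"
  unfolding weyl_def using lists_mono by blast

lemma weyl_induct [consumes 1, case_names id step]:
  assumes "w \<in> weyl J" "P id"
    "\<And>j w. j \<in> J \<Longrightarrow> w \<in> weyl J \<Longrightarrow> P w \<Longrightarrow> P (reflection (\<alpha> j) \<circ> w)"
  shows "P w"
proof -
  obtain "is" where "is \<in> lists J" "w = word is" using assms(1) by (auto simp: weyl_def)
  then show ?thesis
  proof (induction "is" arbitrary: w)
    case Nil
    then show ?case using assms(2) by (simp only: word_Nil)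
  next
    case (Cons i "is")
    then have "i \<in> J" "is \<in> lists J" by auto
    moreover have "P (word is)" using Cons.IH \<open>is \<in> lists J\<close> by blast
    ultimately have "P (word (i # is))"
      unfolding word_Cons by (intro assms(3)) (auto simp: weyl_def)
    then show ?case using Cons.prems by blast
  qed
qed

lemma weyl_root: "w \<in> weyl I \<Longrightarrow> \<gamma> \<in> \<Delta> \<Longrightarrow> w \<gamma> \<in> \<Delta>"
  by (induction rule: weyl_induct) (auto intro: reflection_root simple_in_roots)

lemma weyl_roots_of:
  assumes "w \<in> weyl J" "J \<subseteq> I" "\<gamma> \<in> \<Delta>"
  shows "w \<gamma> \<in> roots_of J \<longleftrightarrow> \<gamma> \<in> roots_of J"
  using assms(1)
proof (induction rule: weyl_induct)
  case (step j w)
  have "w \<gamma> \<in> \<Delta>" using step assms weyl_mono weyl_root by blast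
  then show ?case using step reflection_roots_of[OF assms(2) simple_in_roots_of] assms by simp
qed simp

text \<open>A root outside \<open>roots_of J\<close> stays outside along the word, hence never meets
  the only positive root whose sign the next letter changes.\<close>

lemma weyl_pos_outside:
  assumes "w \<in> weyl J" "J \<subseteq> I" "\<gamma> \<in> \<Delta>" "\<gamma> \<notin> roots_of J" "ht \<gamma> > 0"
  shows "ht (w \<gamma>) > 0"
  using assms(1)
proof (induction rule: weyl_induct)
  case (step j w)
  have "w \<gamma> \<in> \<Delta>" "w \<gamma> \<notin> roots_of J" using step assms weyl_mono weyl_root weyl_roots_of by blast+
  moreover have "w \<gamma> \<noteq> \<alpha> j" using calculation step assms simple_in_roots_of by metis
  ultimately show ?case
    using step assms simple_reflection_pos[of j "w \<gamma>"] by auto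
qed (simp add: assms)

text \<open>Each letter subtracts an integral multiple of a coroot from J, so \<open>weyl J\<close>
  acts trivially on the coroot lattice modulo that of J. This is what makes the componentwise
  relation \<open>same_coset\<close> possible.\<close>

lemma weyl_coroot_lattice:
  assumes "w \<in> weyl J" "J \<subseteq> I" "v \<in> coroot_lattice I"
  shows "w v - v \<in> coroot_lattice J"
  using assms(1)
proof (induction rule: weyl_induct)
  case (step j w)
  have "w v = (w v - v) + v" by simp
  then have "w v \<in> coroot_lattice I"
    using step.IH assms coroot_lattice_add coroot_lattice_mono by (metis order_refl)
  then have "reflection (\<alpha> j) (w v) - w v \<in> coroot_lattice J"
    using reflection_coroot_lattice step assms by blast
  then have "(reflection (\<alpha> j) (w v) - w v) + (w v - v) \<in> coroot_lattice J"
    using step.IH assms coroot_lattice_add by blast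
  then show ?case by simp
qed (simp add: assms coroot_lattice_zero)

lemma weyl_coroot_lattice_I:
  assumes "w \<in> weyl I" "v \<in> coroot_lattice I"
  shows "w v \<in> coroot_lattice I"
  using coroot_lattice_add[OF order_refl weyl_coroot_lattice[OF assms(1) order_refl assms(2)] assms(2)]
  by simp

text \<open>\<open>roots_of J\<close> is an intersection with a lattice, not an orbit, so both
  claims are carried upward from the simple roots: the coroot of \<gamma> is the image under
  \<open>?s\<close> of that of the lower root, and its reflection is the conjugate by
  \<open>?s\<close>.\<close>

lemma root_coroot_lattice_weyl:
  assumes "J \<subseteq> I" "\<gamma> \<in> roots_of J"
  shows "coroot \<gamma> \<in> coroot_lattice J \<and> reflection \<gamma> \<in> weyl J"
proof -
  have *: "coroot \<gamma> \<in> coroot_lattice J \<and> reflection \<gamma> \<in> weyl J"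
    if "\<gamma> \<in> roots_of J" "ht \<gamma> > 0" for \<gamma>
    using assms(1) that
  proof (induction rule: pos_root_induct)
    case (simple j)
    then show ?case using assms simple_coroot_lattice weyl_simple by blast
  next
    case (step j \<gamma>)
    let ?s = "reflection (\<alpha> j)"
    have c: "coroot (?s \<gamma>) \<in> coroot_lattice I" using step assms coroot_lattice_mono by blast
    have "coroot \<gamma> = ?s (coroot (?s \<gamma>))" by (simp add: coroot_reflection)
    also have "\<dots> = (?s (coroot (?s \<gamma>)) - coroot (?s \<gamma>)) + coroot (?s \<gamma>)" by simp
    also have "\<dots> \<in> coroot_lattice J"
      using step assms c reflection_coroot_lattice coroot_lattice_add by blast
    finally have 1: "coroot \<gamma> \<in> coroot_lattice J" .
    have "?s \<circ> (reflection (?s \<gamma>) \<circ> ?s) = reflection \<gamma>"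
      unfolding reflection_comp_orthogonal[OF orthogonal_reflection]
      by (simp add: fun_eq_iff)
    then have 2: "reflection \<gamma> \<in> weyl J"
      using step weyl_comp weyl_simple by metis
    from 1 2 show ?case by blast
  qed
  show ?thesis
  proof (cases "ht \<gamma> > 0")
    case True
    then show ?thesis using * assms by blast
  next
    case False
    then have "ht (- \<gamma>) > 0" using assms ht_root_nonzero[of \<gamma>] roots_of_subset by fastforce
    then have "coroot (- \<gamma>) \<in> coroot_lattice J \<and> reflection (- \<gamma>) \<in> weyl J"
      using * assms minus_roots_of by blast
    then show ?thesis
      using coroot_lattice_minus[OF assms(1), of "coroot (- \<gamma>)"]
      by (simp add: coroot_minus reflection_minus)
  qed
qed

text \<open>\<open>word (rev js)\<close> is the inverse of \<open>word js\<close>. Its letters,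
  applied one after the other, turn the positive \<beta> negative, and this can only happen at a
  letter j where the current root is \<open>\<alpha> j\<close>; that letter is deleted from
  js.\<close>

lemma exchange:
  assumes "J \<subseteq> I" "\<beta> \<in> \<Delta>" "ht \<beta> > 0" "js \<in> lists J" "ht (word (rev js) \<beta>) < 0"
  shows "\<exists>ks\<in>lists J. Suc (length ks) = length js \<and> reflection \<beta> \<circ> word js = word ks"
  using assms(2-5)
proof (induction js arbitrary: \<beta>)
  case (Cons j js)
  then have j: "j \<in> J" "j \<in> I" and js: "js \<in> lists J" using assms(1) by auto
  show ?case
  proof (cases "\<beta> = \<alpha> j")
    case True
    then have "reflection \<beta> \<circ> word (j # js) = word js"
      by (intro ext) simp
    moreover have "Suc (length js) = length (j # js)" by simp
    ultimately show ?thesis using js by blast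
  next
    case False
    let ?b = "reflection (\<alpha> j) \<beta>"
    have "?b \<in> \<Delta>" "ht ?b > 0"
      using Cons.prems j False simple_reflection_pos simple_in_roots reflection_root by auto
    moreover have "ht (word (rev js) ?b) < 0" using Cons.prems by (simp add: word_append)
    ultimately obtain ks where ks: "ks \<in> lists J" "Suc (length ks) = length js"
      "reflection ?b \<circ> word js = word ks"
      using Cons.IH js by blast
    have "reflection \<beta> \<circ> word (j # js) = reflection \<beta> \<circ> reflection (\<alpha> j) \<circ> word js"
      by (simp add: comp_assoc)
    also have "reflection \<beta> \<circ> reflection (\<alpha> j) = reflection (\<alpha> j) \<circ> reflection ?b"
      using reflection_comp_orthogonal[OF orthogonal_reflection, of "\<alpha> j" ?b] by simp
    also have "\<dots> \<circ> word js = word (j # ks)" using ks(3) by (simp add: comp_assoc)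
    finally show ?thesis using ks j by (intro bexI[of _ "j # ks"]) auto
  qed
qed simp

subsection \<open>Affine roots\<close>

definition highest :: 'a where
  "highest = (SOME \<theta>. \<theta> \<in> \<Delta> \<and> (\<forall>\<gamma>\<in>\<Delta>. ht \<gamma> \<le> ht \<theta>))"

lemma roots_nonempty: "\<Delta> \<noteq> {}"
proof
  assume "\<Delta> = {}"
  then have "(UNIV :: 'a set) = {0}" using span_roots by simp
  moreover obtain b :: 'a where "b \<in> Basis" using nonempty_Basis by blast
  ultimately show False using nonzero_Basis by blast
qed

lemma highest_root: "highest \<in> \<Delta>"
  and highest_max: "\<gamma> \<in> \<Delta> \<Longrightarrow> ht \<gamma> \<le> ht highest"
proof -
  have "Max (ht ` \<Delta>) \<in> ht ` \<Delta>"
    using finite_roots roots_nonempty by (intro Max_in) auto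
  then obtain \<theta> where "\<theta> \<in> \<Delta>" "Max (ht ` \<Delta>) = ht \<theta>" by blast
  then have "\<theta> \<in> \<Delta> \<and> (\<forall>\<gamma>\<in>\<Delta>. ht \<gamma> \<le> ht \<theta>)"
    using finite_roots by (metis Max_ge finite_imageI imageI)
  then have *: "highest \<in> \<Delta> \<and> (\<forall>\<gamma>\<in>\<Delta>. ht \<gamma> \<le> ht highest)"
    unfolding highest_def by (rule someI)
  show "highest \<in> \<Delta>" "\<gamma> \<in> \<Delta> \<Longrightarrow> ht \<gamma> \<le> ht highest" using * by auto
qed

lemma ht_int_ge_1: "\<gamma> \<in> \<Delta> \<Longrightarrow> ht \<gamma> > 0 \<Longrightarrow> ht \<gamma> \<ge> 1"
  using ht_root_int[of \<gamma>] by (auto elim!: Ints_cases)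

lemma highest_ht: "ht highest \<ge> 1"
proof -
  have "ht highest > 0"
    using highest_root highest_max[of "- highest"] minus_root ht_root_nonzero[of highest] by fastforce
  then show ?thesis using ht_int_ge_1 highest_root by blast
qed

lemma highest_min: "\<gamma> \<in> \<Delta> \<Longrightarrow> ht \<gamma> \<ge> - ht highest"
  using highest_max[of "- \<gamma>"] minus_root by fastforce

text \<open>With the Coxeter number as the height of \<open>\<delta>\<close>, all simple affine roots, including \<open>- \<theta> + \<delta>\<close>, have
  height \<open>1\<close>.\<close>

definition coxeter :: real where
  "coxeter = ht highest + 1"

definition aff_height :: "'a \<times> real \<Rightarrow> real" where
  "aff_height \<beta> = ht (fst \<beta>) + coxeter * snd \<beta>"

definition aff_roots :: "('a \<times> real) set" where
  "aff_roots = \<Delta> \<times> \<int>"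

lemma aff_height_minus [simp]: "aff_height (- \<beta>) = - aff_height \<beta>"
  and aff_height_diff: "aff_height (\<beta> - \<gamma>) = aff_height \<beta> - aff_height \<gamma>"
  and aff_height_scale: "aff_height (c *\<^sub>R \<beta>) = c * aff_height \<beta>"
  by (simp_all add: aff_height_def ht_diff ht_scale algebra_simps)

lemma coxeter_ht: "\<gamma> \<in> \<Delta> \<Longrightarrow> ht \<gamma> < coxeter" "\<gamma> \<in> \<Delta> \<Longrightarrow> - coxeter < ht \<gamma>"
  using highest_max[of \<gamma>] highest_min[of \<gamma>] by (simp_all add: coxeter_def)

lemma coxeter_ge: "coxeter \<ge> 2"
  using highest_ht by (simp add: coxeter_def)

text \<open>Heights of finite roots are smaller than the Coxeter number in absolute value, so a
  nonzero integral coefficient of \<delta> decides the sign.\<close>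

lemma aff_height_pos_iff:
  assumes "\<gamma> \<in> \<Delta>" "n \<in> \<int>"
  shows "aff_height (\<gamma>, n) > 0 \<longleftrightarrow> n > 0 \<or> n = 0 \<and> ht \<gamma> > 0"
proof -
  obtain k where k: "n = of_int k" using assms by (auto elim: Ints_cases)
  consider "k = 0" | "k \<ge> 1" | "k \<le> - 1" by linarith
  then show ?thesis
  proof cases
    case 2
    then have "coxeter * n \<ge> coxeter * 1" using coxeter_ge k by (intro mult_left_mono) auto
    then have "aff_height (\<gamma>, n) > 0" using coxeter_ht(2)[OF assms(1)] by (simp add: aff_height_def)
    then show ?thesis using 2 k by simp
  next
    case 3
    then have "n \<le> - 1" using k by linarith
    then have "coxeter * n \<le> coxeter * (- 1)" using coxeter_ge by (intro mult_left_mono) auto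
    then have "aff_height (\<gamma>, n) < 0" using coxeter_ht(1)[OF assms(1)] by (simp add: aff_height_def)
    then show ?thesis using 3 k by simp
  qed (simp add: aff_height_def k)
qed

lemma aff_pos_roots_iff:
  assumes "J \<subseteq> I"
  shows "\<beta> \<in> aff_pos_roots J \<longleftrightarrow> fst \<beta> \<in> roots_of J \<and> snd \<beta> \<in> \<int> \<and> aff_height \<beta> > 0"
proof (cases \<beta>)
  case (Pair \<gamma> n)
  show ?thesis
  proof (cases "\<gamma> \<in> roots_of J \<and> n \<in> \<int>")
    case True
    then show ?thesis
      using aff_height_pos_iff[of \<gamma> n] roots_of_subset[of J] Pair
      by (fastforce simp: aff_pos_roots_def pos_roots_iff elim!: Ints_cases)
  qed (auto simp: aff_pos_roots_def Pair)
qed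

lemma aff_pos_I_iff: "\<beta> \<in> aff_pos_roots I \<longleftrightarrow> \<beta> \<in> aff_roots \<and> aff_height \<beta> > 0"
  by (cases \<beta>) (simp add: aff_pos_roots_iff aff_roots_def)

lemma aff_root_ht_nonzero: "\<beta> \<in> aff_roots \<Longrightarrow> aff_height \<beta> \<noteq> 0"
proof
  assume b: "\<beta> \<in> aff_roots" "aff_height \<beta> = 0"
  have "\<not> aff_height (fst \<beta>, snd \<beta>) > 0" "\<not> aff_height (- fst \<beta>, - snd \<beta>) > 0"
    using b by (simp_all add: aff_height_def)
  then show False
    using b aff_height_pos_iff[of "fst \<beta>" "snd \<beta>"] aff_height_pos_iff[of "- fst \<beta>" "- snd \<beta>"] ht_root_nonzero[of "fst \<beta>"]
    by (auto simp: aff_roots_def minus_root)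
qed

lemma minus_aff_root: "\<beta> \<in> aff_roots \<Longrightarrow> - \<beta> \<in> aff_roots"
  by (auto simp: aff_roots_def minus_root)

lemma aff_height_int: "\<beta> \<in> aff_roots \<Longrightarrow> aff_height \<beta> \<in> \<int>"
  by (auto simp: aff_roots_def aff_height_def coxeter_def intro!: Ints_add Ints_mult ht_root_int highest_root)

definition aff_simple :: "('a \<times> real) set" where
  "aff_simple = (\<lambda>i. (\<alpha> i, 0)) ` I \<union> {(- highest, 1)}"

abbreviation arefl :: "'a \<times> real \<Rightarrow> 'a \<times> real \<Rightarrow> 'a \<times> real" where
  "arefl a \<equiv> aff_act (aff_reflection a)"

lemma arefl_eq: "arefl a \<beta> = \<beta> - (fst \<beta> \<bullet> coroot (fst a)) *\<^sub>R a"
  by (cases a; cases \<beta>) (simp add: aff_act_def aff_reflection_def reflection_def)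

lemma arefl_minus: "arefl a (- \<beta>) = - arefl a \<beta>"
  by (simp add: arefl_eq)

lemma arefl_self: "a \<in> aff_roots \<Longrightarrow> arefl a a = - a"
  using root_nonzero by (auto simp: arefl_eq aff_roots_def inner_coroot_self prod_eq_iff scaleR_2)

lemma arefl_arefl [simp]: "arefl a (arefl a \<beta>) = \<beta>"
proof (cases "fst a = 0")
  case False
  then show ?thesis
    by (simp add: arefl_eq inner_diff_left inner_coroot_self algebra_simps scaleR_2)
qed (simp add: arefl_eq coroot_def)

lemma arefl_root: "a \<in> aff_roots \<Longrightarrow> \<beta> \<in> aff_roots \<Longrightarrow> arefl a \<beta> \<in> aff_roots"
  unfolding aff_roots_def
  by (auto simp: aff_act_def aff_reflection_def reflection_root crystallographic intro!: Ints_mult)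

lemma aff_simple_root: "a \<in> aff_simple \<Longrightarrow> a \<in> aff_roots"
  by (auto simp: aff_simple_def aff_roots_def simple_in_roots minus_root highest_root)

lemma aff_height_simple: "a \<in> aff_simple \<Longrightarrow> aff_height a = 1"
  by (auto simp: aff_simple_def aff_height_def coxeter_def)

lemma highest_dominant:
  assumes "\<gamma> \<in> \<Delta>" "ht \<gamma> > 0"
  shows "\<gamma> \<bullet> highest \<ge> 0"
proof -
  have "ht (reflection \<gamma> highest) \<le> ht highest"
    using assms highest_root highest_max reflection_root by blast
  then have "(highest \<bullet> coroot \<gamma>) \<ge> 0"
    using assms by (simp add: reflection_def ht_diff ht_scale zero_le_mult_iff)
  then show ?thesis
    using assms root_nonzero inner_coroot_nonneg_iff[of \<gamma> highest] by (auto simp: inner_commute[of \<gamma> highest])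
qed

text \<open>Roots of maximal height are long.\<close>

lemma highest_coroot_le:
  assumes g: "\<gamma> \<in> \<Delta>" "\<gamma> \<noteq> highest"
  shows "\<gamma> \<bullet> coroot highest \<le> 1"
proof (rule ccontr)
  assume "\<not> ?thesis"
  then have c2: "\<gamma> \<bullet> coroot highest \<ge> 2"
    using crystallographic[OF highest_root g(1)] by (auto elim!: Ints_cases)
  let ?c = "\<gamma> \<bullet> coroot highest"
  have rg: "reflection highest \<gamma> \<in> \<Delta>" using g highest_root reflection_root by blast
  have "ht (reflection highest \<gamma>) = ht \<gamma> - ?c * ht highest"
    by (simp add: reflection_def ht_diff ht_scale)
  moreover have "?c * ht highest \<ge> 2 * ht highest" using c2 highest_ht by (intro mult_right_mono) auto
  \<comment> \<open>The reflection lowers the height by at least the distance from the maximum to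
    its negative, so it must lead from one end of the range to the other.\<close>
  ultimately have eq: "ht \<gamma> = ht highest"
    using highest_max[OF g(1)] highest_min[OF rg] by linarith
  have hpos: "highest \<bullet> highest > 0" "\<gamma> \<bullet> \<gamma> > 0"
    using highest_root g root_nonzero by auto
  have i1: "\<gamma> \<bullet> highest \<ge> highest \<bullet> highest"
    using c2 hpos by (simp add: coroot_def field_simps)
  \<comment> \<open>Pairings of at least 2 both ways would make the squared norm of
    \<open>\<gamma> - highest\<close> nonpositive. What remains is a pairing of 1, and then
    \<open>highest - \<gamma>\<close> is a root of height 0.\<close>
  have "highest \<bullet> coroot \<gamma> < 2"
  proof (rule ccontr)
    assume "\<not> ?thesis"
    then have i2: "\<gamma> \<bullet> highest \<ge> \<gamma> \<bullet> \<gamma>"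
      using hpos by (simp add: coroot_def field_simps inner_commute)
    have "(\<gamma> - highest) \<bullet> (\<gamma> - highest) \<le> 0"
      using i1 i2 by (simp add: inner_diff_left inner_diff_right inner_commute)
    then have "\<gamma> - highest = 0" by (metis inner_ge_zero inner_eq_zero_iff order_antisym)
    then show False using g by simp
  qed
  moreover have "highest \<bullet> coroot \<gamma> > 0"
    using i1 hpos g root_nonzero by (subst inner_coroot_pos_iff) (simp_all add: inner_commute[of highest \<gamma>] del: inner_gt_zero_iff)
  ultimately have "highest \<bullet> coroot \<gamma> = 1"
    using crystallographic[OF g(1) highest_root] by (auto elim!: Ints_cases)
  then have "reflection \<gamma> highest = highest - \<gamma>" by (simp add: reflection_def)
  then have "highest - \<gamma> \<in> \<Delta>" using reflection_root[OF g(1) highest_root] by simp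
  then show False using ht_root_nonzero[of "highest - \<gamma>"] eq by (simp add: ht_diff)
qed

text \<open>For a finite simple root this is \<open>simple_reflection_pos\<close>. For -\<theta> +
  \<delta>, with \<theta> = \<open>highest\<close>, the coefficient n of \<delta> moves by c, the
  pairing of \<gamma> with the coroot of \<theta>. As \<theta> is long, c is at least -1 unless
  \<gamma> = -\<theta>, so only small values of n are critical.\<close>

lemma arefl_simple_pos:
  assumes a: "a \<in> aff_simple" and b: "\<beta> \<in> aff_roots" "aff_height \<beta> > 0" "\<beta> \<noteq> a"
  shows "aff_height (arefl a \<beta>) > 0"
proof -
  obtain \<gamma> n where bg: "\<beta> = (\<gamma>, n)" by (cases \<beta>)
  have g: "\<gamma> \<in> \<Delta>" "n \<in> \<int>" using b bg by (auto simp: aff_roots_def)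
  have n: "n > 0 \<or> n = 0 \<and> ht \<gamma> > 0" using b(2) aff_height_pos_iff[OF g] bg by simp
  show ?thesis
  proof (cases "\<exists>i\<in>I. a = (\<alpha> i, 0)")
    case True
    then obtain i where i: "i \<in> I" "a = (\<alpha> i, 0)" by blast
    have "arefl a \<beta> = (reflection (\<alpha> i) \<gamma>, n)"
      by (simp add: aff_act_def aff_reflection_def i bg)
    moreover have "reflection (\<alpha> i) \<gamma> \<in> \<Delta>" using i g simple_in_roots reflection_root by blast
    ultimately show ?thesis
      using aff_height_pos_iff[of "reflection (\<alpha> i) \<gamma>" n] g n simple_reflection_pos[OF i(1) g(1)] b(3) i bg by auto
  next
    case False
    then have a0: "a = (- highest, 1)" using a by (auto simp: aff_simple_def)
    define c where "c = \<gamma> \<bullet> coroot highest"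
    have eq: "arefl a \<beta> = (\<gamma> - c *\<^sub>R highest, n + c)"
      by (simp add: aff_act_def aff_reflection_def a0 bg reflection_minus coroot_minus reflection_def c_def)
    have r: "\<gamma> - c *\<^sub>R highest \<in> \<Delta>"
      using reflection_root[OF highest_root g(1)] by (simp add: reflection_def c_def)
    have cZ: "c \<in> \<int>" using crystallographic[OF highest_root g(1)] by (simp add: c_def)
    have c1: "\<gamma> \<noteq> highest \<Longrightarrow> c \<le> 1" using highest_coroot_le[OF g(1)] by (simp add: c_def)
    have cm1: "\<gamma> \<noteq> - highest \<Longrightarrow> c \<ge> - 1"
      using highest_coroot_le[OF minus_root[OF g(1)]] by (auto simp: c_def minus_equation_iff[of \<gamma>])
    have c2: "\<gamma> = - highest \<Longrightarrow> c = - 2"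
      using inner_coroot_self[OF root_nonzero[OF highest_root]] by (simp add: c_def)
    obtain k m where km: "n = of_int k" "c = of_int m" using g(2) cZ by (auto elim!: Ints_cases)
    have "n + c > 0 \<or> n + c = 0 \<and> ht (\<gamma> - c *\<^sub>R highest) > 0"
    proof (cases "\<gamma> = - highest")
      case True
      \<comment> \<open>For \<gamma> = -\<theta> the coefficient falls by 2; the critical value n =
        1 is excluded because that root is a itself.\<close>
      then have "n \<noteq> 1" using b(3) a0 bg by simp
      moreover have "n \<noteq> 0" using n True highest_ht by auto
      ultimately have "k \<ge> 2" using n km by auto
      then have "n \<ge> 2" using km by simp
      then show ?thesis using c2[OF True] True highest_ht by (auto simp: ht_diff ht_scale)
    next
      case False
      from cm1[OF False] km have m: "m \<ge> - 1" by linarith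
      \<comment> \<open>For c = -1 the reflected root is \<gamma> + \<theta>. Its height is nonzero
        and at least 0, hence positive; it is also at most that of \<theta>, so \<gamma> is negative
        and n is at least 1.\<close>
      have h0: "ht \<gamma> + ht highest \<noteq> 0" if "m = - 1"
        using ht_root_nonzero[OF r] km that by (simp add: ht_add)
      have h1: "ht \<gamma> + ht highest > 0" if "m = - 1"
        using h0[OF that] highest_min[OF g(1)] by linarith
      have h2: "ht \<gamma> \<le> 0" if "m = - 1"
        using highest_max[OF r] km that by (simp add: ht_add)
      consider "m = - 1" | "m = 0" | "m \<ge> 1" using m by linarith
      then show ?thesis
      proof cases
        case 1
        then have "n \<noteq> 0" using n h2 by auto
        then have "k \<ge> 1" using n km by auto
        then show ?thesis using km 1 h1 by (auto simp: ht_add)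
      next
        case 2
        then show ?thesis using n km by simp
      next
        case 3
        then show ?thesis using n km by auto
      qed
    qed
    then show ?thesis unfolding eq using aff_height_pos_iff[OF r] g cZ by simp
  qed
qed

lemma arefl_simple_pos_iff:
  assumes "a \<in> aff_simple" "\<beta> \<in> aff_roots" "\<beta> \<noteq> a" "\<beta> \<noteq> - a"
  shows "aff_height (arefl a \<beta>) > 0 \<longleftrightarrow> aff_height \<beta> > 0"
proof -
  have "aff_height (arefl a \<beta>) > 0" if "aff_height \<beta> > 0"
    using arefl_simple_pos that assms by blast
  moreover have "aff_height (arefl a \<beta>) < 0" if "aff_height \<beta> < 0"
    using arefl_simple_pos[of a "- \<beta>"] that assms minus_aff_root[OF assms(2)] by (fastforce simp: arefl_minus equation_minus_iff)
  ultimately show ?thesis using aff_root_ht_nonzero[OF assms(2)] by (meson less_irrefl linorder_neqE order_less_trans)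
qed

lemma simple_obtuse:
  assumes "i \<in> I" "k \<in> I" "i \<noteq> k"
  shows "\<alpha> k \<bullet> \<alpha> i \<le> 0"
proof (rule ccontr)
  assume "\<not> ?thesis"
  then have "\<alpha> k \<bullet> coroot (\<alpha> i) > 0"
    using assms simple_in_roots root_nonzero by (auto simp: inner_coroot_pos_iff)
  then have "\<alpha> k \<bullet> coroot (\<alpha> i) \<ge> 1"
    using crystallographic[of "\<alpha> i" "\<alpha> k"] assms simple_in_roots by (auto elim!: Ints_cases)
  moreover have "ht (reflection (\<alpha> i) (\<alpha> k)) > 0"
    using assms inj_simple simple_in_roots by (intro simple_reflection_pos) (auto dest: inj_onD)
  ultimately show False using assms by (simp add: reflection_def ht_diff ht_scale)
qed

text \<open>Irreducibility enters here. Let K be the support of the highest root. Its dominance and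
  \<open>simple_obtuse\<close> make every simple root outside K orthogonal to those in K; then each
  root is supported inside K or outside it, the two families are orthogonal, and one of them must be
  empty.\<close>

lemma highest_support:
  assumes "i \<in> I"
  shows "fund_coweight i \<bullet> highest > 0"
proof (rule ccontr)
  assume ni: "\<not> ?thesis"
  have hp: "fund_coweight k \<bullet> highest \<ge> 0" if "k \<in> I" for k
    using highest_root highest_ht that by (intro pos_roots_fund_coweight) (auto simp: pos_roots_iff)
  define K where "K = {k\<in>I. fund_coweight k \<bullet> highest > 0}"
  have KI: "K \<subseteq> I" "I - K \<subseteq> I" by (auto simp: K_def)
  have K0: "fund_coweight k \<bullet> highest = 0" if "k \<in> I - K" for k
    using that hp[of k] by (auto simp: K_def)
  have orth_simple: "\<alpha> k \<bullet> \<alpha> l = 0" if k: "k \<in> K" and l: "l \<in> I - K" for k l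
  proof -
    have terms: "(fund_coweight j \<bullet> highest) * (\<alpha> j \<bullet> \<alpha> l) \<le> 0" if "j \<in> I" for j
    proof (cases "j = l")
      case True
      then show ?thesis using K0 l by simp
    next
      case False
      then show ?thesis using simple_obtuse[of l j] that l hp[OF that] by (auto intro: mult_nonneg_nonpos)
    qed
    have "highest \<bullet> \<alpha> l = (\<Sum>j\<in>I. (fund_coweight j \<bullet> highest) * (\<alpha> j \<bullet> \<alpha> l))"
      by (subst simple_expansion[of highest]) (simp add: inner_sum_left)
    moreover have "highest \<bullet> \<alpha> l \<ge> 0"
      using highest_dominant[of "\<alpha> l"] l simple_in_roots by (simp add: inner_commute)
    moreover have "(\<Sum>j\<in>I. (fund_coweight j \<bullet> highest) * (\<alpha> j \<bullet> \<alpha> l)) \<le> 0"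
      using terms by (rule sum_nonpos)
    ultimately have "(\<Sum>j\<in>I. (fund_coweight j \<bullet> highest) * (\<alpha> j \<bullet> \<alpha> l)) = 0"
      by linarith
    then have "(\<Sum>j\<in>I. - ((fund_coweight j \<bullet> highest) * (\<alpha> j \<bullet> \<alpha> l))) = 0"
      by (simp add: sum_negf)
    then have "\<forall>j\<in>I. - ((fund_coweight j \<bullet> highest) * (\<alpha> j \<bullet> \<alpha> l)) = 0"
      using terms by (subst (asm) sum_nonneg_eq_0_iff[OF finite_index]) auto
    then show ?thesis using k KI by (auto simp: K_def)
  qed
  have orth: "u \<bullet> v = 0"
    if "\<forall>k\<in>I - K. fund_coweight k \<bullet> u = 0" "\<forall>k\<in>K. fund_coweight k \<bullet> v = 0" for u v
  proof -
    have "u \<bullet> v = (\<Sum>k\<in>I. (fund_coweight k \<bullet> u) *\<^sub>R \<alpha> k) \<bullet> (\<Sum>l\<in>I. (fund_coweight l \<bullet> v) *\<^sub>R \<alpha> l)"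
      by (intro arg_cong2[of _ _ _ _ inner] simple_expansion)
    also have "\<dots> = (\<Sum>k\<in>I. \<Sum>l\<in>I. (fund_coweight k \<bullet> u) * ((fund_coweight l \<bullet> v) * (\<alpha> k \<bullet> \<alpha> l)))"
      unfolding inner_sum_left unfolding inner_sum_right by (simp add: mult.left_commute)
    also have "\<dots> = 0"
      using that orth_simple by (intro sum.neutral ballI) auto
    finally show ?thesis .
  qed
  have split: "(\<forall>k\<in>I - K. fund_coweight k \<bullet> \<gamma> = 0) \<or> (\<forall>k\<in>K. fund_coweight k \<bullet> \<gamma> = 0)"
    if "\<gamma> \<in> roots_of I" "ht \<gamma> > 0" for \<gamma>
    using order_refl that
  proof (induction rule: pos_root_induct)
    case (simple j)
    then show ?case using KI by (cases "j \<in> K") (auto simp: fund_coweight_simple subset_iff)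
  next
    case (step j \<gamma>)
    let ?g = "reflection (\<alpha> j) \<gamma>"
    \<comment> \<open>As \<open>?g\<close> and \<open>\<alpha> j\<close> are not orthogonal, j must
      lie on the same side of K as the support of \<open>?g\<close>.\<close>
    have neg: "?g \<bullet> \<alpha> j \<noteq> 0"
    proof -
      have "?g \<bullet> coroot (\<alpha> j) = - (\<gamma> \<bullet> coroot (\<alpha> j))"
        using step.hyps simple_in_roots root_nonzero
        by (simp add: reflection_def inner_diff_left inner_coroot_self)
      then show ?thesis using step.hyps by (auto simp: coroot_def)
    qed
    have g: "fund_coweight k \<bullet> \<gamma> = fund_coweight k \<bullet> ?g" if "k \<in> I" "k \<noteq> j" for k
      using that step.hyps by (simp add: reflection_def inner_diff_right fund_coweight_simple)
    from step.IH show ?case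
    proof
      assume z: "\<forall>k\<in>I - K. fund_coweight k \<bullet> ?g = 0"
      then have "j \<in> K" using orth[of ?g "\<alpha> j"] neg step.hyps KI z by (metis fund_coweight_simple subsetD)
      then show ?thesis using z g by (metis DiffD1 DiffD2)
    next
      assume z: "\<forall>k\<in>K. fund_coweight k \<bullet> ?g = 0"
      then have "j \<in> I - K"
        using orth[of "\<alpha> j" ?g] neg step.hyps KI z by (metis DiffD1 DiffD2 DiffI fund_coweight_simple inner_commute)
      then show ?thesis using z g KI by (metis DiffD2 subsetD)
    qed
  qed
  let ?A = "{\<gamma>\<in>\<Delta>. \<forall>k\<in>I - K. fund_coweight k \<bullet> \<gamma> = 0}" and ?B = "{\<gamma>\<in>\<Delta>. \<forall>k\<in>K. fund_coweight k \<bullet> \<gamma> = 0}"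
  have "?A \<union> ?B = \<Delta>"
  proof -
    have "\<gamma> \<in> ?A \<union> ?B" if "\<gamma> \<in> \<Delta>" for \<gamma>
    proof (cases "ht \<gamma> > 0")
      case True
      then show ?thesis using split[of \<gamma>] that by auto
    next
      case False
      then have "ht (- \<gamma>) > 0" using ht_root_nonzero[OF that] by simp
      then have "(\<forall>k\<in>I - K. fund_coweight k \<bullet> (- \<gamma>) = 0) \<or> (\<forall>k\<in>K. fund_coweight k \<bullet> (- \<gamma>) = 0)"
        using split[of "- \<gamma>"] minus_root[OF that] by simp
      then show ?thesis using that by auto
    qed
    then show ?thesis by blast
  qed
  then have "?A = {} \<or> ?B = {}" by (rule irreducible) (use orth in blast)
  moreover have "highest \<in> ?A" using highest_root K0 by blast
  moreover have "\<alpha> i \<in> ?B" using assms ni KI simple_in_roots by (auto simp: K_def fund_coweight_simple)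
  ultimately show False by blast
qed

text \<open>With \<theta> = \<open>highest\<close>, \<delta> is -\<theta> + \<delta> plus the sum of
  the simple roots with the coefficients of \<theta>, all positive by
  \<open>highest_support\<close>. As \<delta> pairs to zero with \<gamma>, pairings that are all
  nonpositive must all vanish, and then \<gamma> = 0.\<close>

lemma aff_pos_descent:
  assumes "\<beta> \<in> aff_roots" "aff_height \<beta> > 0"
  shows "\<exists>a\<in>aff_simple. fst \<beta> \<bullet> coroot (fst a) > 0"
proof (rule ccontr)
  assume neg: "\<not> ?thesis"
  obtain \<gamma> n where bg: "\<beta> = (\<gamma>, n)" by (cases \<beta>)
  have g: "\<gamma> \<in> \<Delta>" using assms bg by (auto simp: aff_roots_def)
  have s: "\<gamma> \<bullet> \<alpha> i \<le> 0" if "i \<in> I" for i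
  proof -
    have "\<gamma> \<bullet> coroot (\<alpha> i) \<le> 0" using neg that by (force simp: aff_simple_def bg)
    then show ?thesis
      using that simple_in_roots root_nonzero by (auto simp: inner_coroot_nonpos_iff)
  qed
  have "\<gamma> \<bullet> coroot highest \<ge> 0" using neg by (auto simp: aff_simple_def bg coroot_minus not_less)
  then have "\<gamma> \<bullet> highest \<ge> 0"
    using highest_root root_nonzero by (auto simp: inner_coroot_nonneg_iff)
  moreover have eq: "\<gamma> \<bullet> highest = (\<Sum>i\<in>I. (fund_coweight i \<bullet> highest) * (\<gamma> \<bullet> \<alpha> i))"
    by (subst simple_expansion[of highest]) (simp add: inner_sum_right)
  moreover have terms: "(fund_coweight i \<bullet> highest) * (\<gamma> \<bullet> \<alpha> i) \<le> 0" if "i \<in> I" for i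
    using highest_support[OF that] s[OF that] by (simp add: mult_nonneg_nonpos)
  moreover have "(\<Sum>i\<in>I. (fund_coweight i \<bullet> highest) * (\<gamma> \<bullet> \<alpha> i)) \<le> 0"
    using terms by (rule sum_nonpos)
  ultimately have "(\<Sum>i\<in>I. - ((fund_coweight i \<bullet> highest) * (\<gamma> \<bullet> \<alpha> i))) = 0"
    by (simp add: sum_negf)
  then have "\<forall>i\<in>I. - ((fund_coweight i \<bullet> highest) * (\<gamma> \<bullet> \<alpha> i)) = 0"
    using terms by (subst (asm) sum_nonneg_eq_0_iff[OF finite_index]) auto
  then have z: "\<forall>i\<in>I. \<gamma> \<bullet> \<alpha> i = 0" using highest_support by fastforce
  have "\<gamma> \<bullet> \<gamma> = (\<Sum>i\<in>I. (fund_coweight i \<bullet> \<gamma>) * (\<gamma> \<bullet> \<alpha> i))"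
    by (subst (2) simple_expansion[of \<gamma>]) (simp add: inner_sum_right)
  then have "\<gamma> = 0" using z by simp
  then show False using g zero_not_root by simp
qed

lemma aff_pos_induct [consumes 2, case_names simple step]:
  assumes "\<beta> \<in> aff_roots" "aff_height \<beta> > 0"
  and simple: "\<And>a. a \<in> aff_simple \<Longrightarrow> P a"
  and step: "\<And>a \<beta>. a \<in> aff_simple \<Longrightarrow> \<beta> \<in> aff_roots \<Longrightarrow> aff_height \<beta> > 0 \<Longrightarrow> \<beta> \<noteq> a \<Longrightarrow>
     fst \<beta> \<bullet> coroot (fst a) > 0 \<Longrightarrow> arefl a \<beta> \<in> aff_roots \<Longrightarrow> aff_height (arefl a \<beta>) > 0 \<Longrightarrow>
     P (arefl a \<beta>) \<Longrightarrow> P \<beta>"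
  shows "P \<beta>"
  using assms(1,2)
proof (induction "nat \<lfloor>aff_height \<beta>\<rfloor>" arbitrary: \<beta> rule: less_induct)
  case less
  obtain a where a: "a \<in> aff_simple" "fst \<beta> \<bullet> coroot (fst a) > 0"
    using aff_pos_descent less.prems by blast
  show ?case
  proof (cases "\<beta> = a")
    case True
    then show ?thesis using simple a by simp
  next
    case False
    have b: "arefl a \<beta> \<in> aff_roots" "aff_height (arefl a \<beta>) > 0"
      using arefl_root aff_simple_root a less.prems arefl_simple_pos False by auto
    have "aff_height (arefl a \<beta>) < aff_height \<beta>" using a by (simp add: arefl_eq aff_height_diff aff_height_scale aff_height_simple)
    moreover obtain m n where "aff_height (arefl a \<beta>) = of_int m" "aff_height \<beta> = of_int n"
      using aff_height_int[OF b(1)] aff_height_int[OF less.prems(1)] by (auto elim!: Ints_cases)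
    ultimately have "nat \<lfloor>aff_height (arefl a \<beta>)\<rfloor> < nat \<lfloor>aff_height \<beta>\<rfloor>" using b(2) by simp
    from less.hyps[OF this b] show ?thesis using step a less.prems b False by blast
  qed
qed

subsection \<open>The semi-infinite length\<close>

abbreviation lmul :: "'a \<times> real \<Rightarrow> ('a \<Rightarrow> 'a) \<times> 'a \<Rightarrow> ('a \<Rightarrow> 'a) \<times> 'a" where
  "lmul \<beta> \<equiv> aff_mult (aff_reflection \<beta>)"

text \<open>The finite part of the real root \<open>x\<inverse> \<beta>\<close>; its sign tells whether \<open>s\<^sub>\<beta>\<close> raises or lowers \<open>x\<close>.\<close>

definition fin_dir :: "('a \<Rightarrow> 'a) \<times> 'a \<Rightarrow> 'a \<times> real \<Rightarrow> 'a" where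
  "fin_dir x \<beta> = inv (fst x) (fst \<beta>)"

lemma fst_lmul: "fst (lmul \<beta> x) = reflection (fst \<beta>) \<circ> fst x"
  and snd_lmul: "snd (lmul \<beta> x) = inv (fst x) (snd \<beta> *\<^sub>R coroot (fst \<beta>)) + snd x"
  by (simp_all add: aff_mult_def aff_reflection_def)

lemma aff_weylD:
  assumes "x \<in> aff_weyl J"
  shows "fst x \<in> weyl J" "snd x \<in> coroot_lattice J"
  using assms by (auto simp: aff_weyl_def)

lemma aff_weylI: "fst x \<in> weyl J \<Longrightarrow> snd x \<in> coroot_lattice J \<Longrightarrow> x \<in> aff_weyl J"
  by (cases x) (simp add: aff_weyl_def)

lemma aff_weyl_mono: "J \<subseteq> I \<Longrightarrow> x \<in> aff_weyl J \<Longrightarrow> x \<in> aff_weyl I"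
  by (blast intro: aff_weylI aff_weylD weyl_mono coroot_lattice_mono)

lemma root_weyl: "\<gamma> \<in> \<Delta> \<Longrightarrow> reflection \<gamma> \<in> weyl I"
  and root_coroot_lattice: "\<gamma> \<in> \<Delta> \<Longrightarrow> coroot \<gamma> \<in> coroot_lattice I"
  using root_coroot_lattice_weyl[OF order_refl] by simp_all

lemma lmul_weyl:
  assumes "\<beta> \<in> aff_roots" "x \<in> aff_weyl I"
  shows "lmul \<beta> x \<in> aff_weyl I"
proof (rule aff_weylI)
  have b: "fst \<beta> \<in> \<Delta>" "snd \<beta> \<in> \<int>" using assms by (auto simp: aff_roots_def)
  show "fst (lmul \<beta> x) \<in> weyl I"
    unfolding fst_lmul using weyl_comp root_weyl b assms aff_weylD by blast
  have "snd \<beta> *\<^sub>R coroot (fst \<beta>) \<in> coroot_lattice I"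
    using coroot_lattice_scale[OF order_refl b(2) root_coroot_lattice[OF b(1)]] .
  then have "inv (fst x) (snd \<beta> *\<^sub>R coroot (fst \<beta>)) \<in> coroot_lattice I"
    using weyl_coroot_lattice_I[OF weyl_inv[OF aff_weylD(1)[OF assms(2)]]] by blast
  then show "snd (lmul \<beta> x) \<in> coroot_lattice I"
    unfolding snd_lmul using coroot_lattice_add[OF order_refl] aff_weylD(2)[OF assms(2)] by blast
qed

lemma inv_lmul:
  assumes "x \<in> aff_weyl I"
  shows "inv (fst (lmul \<beta> x)) v = inv (fst x) (reflection (fst \<beta>) v)"
proof -
  have "inv (reflection (fst \<beta>) \<circ> fst x) = inv (fst x) \<circ> inv (reflection (fst \<beta>))"
    using assms by (intro o_inv_distrib orthogonal_transformation_bij orthogonal_reflection weyl_bij[OF aff_weylD(1)])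
  then show ?thesis by (simp add: fst_lmul inv_reflection)
qed

lemma weyl_inv_linear: "x \<in> aff_weyl J \<Longrightarrow> linear (inv (fst x))"
  using aff_weylD weyl_inv weyl_linear by blast

lemma lmul_lmul [simp]:
  assumes "x \<in> aff_weyl I"
  shows "lmul \<beta> (lmul \<beta> x) = x"
proof (rule prod_eqI)
  show "fst (lmul \<beta> (lmul \<beta> x)) = fst x" by (simp add: fst_lmul fun_eq_iff)
  have l: "linear (inv (fst x))" using weyl_inv_linear assms by blast
  have "reflection (fst \<beta>) (coroot (fst \<beta>)) = - coroot (fst \<beta>)"
    using coroot_reflection[of "fst \<beta>" "fst \<beta>"] by (simp add: reflection_self coroot_minus)
  then show "snd (lmul \<beta> (lmul \<beta> x)) = snd x"
    unfolding snd_lmul[of _ "lmul \<beta> x"] inv_lmul[OF assms]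
    by (simp add: snd_lmul linear_scale[OF linear_reflection] linear_neg[OF l] linear_scale[OF l])
qed

lemma lmul_conj:
  assumes "x \<in> aff_weyl I"
  shows "lmul a (lmul \<beta> x) = lmul (arefl a \<beta>) (lmul a x)"
proof (rule prod_eqI)
  have f: "fst (arefl a \<beta>) = reflection (fst a) (fst \<beta>)"
    by (simp add: aff_act_def aff_reflection_def)
  have s: "snd (arefl a \<beta>) = snd \<beta> - fst \<beta> \<bullet> (snd a *\<^sub>R coroot (fst a))"
    by (simp add: aff_act_def aff_reflection_def)
  show "fst (lmul a (lmul \<beta> x)) = fst (lmul (arefl a \<beta>) (lmul a x))"
    unfolding fst_lmul f
    by (simp add: fun_eq_iff reflection_orthogonal[OF orthogonal_reflection])
  have l: "linear (inv (fst x))" using weyl_inv_linear assms by blast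
  have "reflection (fst a) (coroot (reflection (fst a) (fst \<beta>))) = coroot (fst \<beta>)"
    by (simp add: coroot_reflection)
  then show "snd (lmul a (lmul \<beta> x)) = snd (lmul (arefl a \<beta>) (lmul a x))"
    unfolding snd_lmul[of _ "lmul _ x"] inv_lmul[OF assms] f s
    by (simp add: snd_lmul linear_scale[OF linear_reflection] linear_diff[OF linear_reflection] reflection_coroot[of "fst \<beta>"]
        linear_diff[OF l] linear_scale[OF l] algebra_simps scaleR_diff_left scaleR_diff_right)
qed

lemma act_lmul:
  assumes "x \<in> aff_weyl I"
  shows "aff_act (lmul a x) \<beta> = arefl a (aff_act x \<beta>)"
proof -
  have "fst \<beta> \<bullet> inv (fst x) v = fst x (fst \<beta>) \<bullet> v" for v
    using weyl_inv_inner[OF aff_weylD(1)[OF assms], of v "fst \<beta>"] by (simp add: inner_commute)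
  then show ?thesis
    using assms by (simp add: aff_act_def[of "lmul _ _"] fst_lmul snd_lmul)
      (simp add: aff_act_def aff_reflection_def inner_add_right)
qed

lemma act_root:
  assumes "x \<in> aff_weyl I" "\<beta> \<in> aff_roots"
  shows "aff_act x \<beta> \<in> aff_roots"
  using assms weyl_root root_coroot_lattice_int
  by (auto simp: aff_roots_def aff_act_def aff_weyl_def)

lemma fin_dir_root:
  assumes "x \<in> aff_weyl I" "\<beta> \<in> aff_roots"
  shows "fin_dir x \<beta> \<in> \<Delta>"
  using weyl_root[OF weyl_inv[OF aff_weylD(1)[OF assms(1)]]] assms(2) by (auto simp: fin_dir_def aff_roots_def)

text \<open>Multiplying x by s_a and applying s_a to \<beta> cancel in x^{-1} \<beta>. Hence
  conjugation turns a raising reflection into a raising one as long as the conjugated root is still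
  positive.\<close>

lemma fin_dir_lmul:
  assumes "x \<in> aff_weyl I"
  shows "fin_dir (lmul a x) (arefl a \<beta>) = fin_dir x \<beta>"
  unfolding fin_dir_def inv_lmul[OF assms] by (simp add: aff_act_def aff_reflection_def)

lemma fin_dir_lmul_self:
  assumes "x \<in> aff_weyl I"
  shows "fin_dir (lmul a x) a = - fin_dir x a"
  unfolding fin_dir_def inv_lmul[OF assms]
  using linear_neg[OF weyl_inv_linear[OF assms]] by (simp add: reflection_self)

text \<open>The argument of \<open>aff_act x\<close> is x^{-1} \<beta> written out: its
  \<delta>-coefficient restores what the translation part of x takes away.\<close>

lemma act_fin_dir:
  assumes "x \<in> aff_weyl I"
  shows "aff_act x (fin_dir x \<beta>, snd \<beta> + fin_dir x \<beta> \<bullet> snd x) = \<beta>"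
  using weyl_f_inv[OF aff_weylD(1)[OF assms]] by (simp add: aff_act_def fin_dir_def)

text \<open>A reflection on the left of x is the reflection in x^{-1} \<beta> on its right. The
  pairings with the translation part of x cancel, so only the \<delta>-coefficient of \<beta> itself
  appears.\<close>

lemma lmul_right:
  assumes x: "x \<in> aff_weyl I"
  shows "lmul \<beta> x = (fst x \<circ> reflection (fin_dir x \<beta>), snd x + snd \<beta> *\<^sub>R coroot (fin_dir x \<beta>))"
proof (rule prod_eqI)
  have w: "fst x \<in> weyl I" using x aff_weylD by blast
  have b: "fst \<beta> = fst x (fin_dir x \<beta>)" using w by (simp add: fin_dir_def)
  show "fst (lmul \<beta> x) = fst (fst x \<circ> reflection (fin_dir x \<beta>), snd x + snd \<beta> *\<^sub>R coroot (fin_dir x \<beta>))"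
    unfolding fst_lmul by (subst b) (simp only: reflection_comp_orthogonal[OF weyl_orthogonal[OF w]] fst_conv)
  have "inv (fst x) (coroot (fst \<beta>)) = coroot (fin_dir x \<beta>)"
    using w by (subst b) (simp add: coroot_orthogonal[OF weyl_orthogonal[OF w]])
  then show "snd (lmul \<beta> x) = snd (fst x \<circ> reflection (fin_dir x \<beta>), snd x + snd \<beta> *\<^sub>R coroot (fin_dir x \<beta>))"
    using linear_scale[OF weyl_inv_linear[OF x]] by (simp add: snd_lmul add.commute)
qed

text \<open>\<open>crossing x \<gamma>\<close> is the least integer \<open>n\<close> for which \<open>x\<close> maps \<open>\<gamma> + n\<delta>\<close> to a positive root.\<close>

definition crossing :: "('a \<Rightarrow> 'a) \<times> 'a \<Rightarrow> 'a \<Rightarrow> real" where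
  "crossing x \<gamma> = (if ht (fst x \<gamma>) < 0 then 1 else 0) + \<gamma> \<bullet> snd x"

text \<open>Another form of \<open>si_len\<close>, by \<open>si_len_eq\<close>. Each term depends
  only on which affine roots x makes positive, so the change under a reflection can be studied term
  by term, without words.\<close>

definition slen :: "('a \<Rightarrow> 'a) \<times> 'a \<Rightarrow> real" where
  "slen x = (\<Sum>\<gamma>\<in>pos_roots. crossing x \<gamma>)"

lemma crossing_int: "x \<in> aff_weyl I \<Longrightarrow> \<gamma> \<in> \<Delta> \<Longrightarrow> crossing x \<gamma> \<in> \<int>"
  by (auto simp: crossing_def intro!: Ints_add root_coroot_lattice_int aff_weylD)

lemma crossing_le_iff:
  assumes "x \<in> aff_weyl I" "\<gamma> \<in> \<Delta>" "n \<in> \<int>"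
  shows "crossing x \<gamma> \<le> n \<longleftrightarrow> aff_height (aff_act x (\<gamma>, n)) > 0"
proof -
  have g: "fst x \<gamma> \<in> \<Delta>" using assms aff_weylD weyl_root by blast
  have gx: "\<gamma> \<bullet> snd x \<in> \<int>" using assms aff_weylD root_coroot_lattice_int by blast
  have "aff_height (aff_act x (\<gamma>, n)) > 0 \<longleftrightarrow> n - \<gamma> \<bullet> snd x > 0 \<or> n - \<gamma> \<bullet> snd x = 0 \<and> ht (fst x \<gamma>) > 0"
    unfolding aff_act_def using aff_height_pos_iff[OF g] assms gx by simp
  moreover obtain k m where "n = of_int k" "\<gamma> \<bullet> snd x = of_int m"
    using assms gx by (auto elim!: Ints_cases)
  ultimately show ?thesis
    using ht_root_nonzero[OF g] by (auto simp: crossing_def)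
qed

lemma finite_pos_roots: "finite pos_roots"
  using finite_roots by (simp add: pos_roots_def)

lemma pos_root_root: "\<gamma> \<in> pos_roots \<Longrightarrow> \<gamma> \<in> \<Delta>"
  by (simp add: pos_roots_def)

lemma Ints_le_antisym:
  fixes p q :: real
  assumes "p \<in> \<int>" "q \<in> \<int>" "\<And>n. n \<in> \<int> \<Longrightarrow> p \<le> n \<longleftrightarrow> q \<le> n"
  shows "p = q"
  using assms(3)[OF assms(1)] assms(3)[OF assms(2)] by simp

text \<open>The root x^{-1} \<beta>, whose finite part is \<gamma>, is sent to \<beta> by x and to
  -\<beta> by s_\<beta> x, so its \<delta>-coefficient \<open>?k\<close> separates the two
  thresholds.\<close>

lemma crossing_lmul_fin_dir:
  assumes x: "x \<in> aff_weyl I" and b: "\<beta> \<in> aff_roots" "aff_height \<beta> > 0"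
  defines "\<gamma> \<equiv> fin_dir x \<beta>"
  shows "crossing x \<gamma> < crossing (lmul \<beta> x) \<gamma>"
proof -
  let ?k = "snd \<beta> + \<gamma> \<bullet> snd x"
  have g: "\<gamma> \<in> \<Delta>" using fin_dir_root x b \<gamma>_def by blast
  have k: "?k \<in> \<int>" using b g x aff_weylD root_coroot_lattice_int by (auto simp: aff_roots_def)
  have "crossing x \<gamma> \<le> ?k"
    unfolding crossing_le_iff[OF x g k] using b act_fin_dir[OF x, of \<beta>] by (simp add: \<gamma>_def)
  moreover have "\<not> crossing (lmul \<beta> x) \<gamma> \<le> ?k"
    unfolding crossing_le_iff[OF lmul_weyl[OF b(1) x] g k] act_lmul[OF x]
    using b act_fin_dir[OF x, of \<beta>] by (simp add: \<gamma>_def arefl_self)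
  ultimately show ?thesis by simp
qed

text \<open>The change of \<open>crossing\<close> under \<open>s\<^sub>\<beta>\<close> is antisymmetric under \<open>s\<^sub>\<gamma>\<close>, where \<open>\<gamma>\<close> is the direction of
  the reflection seen from the right. So only the inversions of \<open>s\<^sub>\<gamma>\<close> contribute to the sum.\<close>

lemma slen_lmul_less:
  assumes x: "x \<in> aff_weyl I" and b: "\<beta> \<in> aff_roots" "aff_height \<beta> > 0" and up: "ht (fin_dir x \<beta>) > 0"
  shows "slen x + 1 \<le> slen (lmul \<beta> x)"
proof -
  define \<gamma> where "\<gamma> = fin_dir x \<beta>"
  define D where "D \<epsilon> = crossing (lmul \<beta> x) \<epsilon> - crossing x \<epsilon>" for \<epsilon>
  let ?s = "reflection \<gamma>"
  have g: "\<gamma> \<in> \<Delta>" using fin_dir_root x b \<gamma>_def by blast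
  have y: "lmul \<beta> x \<in> aff_weyl I" using lmul_weyl x b by blast
  have w: "fst x \<in> weyl I" using x aff_weylD by blast
  have bg: "fst \<beta> = fst x \<gamma>" unfolding \<gamma>_def fin_dir_def using w by simp
  have lm: "lmul \<beta> x = (fst x \<circ> ?s, snd x + snd \<beta> *\<^sub>R coroot \<gamma>)"
    unfolding \<gamma>_def by (rule lmul_right[OF x])
  have Ds: "D (?s \<epsilon>) = - D \<epsilon>" for \<epsilon>
  proof -
    have "?s \<epsilon> \<bullet> coroot \<gamma> = - (\<epsilon> \<bullet> coroot \<gamma>)"
      using inner_coroot_self[OF root_nonzero[OF g]] by (simp add: reflection_def inner_diff_left)
    then show ?thesis
      unfolding D_def crossing_def lm by (simp add: inner_add_right)
  qed
  have Dpos: "D \<epsilon> \<ge> 0" if e: "\<epsilon> \<in> \<Delta>" "\<epsilon> \<bullet> coroot \<gamma> \<ge> 0" for \<epsilon>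
  proof -
    let ?n = "crossing (lmul \<beta> x) \<epsilon>"
    have n: "?n \<in> \<int>" using crossing_int[OF y e(1)] .
    have "aff_height (aff_act (lmul \<beta> x) (\<epsilon>, ?n)) > 0" using crossing_le_iff[OF y e(1) n] by simp
    \<comment> \<open>The images of a root under x and under s_\<beta> x differ by a multiple of
      \<beta>, and the height of that multiple is nonnegative when the pairing is.\<close>
    then have "aff_height (aff_act x (\<epsilon>, ?n)) > (fst x \<epsilon> \<bullet> coroot (fst \<beta>)) * aff_height \<beta>"
      unfolding act_lmul[OF x] arefl_eq by (simp add: aff_height_diff aff_height_scale) (simp add: aff_act_def)
    moreover have "fst x \<epsilon> \<bullet> coroot (fst \<beta>) = \<epsilon> \<bullet> coroot \<gamma>"
      unfolding bg coroot_orthogonal[OF weyl_orthogonal[OF w]] using weyl_inner[OF w] .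
    ultimately have "aff_height (aff_act x (\<epsilon>, ?n)) > 0"
      using mult_nonneg_nonneg[OF e(2) less_imp_le[OF b(2)]] by simp
    then show ?thesis using crossing_le_iff[OF x e(1) n] by (simp add: D_def)
  qed
  have D1: "D \<gamma> \<ge> 1"
  proof -
    have "D \<gamma> > 0" using crossing_lmul_fin_dir[OF x b] by (simp add: D_def \<gamma>_def)
    moreover have "D \<gamma> \<in> \<int>" unfolding D_def using crossing_int x y g by (intro Ints_diff)
    ultimately show ?thesis by (auto elim!: Ints_cases)
  qed
  let ?A = "{\<epsilon>\<in>pos_roots. ?s \<epsilon> \<in> pos_roots}" and ?B = "{\<epsilon>\<in>pos_roots. ?s \<epsilon> \<notin> pos_roots}"
  have "(\<Sum>\<epsilon>\<in>?A. D \<epsilon>) = (\<Sum>\<epsilon>\<in>?A. D (?s \<epsilon>))"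
    by (rule sum.reindex_bij_witness[of _ ?s ?s]) auto
  then have A: "(\<Sum>\<epsilon>\<in>?A. D \<epsilon>) = 0" by (simp add: Ds sum_negf)
  have gB: "\<gamma> \<in> ?B" using up g by (auto simp: \<gamma>_def[symmetric] pos_roots_iff reflection_self)
  have Bpos: "D \<epsilon> \<ge> 0" if e: "\<epsilon> \<in> ?B" for \<epsilon>
  proof (rule Dpos)
    show "\<epsilon> \<in> \<Delta>" using e pos_root_root by blast
    then have "?s \<epsilon> \<in> \<Delta>" using reflection_root g by blast
    then have "ht (?s \<epsilon>) \<le> 0" "ht \<epsilon> > 0" using e by (auto simp: pos_roots_iff)
    then have "(\<epsilon> \<bullet> coroot \<gamma>) * ht \<gamma> > 0" by (simp add: reflection_def ht_diff ht_scale)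
    then show "\<epsilon> \<bullet> coroot \<gamma> \<ge> 0" using up by (simp add: \<gamma>_def[symmetric] zero_less_mult_iff)
  qed
  have "D \<gamma> \<le> (\<Sum>\<epsilon>\<in>?B. D \<epsilon>)"
    using gB Bpos finite_pos_roots by (intro member_le_sum) auto
  then have B: "(\<Sum>\<epsilon>\<in>?B. D \<epsilon>) \<ge> 1" using D1 by simp
  have "slen (lmul \<beta> x) - slen x = (\<Sum>\<epsilon>\<in>pos_roots. D \<epsilon>)"
    by (simp add: slen_def D_def sum_subtractf)
  also have "pos_roots = ?A \<union> ?B" by blast
  also have "(\<Sum>\<epsilon>\<in>?A \<union> ?B. D \<epsilon>) = (\<Sum>\<epsilon>\<in>?A. D \<epsilon>) + (\<Sum>\<epsilon>\<in>?B. D \<epsilon>)"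
    using finite_pos_roots by (intro sum.union_disjoint) auto
  finally show ?thesis using A B by simp
qed

text \<open>A simple reflection permutes the positive affine roots other than a, so all thresholds
  except the one at \<gamma> stay. That one is at least \<open>?k\<close> before and at most
  \<open>?k + 1\<close> after, and it grows strictly, so it grows by exactly one.\<close>

lemma slen_lmul_simple:
  assumes x: "x \<in> aff_weyl I" and a: "a \<in> aff_simple" and up: "ht (fin_dir x a) > 0"
  shows "slen (lmul a x) = slen x + 1"
proof -
  define \<gamma> where "\<gamma> = fin_dir x a"
  have ar: "a \<in> aff_roots" using a aff_simple_root by blast
  have g: "\<gamma> \<in> \<Delta>" using fin_dir_root x ar \<gamma>_def by blast
  have gp: "\<gamma> \<in> pos_roots" using g up by (simp add: pos_roots_iff \<gamma>_def)
  have y: "lmul a x \<in> aff_weyl I" using lmul_weyl x ar by blast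
  have w: "fst x \<in> weyl I" using x aff_weylD by blast
  have other: "crossing (lmul a x) \<epsilon> = crossing x \<epsilon>" if e: "\<epsilon> \<in> pos_roots - {\<gamma>}" for \<epsilon>
  proof (rule Ints_le_antisym)
    have ed: "\<epsilon> \<in> \<Delta>" using e pos_root_root by blast
    then show "crossing (lmul a x) \<epsilon> \<in> \<int>" "crossing x \<epsilon> \<in> \<int>" using crossing_int x y by auto
    fix n :: real assume n: "n \<in> \<int>"
    have r: "aff_act x (\<epsilon>, n) \<in> aff_roots" using act_root x ed n by (simp add: aff_roots_def)
    have "inv (fst x) (fst (aff_act x (\<epsilon>, n))) = \<epsilon>" using w by (simp add: aff_act_def)
    moreover have "\<epsilon> \<noteq> \<gamma>" using e by blast
    moreover have "\<epsilon> \<noteq> - \<gamma>" using e gp by (auto simp: pos_roots_iff)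
    moreover have "inv (fst x) (fst (- a)) = - \<gamma>"
      using linear_neg[OF weyl_inv_linear[OF x]] by (simp add: \<gamma>_def fin_dir_def)
    moreover have "inv (fst x) (fst a) = \<gamma>" by (simp add: \<gamma>_def fin_dir_def)
    ultimately have "aff_act x (\<epsilon>, n) \<noteq> a" "aff_act x (\<epsilon>, n) \<noteq> - a" by metis+
    then show "crossing (lmul a x) \<epsilon> \<le> n \<longleftrightarrow> crossing x \<epsilon> \<le> n"
      unfolding crossing_le_iff[OF x ed n] crossing_le_iff[OF y ed n] act_lmul[OF x]
      using arefl_simple_pos_iff[OF a r] by simp
  qed
  let ?k = "snd a + \<gamma> \<bullet> snd x"
  have k: "?k \<in> \<int>" using ar g x aff_weylD root_coroot_lattice_int by (auto simp: aff_roots_def)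
  have k1: "?k - 1 \<in> \<int>" "?k + 1 \<in> \<int>" using k by auto
  \<comment> \<open>x sends \<gamma> + k\<delta> to a. The signs of a - \<delta> here and of
    \<delta> - a below are known because a has height 1 and \<delta> has height at least 2.\<close>
  have "\<not> crossing x \<gamma> \<le> ?k - 1"
  proof -
    have "aff_act x (\<gamma>, ?k - 1) = a - (0, 1)"
      using act_fin_dir[OF x, of a] by (auto simp: aff_act_def \<gamma>_def prod_eq_iff)
    moreover have "aff_height (a - (0, 1)) < 0"
      using aff_height_simple[OF a] coxeter_ge by (simp add: aff_height_diff) (simp add: aff_height_def ht_def)
    ultimately show ?thesis unfolding crossing_le_iff[OF x g k1(1)] by simp
  qed
  moreover have "crossing (lmul a x) \<gamma> \<le> ?k + 1"
  proof -
    have "aff_act x (\<gamma>, ?k + 1) = a + (0, 1)"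
      using act_fin_dir[OF x, of a] by (auto simp: aff_act_def \<gamma>_def prod_eq_iff)
    moreover have "arefl a (a + (0, 1)) = (0, 1) - a"
      using inner_coroot_self[of "fst a"] root_nonzero ar
      by (auto simp: arefl_eq aff_roots_def prod_eq_iff scaleR_2)
    moreover have "aff_height ((0, 1) - a) > 0"
      using aff_height_simple[OF a] coxeter_ge by (simp add: aff_height_diff) (simp add: aff_height_def ht_def)
    ultimately show ?thesis unfolding crossing_le_iff[OF y g k1(2)] act_lmul[OF x] by simp
  qed
  moreover have "crossing x \<gamma> < crossing (lmul a x) \<gamma>"
    using crossing_lmul_fin_dir[OF x ar] aff_height_simple[OF a] by (simp add: \<gamma>_def)
  moreover obtain p q r where "crossing x \<gamma> = of_int p" "crossing (lmul a x) \<gamma> = of_int q" "?k = of_int r"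
    using crossing_int[OF x g] crossing_int[OF y g] k by (auto elim!: Ints_cases)
  ultimately have pqr: "\<not> real_of_int p \<le> real_of_int r - 1" "real_of_int q \<le> real_of_int r + 1"
    "real_of_int p < real_of_int q" "crossing x \<gamma> = of_int p" "crossing (lmul a x) \<gamma> = of_int q"
    by metis+
  then have "r - 1 < p" "q \<le> r + 1" "p < q" by linarith+
  then have "crossing (lmul a x) \<gamma> = crossing x \<gamma> + 1" using pqr(4,5) by simp
  then show ?thesis
    unfolding slen_def sum.remove[OF finite_pos_roots gp] using other by simp
qed

section \<open>Inversions and the length of finite Weyl group elements\<close>

definition inversions :: "('a \<Rightarrow> 'a) \<Rightarrow> nat" where
  "inversions w = card {\<gamma>\<in>pos_roots. ht (w \<gamma>) < 0}"

lemma slen_eq: "slen x = real (inversions (fst x)) + 2 * (\<rho> \<bullet> snd x)"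
proof -
  have "(\<Sum>\<gamma>\<in>pos_roots. if ht (fst x \<gamma>) < 0 then 1 else 0 :: real) = real (inversions (fst x))"
    using finite_pos_roots by (simp add: inversions_def sum.If_cases Int_def)
  moreover have "(\<Sum>\<gamma>\<in>pos_roots. \<gamma> \<bullet> snd x) = 2 * (\<rho> \<bullet> snd x)"
    by (simp add: \<rho>_def inner_sum_left)
  ultimately show ?thesis by (simp add: slen_def crossing_def sum.distrib)
qed

lemma weyl_aff: "w \<in> weyl I \<Longrightarrow> (w, 0) \<in> aff_weyl I"
  by (simp add: aff_weyl_def coroot_lattice_zero)

text \<open>This is \<open>slen_lmul_simple\<close> at translation part 0, where only the inversions
  remain in \<open>slen\<close>; applied to the product it gives the descending case.\<close>

lemma inversions_simple:
  assumes w: "w \<in> weyl I" and i: "i \<in> I"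
  shows "ht (inv w (\<alpha> i)) > 0 \<Longrightarrow> inversions (reflection (\<alpha> i) \<circ> w) = Suc (inversions w)"
    and "ht (inv w (\<alpha> i)) < 0 \<Longrightarrow> inversions w = Suc (inversions (reflection (\<alpha> i) \<circ> w))"
proof -
  let ?a = "(\<alpha> i, 0 :: real)" and ?v = "reflection (\<alpha> i) \<circ> w"
  have a: "?a \<in> aff_simple" using i by (auto simp: aff_simple_def)
  have *: "inversions (reflection (\<alpha> i) \<circ> u) = Suc (inversions u)"
    if "ht (inv u (\<alpha> i)) > 0" "u \<in> weyl I" for u
  proof -
    have "linear (inv u)" using that weyl_inv weyl_linear by blast
    then have "lmul ?a (u, 0) = (reflection (\<alpha> i) \<circ> u, 0)"
      by (simp add: aff_mult_def aff_reflection_def linear_0)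
    then have "slen (reflection (\<alpha> i) \<circ> u, 0) = slen (u, 0) + 1"
      using slen_lmul_simple[OF weyl_aff[OF that(2)] a] that by (simp add: fin_dir_def)
    then show ?thesis by (simp add: slen_eq)
  qed
  show "ht (inv w (\<alpha> i)) > 0 \<Longrightarrow> inversions ?v = Suc (inversions w)" using * w by blast
  assume neg: "ht (inv w (\<alpha> i)) < 0"
  have v: "?v \<in> weyl I" using weyl_comp weyl_simple w i by blast
  have "inv ?v (\<alpha> i) = - inv w (\<alpha> i)"
    using fin_dir_lmul_self[OF weyl_aff[OF w], of ?a] by (simp add: fin_dir_def fst_lmul)
  then have "inversions (reflection (\<alpha> i) \<circ> ?v) = Suc (inversions ?v)" using neg v * by simp
  moreover have "reflection (\<alpha> i) \<circ> ?v = w" by (simp add: fun_eq_iff)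
  ultimately show "inversions w = Suc (inversions ?v)" by simp
qed

lemma inversions_word_le: "is \<in> lists I \<Longrightarrow> inversions (word is) \<le> length is"
proof (induction "is")
  case Nil
  have "{\<gamma>\<in>pos_roots. ht (id \<gamma>) < 0} = {}" by (auto simp: pos_roots_iff)
  then show ?case by (simp only: inversions_def word_Nil card.empty)
next
  case (Cons i "is")
  then have i: "i \<in> I" "is \<in> lists I" by auto
  then have w: "word is \<in> weyl I" by (auto simp: weyl_def)
  have "ht (inv (word is) (\<alpha> i)) \<noteq> 0"
    using w i weyl_inv weyl_root simple_in_roots ht_root_nonzero by blast
  then consider "ht (inv (word is) (\<alpha> i)) > 0" | "ht (inv (word is) (\<alpha> i)) < 0" by linarith
  then have "inversions (reflection (\<alpha> i) \<circ> word is) \<le> Suc (inversions (word is))"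
    by cases (use inversions_simple[OF w i(1)] in linarith)+
  then show ?case unfolding word_Cons length_Cons using Cons.IH[OF i(2)] by linarith
qed

text \<open>A further letter either adds an inversion, and the longer word is still as short as its
  inversions allow, or removes one, and \<open>exchange\<close> deletes a letter. So the inversions
  attain the minimum that \<open>len\<close> asks for.\<close>

lemma reduced_word: "is \<in> lists I \<Longrightarrow> \<exists>js\<in>lists I. word js = word is \<and> length js = inversions (word is)"
proof (induction "is")
  case Nil
  have "length [] = inversions (word [])" using inversions_word_le[of "[]"] by (simp del: word_Nil)
  then show ?case by blast
next
  case (Cons i "is")
  then have i: "i \<in> I" "is \<in> lists I" by auto
  obtain js where js: "js \<in> lists I" "word js = word is" "length js = inversions (word is)"
    using Cons.IH[OF i(2)] by blast
  have w: "word is \<in> weyl I" using i by (auto simp: weyl_def)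
  have nz: "ht (inv (word is) (\<alpha> i)) \<noteq> 0"
    using w i weyl_inv weyl_root simple_in_roots ht_root_nonzero by blast
  show ?case
  proof (cases "ht (inv (word is) (\<alpha> i)) > 0")
    case True
    have "word (i # js) = word (i # is)" using js by simp
    moreover have "length (i # js) = inversions (word (i # is))"
      unfolding word_Cons using inversions_simple(1)[OF w i(1) True] js(3) by (metis length_Cons)
    moreover have "i # js \<in> lists I" using i js by simp
    ultimately show ?thesis by blast
  next
    case False
    then have neg: "ht (inv (word js) (\<alpha> i)) < 0" using nz js by simp
    then have "ht (word (rev js) (\<alpha> i)) < 0" by (simp add: inv_word)
    then obtain ks where ks: "ks \<in> lists I" "Suc (length ks) = length js"
      "reflection (\<alpha> i) \<circ> word js = word ks"
      using exchange[OF order_refl simple_in_roots[OF i(1)] _ js(1)] i by auto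
    have "inversions (word is) = Suc (inversions (word (i # is)))"
      using inversions_simple(2)[OF w i(1)] neg js by simp
    then have "length ks = inversions (word (i # is))" using ks js by simp
    moreover have "word ks = word (i # is)" using ks(3) js by simp
    ultimately show ?thesis using ks by blast
  qed
qed

lemma len_eq: "w \<in> weyl I \<Longrightarrow> len w = inversions w"
  unfolding len_def
proof (rule Least_equality)
  assume "w \<in> weyl I"
  then show "\<exists>is\<in>lists I. length is = inversions w \<and> word is = w"
    unfolding weyl_def using reduced_word by (metis imageE)
qed (use inversions_word_le in blast)

lemma inversions_0:
  assumes "w \<in> weyl I" "inversions w = 0"
  shows "w = id"
  using assms reduced_word by (force simp: weyl_def)

lemma si_len_eq: "x \<in> aff_weyl I \<Longrightarrow> si_len x = slen x"
  using aff_weylD by (simp add: si_len_def slen_eq len_eq)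

subsection \<open>The lifting property\<close>

abbreviation si_less_eq :: "('a \<Rightarrow> 'a) \<times> 'a \<Rightarrow> ('a \<Rightarrow> 'a) \<times> 'a \<Rightarrow> bool" where
  "si_less_eq \<equiv> si_le {}"

definition ascent :: "'a \<times> real \<Rightarrow> ('a \<Rightarrow> 'a) \<times> 'a \<Rightarrow> bool" where
  "ascent a x \<longleftrightarrow> ht (fin_dir x a) > 0"

text \<open>With the smaller and the larger of x and s_a x as functions, all cases of the lifting
  property become one statement: \<open>lower a\<close> and \<open>upper a\<close> are
  monotone.\<close>

definition lower :: "'a \<times> real \<Rightarrow> ('a \<Rightarrow> 'a) \<times> 'a \<Rightarrow> ('a \<Rightarrow> 'a) \<times> 'a" where
  "lower a x = (if ascent a x then x else lmul a x)"

definition upper :: "'a \<times> real \<Rightarrow> ('a \<Rightarrow> 'a) \<times> 'a \<Rightarrow> ('a \<Rightarrow> 'a) \<times> 'a" where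
  "upper a x = (if ascent a x then lmul a x else x)"

lemma aff_min_reps_empty: "aff_min_reps {} = aff_weyl I"
  by (simp add: aff_min_reps_def aff_pos_roots_def)

lemma si_le_weyl: "si_less_eq x y \<Longrightarrow> x \<in> aff_weyl I" "si_less_eq x y \<Longrightarrow> y \<in> aff_weyl I"
  by (simp_all add: si_le_def aff_min_reps_empty)

lemma si_le_refl: "x \<in> aff_weyl I \<Longrightarrow> si_less_eq x x"
  by (simp add: si_le_def aff_min_reps_empty)

lemma si_le_trans [trans]: "si_less_eq x y \<Longrightarrow> si_less_eq y z \<Longrightarrow> si_less_eq x z"
  by (auto simp: si_le_def)

lemma fin_dir_nonzero:
  assumes "x \<in> aff_weyl I" "\<beta> \<in> aff_roots"
  shows "ht (fin_dir x \<beta>) \<noteq> 0"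
  using fin_dir_root[OF assms] ht_root_nonzero by blast

text \<open>In a lowering direction \<open>slen_lmul_less\<close> would apply to the reverse
  reflection, so the length condition of an edge already fixes the direction.\<close>

lemma edge_fin_dir:
  assumes x: "x \<in> aff_weyl I" and b: "\<beta> \<in> aff_roots" "aff_height \<beta> > 0"
    and l: "si_len (lmul \<beta> x) = si_len x + 1"
  shows "ht (fin_dir x \<beta>) > 0"
proof (rule ccontr)
  assume "\<not> ?thesis"
  then have "ht (fin_dir (lmul \<beta> x) \<beta>) > 0"
    using fin_dir_nonzero[OF x b(1)] fin_dir_lmul_self[OF x] by simp
  then have "slen (lmul \<beta> x) + 1 \<le> slen x"
    using slen_lmul_less[OF lmul_weyl[OF b(1) x] b] x by simp
  then show False using l si_len_eq lmul_weyl[OF b(1) x] x by simp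
qed

lemma si_le_edge:
  assumes x: "x \<in> aff_weyl I" and b: "\<beta> \<in> aff_roots" "aff_height \<beta> > 0"
    and l: "slen (lmul \<beta> x) = slen x + 1"
  shows "si_less_eq x (lmul \<beta> x)"
proof -
  have y: "lmul \<beta> x \<in> aff_weyl I" using lmul_weyl x b by blast
  then have "(x, lmul \<beta> x) \<in> si_edges {}"
    unfolding si_edges_def aff_min_reps_empty mem_Collect_eq
    using x b l by (intro exI[of _ x] exI[of _ \<beta>]) (simp add: si_len_eq aff_pos_I_iff)
  then show ?thesis
    using x y by (auto simp: si_le_def aff_min_reps_empty)
qed

lemma si_le_induct [consumes 1, case_names refl edge]:
  assumes le: "si_less_eq x y"
    and refl: "P x"
    and edge: "\<And>y \<beta>. si_less_eq x y \<Longrightarrow> y \<in> aff_weyl I \<Longrightarrow> \<beta> \<in> aff_roots \<Longrightarrow> aff_height \<beta> > 0 \<Longrightarrow>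
      ht (fin_dir y \<beta>) > 0 \<Longrightarrow> slen (lmul \<beta> y) = slen y + 1 \<Longrightarrow> P y \<Longrightarrow> P (lmul \<beta> y)"
  shows "P y"
proof -
  have x: "x \<in> aff_weyl I" using si_le_weyl le by blast
  have "(x, y) \<in> (si_edges {})\<^sup>*" using le by (simp add: si_le_def)
  then show ?thesis
  proof (induction rule: rtrancl_induct)
    case base
    then show ?case by (rule refl)
  next
    case (step y z)
    from step(2) obtain \<beta> where z: "z = lmul \<beta> y" and b: "\<beta> \<in> aff_roots" "aff_height \<beta> > 0"
      and y: "y \<in> aff_weyl I" and l: "si_len z = si_len y + 1"
      by (auto simp: si_edges_def aff_min_reps_empty aff_pos_I_iff)
    have "si_less_eq x y" using step(1) x y by (simp add: si_le_def aff_min_reps_empty)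
    moreover have "slen z = slen y + 1" using l z lmul_weyl[OF b(1) y] y by (simp add: si_len_eq)
    moreover have "ht (fin_dir y \<beta>) > 0" using edge_fin_dir[OF y b] l z by simp
    ultimately show ?case using edge y b step.IH z by blast
  qed
qed

lemma ascent_lmul:
  assumes "x \<in> aff_weyl I" "a \<in> aff_simple"
  shows "ascent a (lmul a x) \<longleftrightarrow> \<not> ascent a x"
  using fin_dir_nonzero[OF assms(1) aff_simple_root[OF assms(2)]] fin_dir_lmul_self[OF assms(1)]
  by (auto simp: ascent_def)

lemma slen_ascent:
  assumes "x \<in> aff_weyl I" "a \<in> aff_simple"
  shows "ascent a x \<Longrightarrow> slen (lmul a x) = slen x + 1"
    and "\<not> ascent a x \<Longrightarrow> slen x = slen (lmul a x) + 1"
proof -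
  show "ascent a x \<Longrightarrow> slen (lmul a x) = slen x + 1"
    using slen_lmul_simple assms by (simp add: ascent_def)
  assume "\<not> ascent a x"
  then have "ascent a (lmul a x)" using ascent_lmul assms by blast
  then have "slen (lmul a (lmul a x)) = slen (lmul a x) + 1"
    using slen_lmul_simple[OF lmul_weyl[OF aff_simple_root[OF assms(2)] assms(1)] assms(2)]
    by (simp add: ascent_def)
  then show "slen x = slen (lmul a x) + 1" using assms by simp
qed

lemma si_le_lmul_simple:
  assumes "x \<in> aff_weyl I" "a \<in> aff_simple"
  shows "ascent a x \<Longrightarrow> si_less_eq x (lmul a x)" "\<not> ascent a x \<Longrightarrow> si_less_eq (lmul a x) x"
proof -
  have a: "a \<in> aff_roots" "aff_height a > 0" using assms aff_simple_root aff_height_simple by auto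
  show "ascent a x \<Longrightarrow> si_less_eq x (lmul a x)"
    using si_le_edge[OF assms(1) a] slen_ascent[OF assms] by blast
  assume "\<not> ascent a x"
  then have "si_less_eq (lmul a x) (lmul a (lmul a x))"
    using si_le_edge[OF lmul_weyl[OF a(1) assms(1)] a] slen_ascent[OF assms] assms by simp
  then show "si_less_eq (lmul a x) x" using assms by simp
qed

lemma lower_le: "x \<in> aff_weyl I \<Longrightarrow> a \<in> aff_simple \<Longrightarrow> si_less_eq (lower a x) x"
  and upper_ge: "x \<in> aff_weyl I \<Longrightarrow> a \<in> aff_simple \<Longrightarrow> si_less_eq x (upper a x)"
  using si_le_lmul_simple si_le_refl by (auto simp: lower_def upper_def)

lemma lower_lmul: "x \<in> aff_weyl I \<Longrightarrow> a \<in> aff_simple \<Longrightarrow> lower a (lmul a x) = lower a x"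
  and upper_lmul: "x \<in> aff_weyl I \<Longrightarrow> a \<in> aff_simple \<Longrightarrow> upper a (lmul a x) = upper a x"
  by (simp_all add: lower_def upper_def ascent_lmul)

text \<open>For \<open>\<beta> \<noteq> a\<close> the conjugated reflection has the same direction and still belongs to a positive root, so
  it leads upwards from \<open>s\<^sub>a x\<close> to \<open>s\<^sub>a y\<close>, where \<open>y = s\<^sub>\<beta> x\<close>. Comparing lengths, either this is an
  edge, or \<open>s\<^sub>a x < x < y < s\<^sub>a y\<close>.\<close>

lemma lifting_edge:
  assumes x: "x \<in> aff_weyl I" and a: "a \<in> aff_simple"
    and b: "\<beta> \<in> aff_roots" "aff_height \<beta> > 0" "ht (fin_dir x \<beta>) > 0" and l: "slen (lmul \<beta> x) = slen x + 1"
  shows "si_less_eq (lower a x) (lower a (lmul \<beta> x)) \<and> si_less_eq (upper a x) (upper a (lmul \<beta> x))"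
proof (cases "\<beta> = a")
  case True
  then have "ascent a x" using b by (simp add: ascent_def)
  then have "lower a x = lower a (lmul \<beta> x)" "upper a x = upper a (lmul \<beta> x)"
    using True x a by (simp_all add: lower_lmul upper_lmul)
  then show ?thesis
    using si_le_refl si_le_weyl lower_le[OF x a] upper_ge[OF x a] by metis
next
  case False
  let ?y = "lmul \<beta> x" and ?b = "arefl a \<beta>"
  have y: "?y \<in> aff_weyl I" using lmul_weyl b x by blast
  have ar: "a \<in> aff_roots" using a aff_simple_root by blast
  have ax: "lmul a x \<in> aff_weyl I" using lmul_weyl ar x by blast
  have bb: "?b \<in> aff_roots" "aff_height ?b > 0" using arefl_root ar b arefl_simple_pos a False by blast+
  have eq: "lmul a ?y = lmul ?b (lmul a x)" using lmul_conj x by blast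
  have "slen (lmul a x) + 1 \<le> slen (lmul a ?y)"
    unfolding eq using slen_lmul_less[OF ax bb] fin_dir_lmul[OF x] b by simp
  moreover have e: "si_less_eq x ?y" using si_le_edge x b l by blast
  moreover have "si_less_eq (lmul a x) (lmul a ?y)" if "slen (lmul a ?y) = slen (lmul a x) + 1"
    using si_le_edge[OF ax bb] that eq by simp
  moreover have "si_less_eq (lmul a x) ?y" if "\<not> ascent a x"
    using si_le_lmul_simple(2)[OF x a that] e si_le_trans by blast
  moreover have "si_less_eq x (lmul a ?y)" if "ascent a ?y"
    using si_le_lmul_simple(1)[OF y a that] e si_le_trans by blast
  \<comment> \<open>Otherwise s_a y would have the length of x, yet it is longer than s_a x, which
    is longer than x. So the only mixed case is x descending and y ascending.\<close>
  moreover have "ascent a ?y" if "ascent a x"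
    using calculation(1) slen_ascent(1)[OF x a that] slen_ascent(2)[OF y a] l by fastforce
  moreover have "slen (lmul a ?y) = slen (lmul a x) + 1" if "ascent a x \<longleftrightarrow> ascent a ?y"
    using slen_ascent[OF x a] slen_ascent[OF y a] l that by (cases "ascent a x") auto
  ultimately show ?thesis
    unfolding lower_def upper_def by (cases "ascent a x"; cases "ascent a ?y") simp_all
qed

lemma lifting:
  assumes "si_less_eq x y" "a \<in> aff_simple"
  shows "si_less_eq (lower a x) (lower a y)" "si_less_eq (upper a x) (upper a y)"
proof -
  have x: "x \<in> aff_weyl I" using si_le_weyl assms by blast
  have "si_less_eq (lower a x) (lower a y) \<and> si_less_eq (upper a x) (upper a y)"
    using assms(1)
  proof (induction rule: si_le_induct)
    case refl
    then show ?case using si_le_refl si_le_weyl lower_le[OF x assms(2)] upper_ge[OF x assms(2)] by blast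
  next
    case (edge y \<beta>)
    then show ?case using lifting_edge[OF edge(2) assms(2)] si_le_trans by blast
  qed
  then show "si_less_eq (lower a x) (lower a y)" "si_less_eq (upper a x) (upper a y)" by auto
qed

text \<open>The length may grow by more than one, so this reaches beyond edges. Conjugation by s_a
  makes \<beta> lower, and the comparison of s_a x with s_a y is carried back by
  \<open>lifting\<close>. If a raises x, then x lies below \<open>lower a y\<close>, hence below y;
  if a lowers x, it also lowers y, and x and y are the upper elements.\<close>

lemma si_le_reflection:
  assumes "x \<in> aff_weyl I" "\<beta> \<in> aff_roots" "aff_height \<beta> > 0" "ht (fin_dir x \<beta>) > 0"
  shows "si_less_eq x (lmul \<beta> x)"
  using assms(2,3,1,4)
proof (induction arbitrary: x rule: aff_pos_induct)
  case (simple a)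
  then show ?case using si_le_lmul_simple(1) by (simp add: ascent_def)
next
  case (step a \<beta>)
  note x = step.prems(1)
  let ?y = "lmul \<beta> x"
  have y: "?y \<in> aff_weyl I" using lmul_weyl step x by blast
  have ax: "lmul a x \<in> aff_weyl I" "lmul a ?y \<in> aff_weyl I"
    using lmul_weyl aff_simple_root step x y by blast+
  have "si_less_eq (lmul a x) (lmul (arefl a \<beta>) (lmul a x))"
    using step ax fin_dir_lmul[OF x] by metis
  then have "si_less_eq (lmul a x) (lmul a ?y)" using lmul_conj[OF x] by simp
  then have l: "si_less_eq (lower a x) (lower a ?y)" "si_less_eq (upper a x) (upper a ?y)"
    using lifting[of "lmul a x" "lmul a ?y" a] lower_lmul upper_lmul x y step by auto
  show ?case
  proof (cases "ascent a x")
    case True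
    then have "si_less_eq x (lower a ?y)" using l by (simp add: lower_def)
    then show ?thesis using lower_le[OF y step(1)] si_le_trans by blast
  next
    case False
    then have ax0: "ht (fin_dir x a) < 0"
      using fin_dir_nonzero[OF x aff_simple_root[OF step(1)]] by (auto simp: ascent_def)
    have lin: "linear (inv (fst x))" using weyl_inv_linear x by blast
    have "fst \<beta> \<in> \<Delta>" "fst a \<in> \<Delta>"
      using step(2) aff_simple_root[OF step(1)] by (auto simp: aff_roots_def)
    then have b0: "fst \<beta> \<noteq> 0" "fst a \<noteq> 0" using root_nonzero by blast+
    \<comment> \<open>The choice of a makes this pairing positive, so the direction of a at
      \<open>?y\<close> is that at x minus a positive multiple of a positive root, and stays
      negative.\<close>
    have "fst a \<bullet> coroot (fst \<beta>) > 0"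
      using step b0 by (simp add: inner_coroot_pos_iff inner_commute)
    then have "(fst a \<bullet> coroot (fst \<beta>)) * ht (fin_dir x \<beta>) > 0"
      using step.prems(2) by (rule mult_pos_pos)
    moreover have "fin_dir ?y a = fin_dir x a - (fst a \<bullet> coroot (fst \<beta>)) *\<^sub>R fin_dir x \<beta>"
      unfolding fin_dir_def inv_lmul[OF x]
      by (simp add: reflection_def linear_diff[OF lin] linear_scale[OF lin])
    ultimately have "ht (fin_dir ?y a) < 0"
      using ax0 by (simp add: ht_diff ht_scale)
    then have "\<not> ascent a ?y" by (simp add: ascent_def)
    then show ?thesis using l False by (simp add: upper_def)
  qed
qed

section \<open>Comparisons by reflections on the right and by translations\<close>

lemma si_le_right_reflection:
  assumes w: "w \<in> weyl I" and xi: "\<xi> \<in> coroot_lattice I" and g: "\<gamma> \<in> pos_roots" and m: "m \<in> \<int>"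
    and pos: "m > 0 \<or> m = 0 \<and> ht (w \<gamma>) > 0"
  shows "si_less_eq (w, \<xi>) (w \<circ> reflection \<gamma>, \<xi> + m *\<^sub>R coroot \<gamma>)"
proof -
  let ?b = "(w \<gamma>, m)"
  have gd: "\<gamma> \<in> \<Delta>" "ht \<gamma> > 0" using g by (auto simp: pos_roots_iff)
  have x: "(w, \<xi>) \<in> aff_weyl I" using w xi by (simp add: aff_weyl_def)
  have wg: "w \<gamma> \<in> \<Delta>" using w gd weyl_root by blast
  have b: "?b \<in> aff_roots" "aff_height ?b > 0" using wg m pos aff_height_pos_iff[OF wg m] by (auto simp: aff_roots_def)
  have f: "fin_dir (w, \<xi>) ?b = \<gamma>" using w by (simp add: fin_dir_def)
  show ?thesis
    using si_le_reflection[OF x b] gd unfolding lmul_right[OF x] f by simp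
qed

text \<open>Translating by a simple coroot is two reflections in \<open>\<alpha> i\<close> on the
  right, with \<delta>-coefficients 0 and 1. The sign of \<open>w (\<alpha> i)\<close> decides their
  order, since coefficient 0 raises only when the image of \<open>\<alpha> i\<close> is
  positive.\<close>

lemma si_le_simple_translation:
  assumes w: "w \<in> weyl I" and xi: "\<xi> \<in> coroot_lattice I" and i: "i \<in> I"
  shows "si_less_eq (w, \<xi>) (w, \<xi> + coroot (\<alpha> i))"
proof -
  have p: "\<alpha> i \<in> pos_roots" using i simple_in_roots by (simp add: pos_roots_iff)
  let ?u = "w \<circ> reflection (\<alpha> i)"
  have u: "?u \<in> weyl I" using w i weyl_comp weyl_simple by blast
  have xi': "\<xi> + coroot (\<alpha> i) \<in> coroot_lattice I"
    using xi i coroot_lattice_add simple_coroot_lattice by blast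
  have uu: "?u \<circ> reflection (\<alpha> i) = w" by (simp add: fun_eq_iff)
  have ua: "?u (\<alpha> i) = - w (\<alpha> i)"
    using linear_neg[OF weyl_linear[OF w]] by (simp add: reflection_self)
  have nz: "ht (w (\<alpha> i)) \<noteq> 0" using w i weyl_root simple_in_roots ht_root_nonzero by blast
  show ?thesis
  proof (cases "ht (w (\<alpha> i)) > 0")
    case True
    have "si_less_eq (w, \<xi>) (?u, \<xi>)"
      using si_le_right_reflection[OF w xi p, of 0] True by simp
    also have "si_less_eq \<dots> (w, \<xi> + coroot (\<alpha> i))"
      using si_le_right_reflection[OF u xi p, of 1] uu by simp
    finally show ?thesis .
  next
    case False
    have "si_less_eq (w, \<xi>) (?u, \<xi> + coroot (\<alpha> i))"
      using si_le_right_reflection[OF w xi p, of 1] by simp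
    also have "si_less_eq \<dots> (w, \<xi> + coroot (\<alpha> i))"
      using si_le_right_reflection[OF u xi' p, of 0] uu ua False nz by simp
    finally show ?thesis .
  qed
qed

lemma si_le_translation:
  assumes w: "w \<in> weyl I" and xi: "\<xi> \<in> coroot_lattice I" and z: "\<zeta> \<in> coroot_lattice I"
    and nn: "\<And>i. i \<in> I \<Longrightarrow> fund_weight i \<bullet> \<zeta> \<ge> 0"
  shows "si_less_eq (w, \<xi>) (w, \<xi> + \<zeta>)"
proof -
  have one: "si_less_eq (w, \<xi>) (w, \<xi> + real k *\<^sub>R coroot (\<alpha> i))"
    if "i \<in> I" "\<xi> \<in> coroot_lattice I" for i k \<xi>
  proof (induction k)
    case 0
    then show ?case using that w si_le_refl by (simp add: aff_weyl_def)
  next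
    case (Suc k)
    have "\<xi> + real k *\<^sub>R coroot (\<alpha> i) \<in> coroot_lattice I"
      using that coroot_lattice_add coroot_lattice_scale simple_coroot_lattice by simp
    from si_le_simple_translation[OF w this that(1)] Suc show ?case
      using si_le_trans by (simp add: algebra_simps)
  qed
  have "si_less_eq (w, \<xi>) (w, \<xi> + (\<Sum>i\<in>K. (fund_weight i \<bullet> \<zeta>) *\<^sub>R coroot (\<alpha> i))) \<and>
      \<xi> + (\<Sum>i\<in>K. (fund_weight i \<bullet> \<zeta>) *\<^sub>R coroot (\<alpha> i)) \<in> coroot_lattice I" if "K \<subseteq> I" for K
    using finite_subset[OF that finite_index] that
  proof (induction K rule: finite_induct)
    case empty
    then show ?case using w xi si_le_refl by (simp add: aff_weyl_def)
  next
    case (insert i K)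
    let ?v = "\<xi> + (\<Sum>i\<in>K. (fund_weight i \<bullet> \<zeta>) *\<^sub>R coroot (\<alpha> i))"
    have i: "i \<in> I" using insert by blast
    have int: "fund_weight i \<bullet> \<zeta> \<in> \<int>" using z i by (simp add: coroot_lattice_iff)
    then have eq: "fund_weight i \<bullet> \<zeta> = real (nat \<lfloor>fund_weight i \<bullet> \<zeta>\<rfloor>)" using nn[OF i] by (auto elim!: Ints_cases)
    have v: "?v \<in> coroot_lattice I" using insert by blast
    have e: "\<xi> + (\<Sum>i\<in>insert i K. (fund_weight i \<bullet> \<zeta>) *\<^sub>R coroot (\<alpha> i)) = ?v + (fund_weight i \<bullet> \<zeta>) *\<^sub>R coroot (\<alpha> i)"
      using insert by (simp add: algebra_simps)
    have "si_less_eq (w, ?v) (w, ?v + (fund_weight i \<bullet> \<zeta>) *\<^sub>R coroot (\<alpha> i))"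
      by (subst eq) (rule one[OF i v])
    moreover have "?v + (fund_weight i \<bullet> \<zeta>) *\<^sub>R coroot (\<alpha> i) \<in> coroot_lattice I"
      using v int i coroot_lattice_add coroot_lattice_scale simple_coroot_lattice by blast
    ultimately show ?case unfolding e using insert si_le_trans by blast
  qed
  from this[OF order_refl] show ?thesis using coroot_expansion[of \<zeta>] by simp
qed

subsection \<open>Cosets and minimal representatives\<close>

text \<open>Left cosets of (W_J)_af, componentwise. In a product the translation part of x is
  twisted by W_J, but only within the coroot lattice of J; \<open>same_coset_iff\<close> makes this
  precise.\<close>

definition same_coset :: "'i set \<Rightarrow> ('a \<Rightarrow> 'a) \<times> 'a \<Rightarrow> ('a \<Rightarrow> 'a) \<times> 'a \<Rightarrow> bool" where
  "same_coset J x y \<longleftrightarrow> x \<in> aff_weyl I \<and> y \<in> aff_weyl I \<and>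
     (\<exists>u\<in>weyl J. fst y = fst x \<circ> u) \<and> snd y - snd x \<in> coroot_lattice J"

lemma same_coset_weyl: "same_coset J x y \<Longrightarrow> x \<in> aff_weyl I" "same_coset J x y \<Longrightarrow> y \<in> aff_weyl I"
  by (auto simp: same_coset_def)

lemma aff_mult_snd_diff:
  assumes "J \<subseteq> I" "x \<in> aff_weyl I" "u \<in> weyl J"
  shows "inv u (snd x) - snd x \<in> coroot_lattice J"
  using weyl_coroot_lattice[OF weyl_inv[OF assms(3)] assms(1)] aff_weylD(2)[OF assms(2)] by blast

lemma same_coset_iff:
  assumes J: "J \<subseteq> I" and x: "x \<in> aff_weyl I"
  shows "same_coset J x y \<longleftrightarrow> (\<exists>z\<in>aff_weyl J. y = aff_mult x z)"
proof
  assume "same_coset J x y"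
  then obtain u where u: "u \<in> weyl J" "fst y = fst x \<circ> u" and d: "snd y - snd x \<in> coroot_lattice J"
    by (auto simp: same_coset_def)
  \<comment> \<open>The second component undoes the twist of the translation part of x in
    \<open>aff_mult x\<close>.\<close>
  let ?z = "(u, (snd y - snd x) - (inv u (snd x) - snd x))"
  have "?z \<in> aff_weyl J"
    using u(1) coroot_lattice_diff[OF J d aff_mult_snd_diff[OF J x u(1)]] by (simp add: aff_weyl_def)
  moreover have "y = aff_mult x ?z" using u by (simp add: aff_mult_def prod_eq_iff)
  ultimately show "\<exists>z\<in>aff_weyl J. y = aff_mult x z" by blast
next
  assume "\<exists>z\<in>aff_weyl J. y = aff_mult x z"
  then obtain z where z: "z \<in> aff_weyl J" "y = aff_mult x z" by blast
  have u: "fst z \<in> weyl J" "snd z \<in> coroot_lattice J" using z aff_weylD by blast+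
  have "(inv (fst z) (snd x) - snd x) + snd z \<in> coroot_lattice J"
    using u aff_mult_snd_diff[OF J x] coroot_lattice_add[OF J] by blast
  then have d: "snd y - snd x \<in> coroot_lattice J" using z by (simp add: aff_mult_def algebra_simps)
  have "(snd y - snd x) + snd x \<in> coroot_lattice I"
    using coroot_lattice_add[OF order_refl coroot_lattice_mono[OF J d] aff_weylD(2)[OF x]] .
  then have "y \<in> aff_weyl I"
    using z(2) weyl_comp[OF aff_weylD(1)[OF x] weyl_mono[OF J u(1)]]
    by (intro aff_weylI) (simp_all add: aff_mult_def)
  then show "same_coset J x y" using x d u z by (auto simp: same_coset_def aff_mult_def)
qed

lemma same_coset_refl: "J \<subseteq> I \<Longrightarrow> x \<in> aff_weyl I \<Longrightarrow> same_coset J x x"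
  by (auto simp: same_coset_def coroot_lattice_zero intro!: bexI[of _ id])

lemma same_coset_sym:
  assumes "J \<subseteq> I" "same_coset J x y"
  shows "same_coset J y x"
proof -
  obtain u where u: "u \<in> weyl J" "fst y = fst x \<circ> u" using assms by (auto simp: same_coset_def)
  then have "fst x = fst y \<circ> inv u" by (simp add: fun_eq_iff)
  moreover have "snd x - snd y \<in> coroot_lattice J"
    using assms coroot_lattice_minus[of J "snd y - snd x"] by (simp add: same_coset_def)
  ultimately show ?thesis using assms weyl_inv[OF u(1)] by (auto simp: same_coset_def)
qed

lemma same_coset_trans:
  assumes "J \<subseteq> I" "same_coset J x y" "same_coset J y z"
  shows "same_coset J x z"
proof -
  obtain u v where u: "u \<in> weyl J" "fst y = fst x \<circ> u" and v: "v \<in> weyl J" "fst z = fst y \<circ> v"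
    using assms by (auto simp: same_coset_def)
  then have "fst z = fst x \<circ> (u \<circ> v)" by (simp add: comp_assoc)
  moreover have "(snd z - snd y) + (snd y - snd x) \<in> coroot_lattice J"
    using assms(2,3) by (intro coroot_lattice_add assms(1)) (auto simp: same_coset_def)
  then have "snd z - snd x \<in> coroot_lattice J" by simp
  ultimately show ?thesis using assms weyl_comp[OF u(1) v(1)] by (auto simp: same_coset_def)
qed

lemma same_coset_lmul:
  assumes J: "J \<subseteq> I" and xy: "same_coset J x y" and b: "\<beta> \<in> aff_roots"
  shows "same_coset J (lmul \<beta> x) (lmul \<beta> y)"
proof -
  obtain u where u: "u \<in> weyl J" "fst y = fst x \<circ> u" using xy by (auto simp: same_coset_def)
  have x: "x \<in> aff_weyl I" and y: "y \<in> aff_weyl I" using xy same_coset_weyl by blast+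
  let ?v = "inv (fst x) (snd \<beta> *\<^sub>R coroot (fst \<beta>))"
  have "inv (fst y) = inv u \<circ> inv (fst x)"
    unfolding u(2) using weyl_bij u(1) x aff_weylD by (intro o_inv_distrib) blast+
  then have e: "snd (lmul \<beta> y) - snd (lmul \<beta> x) = (inv u ?v - ?v) + (snd y - snd x)"
    by (simp add: snd_lmul)
  have "snd \<beta> *\<^sub>R coroot (fst \<beta>) \<in> coroot_lattice I"
    using b by (auto simp: aff_roots_def intro!: coroot_lattice_scale root_coroot_lattice)
  then have "?v \<in> coroot_lattice I" using weyl_coroot_lattice_I weyl_inv aff_weylD(1)[OF x] by blast
  then have "inv u ?v - ?v \<in> coroot_lattice J" using weyl_coroot_lattice J weyl_inv u by blast
  then have "snd (lmul \<beta> y) - snd (lmul \<beta> x) \<in> coroot_lattice J"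
    unfolding e using xy coroot_lattice_add[OF J] by (simp add: same_coset_def)
  moreover have "fst (lmul \<beta> y) = fst (lmul \<beta> x) \<circ> u" by (simp add: fst_lmul u comp_assoc)
  ultimately show ?thesis using lmul_weyl b x y u by (auto simp: same_coset_def)
qed

lemma same_coset_lmul_stable:
  assumes J: "J \<subseteq> I" and x: "x \<in> aff_weyl I" and b: "\<beta> \<in> aff_roots" and d: "fin_dir x \<beta> \<in> roots_of J"
  shows "same_coset J x (lmul \<beta> x)"
proof -
  have g: "coroot (fin_dir x \<beta>) \<in> coroot_lattice J" "reflection (fin_dir x \<beta>) \<in> weyl J"
    using root_coroot_lattice_weyl J d by auto
  have "snd \<beta> \<in> \<int>" using b by (auto simp: aff_roots_def)
  then have "snd \<beta> *\<^sub>R coroot (fin_dir x \<beta>) \<in> coroot_lattice J" using g coroot_lattice_scale J by blast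
  then show ?thesis
    using x lmul_weyl[OF b x] g unfolding same_coset_def lmul_right[OF x] by auto
qed

text \<open>The directions at two members of a coset differ by an element of \<open>weyl J\<close>,
  which preserves \<open>roots_of J\<close> and the sign of every root outside it.\<close>

lemma same_coset_fin_dir:
  assumes J: "J \<subseteq> I" and xy: "same_coset J x y" and b: "\<beta> \<in> aff_roots"
  shows "fin_dir y \<beta> \<in> roots_of J \<longleftrightarrow> fin_dir x \<beta> \<in> roots_of J"
    and "fin_dir x \<beta> \<notin> roots_of J \<Longrightarrow> ht (fin_dir x \<beta>) > 0 \<Longrightarrow> ht (fin_dir y \<beta>) > 0"
proof -
  obtain u where u: "u \<in> weyl J" "fst y = fst x \<circ> u" using xy by (auto simp: same_coset_def)
  have x: "x \<in> aff_weyl I" using xy same_coset_weyl by blast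
  have "inv (fst y) = inv u \<circ> inv (fst x)"
    unfolding u(2) using weyl_bij u(1) x aff_weylD by (intro o_inv_distrib) blast+
  then have e: "fin_dir y \<beta> = inv u (fin_dir x \<beta>)" by (simp add: fin_dir_def)
  show "fin_dir y \<beta> \<in> roots_of J \<longleftrightarrow> fin_dir x \<beta> \<in> roots_of J"
    unfolding e using weyl_roots_of weyl_inv u J fin_dir_root x b by blast
  show "fin_dir x \<beta> \<notin> roots_of J \<Longrightarrow> ht (fin_dir x \<beta>) > 0 \<Longrightarrow> ht (fin_dir y \<beta>) > 0"
    unfolding e using weyl_pos_outside weyl_inv u J fin_dir_root x b by blast
qed

lemma same_coset_ascent:
  assumes J: "J \<subseteq> I" and xy: "same_coset J x y" and a: "a \<in> aff_simple"
    and d: "fin_dir x a \<notin> roots_of J"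
  shows "ascent a y \<longleftrightarrow> ascent a x"
proof -
  have ar: "a \<in> aff_roots" using a aff_simple_root by blast
  show ?thesis
    using same_coset_fin_dir[OF J xy ar] same_coset_fin_dir(2)[OF J same_coset_sym[OF J xy] ar] d
    by (auto simp: ascent_def)
qed

lemma aff_min_reps_iff:
  assumes "J \<subseteq> I"
  shows "x \<in> aff_min_reps J \<longleftrightarrow> x \<in> aff_weyl I \<and> (\<forall>\<beta>\<in>aff_pos_roots J. aff_height (aff_act x \<beta>) > 0)"
proof -
  have "aff_act x \<beta> \<in> aff_roots" if "x \<in> aff_weyl I" "\<beta> \<in> aff_pos_roots J" for \<beta>
    using that roots_of_subset aff_pos_roots_iff[OF assms]
    by (intro act_root) (auto simp: aff_roots_def mem_Times_iff)
  then show ?thesis by (auto simp: aff_min_reps_def aff_pos_I_iff)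
qed

section \<open>Uniqueness of minimal representatives\<close>

lemma coroot_lattice_sum_list:
  assumes "J \<subseteq> I" "\<zeta> \<in> coroot_lattice J"
  shows "\<exists>gs. set gs \<subseteq> roots_of J \<and> \<zeta> = sum_list (map coroot gs)"
proof -
  obtain c where z: "\<zeta> = (\<Sum>j\<in>J. real_of_int (c j) *\<^sub>R coroot (\<alpha> j))"
    using assms by (auto simp: coroot_lattice_def int_span_def)
  have "\<exists>gs. set gs \<subseteq> roots_of J \<and> (\<Sum>j\<in>K. real_of_int (c j) *\<^sub>R coroot (\<alpha> j)) = sum_list (map coroot gs)"
    if "K \<subseteq> J" for K
    using finite_subset[OF subset_trans[OF that assms(1)] finite_index] that
  proof (induction K rule: finite_induct)
    case empty
    then show ?case by (intro exI[of _ "[]"]) simp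
  next
    case (insert j K)
    then obtain gs where gs: "set gs \<subseteq> roots_of J"
      "(\<Sum>j\<in>K. real_of_int (c j) *\<^sub>R coroot (\<alpha> j)) = sum_list (map coroot gs)" by auto
    let ?g = "if c j \<ge> 0 then \<alpha> j else - \<alpha> j"
    have j: "?g \<in> roots_of J" using insert assms simple_in_roots_of minus_roots_of by auto
    have "real_of_int (c j) *\<^sub>R coroot (\<alpha> j) = real (nat \<bar>c j\<bar>) *\<^sub>R coroot ?g"
      by (auto simp: coroot_minus)
    then have "real_of_int (c j) *\<^sub>R coroot (\<alpha> j) = sum_list (map coroot (replicate (nat \<bar>c j\<bar>) ?g))"
      by (simp add: sum_list_replicate_scaleR map_replicate_const del: replicate.simps)
    then show ?case
      using insert gs j
      by (intro exI[of _ "replicate (nat \<bar>c j\<bar>) ?g @ gs"]) (auto simp: set_replicate_conv_if)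
  qed
  from this[OF order_refl] show ?thesis using z by simp
qed

text \<open>Write \<open>\<zeta>\<close> as a sum of coroots. If \<open>\<zeta> \<noteq> 0\<close>, some summand \<open>\<gamma>\<close> pairs to \<open>1\<close> with \<open>\<zeta>\<close>, and then
  \<open>s\<^sub>\<gamma> \<zeta>\<close> is a minuscule element with one summand less.\<close>

lemma minuscule_zero:
  assumes J: "J \<subseteq> I" and z: "\<zeta> \<in> coroot_lattice J" and m: "\<And>\<gamma>. \<gamma> \<in> roots_of J \<Longrightarrow> \<bar>\<gamma> \<bullet> \<zeta>\<bar> \<le> 1"
  shows "\<zeta> = 0"
proof -
  have *: "sum_list (map coroot gs) = 0"
    if "set gs \<subseteq> roots_of J" "\<And>\<gamma>. \<gamma> \<in> roots_of J \<Longrightarrow> \<bar>\<gamma> \<bullet> sum_list (map coroot gs)\<bar> \<le> 1" for gs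
    using that
  proof (induction "length gs" arbitrary: gs)
    case (Suc n)
    let ?z = "sum_list (map coroot gs)"
    show ?case
    proof (rule ccontr)
      assume nz: "?z \<noteq> 0"
      have "\<exists>\<gamma>\<in>set gs. coroot \<gamma> \<bullet> ?z > 0"
      proof (rule ccontr)
        assume neg: "\<not> ?thesis"
        have "sum_list (map coroot hs) \<bullet> ?z \<le> 0" if "set hs \<subseteq> set gs" for hs
          using that neg by (induction hs) (auto simp: inner_add_left not_less add_nonpos_nonpos)
        then have "?z \<bullet> ?z \<le> 0" by blast
        then show False using nz by (metis inner_ge_zero inner_eq_zero_iff order_antisym)
      qed
      then obtain \<gamma> where g: "\<gamma> \<in> set gs" "coroot \<gamma> \<bullet> ?z > 0" by blast
      have gJ: "\<gamma> \<in> roots_of J" using g Suc by blast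
      have gd: "\<gamma> \<in> \<Delta>" using gJ roots_of_subset by blast
      have "?z \<bullet> \<gamma> > 0" using g root_nonzero[OF gd] inner_coroot_pos_iff[of \<gamma> ?z] by (simp add: inner_commute)
      moreover have "?z \<in> coroot_lattice I"
      proof -
        have "sum_list (map coroot hs) \<in> coroot_lattice I" if "set hs \<subseteq> roots_of J" for hs
          using that roots_of_subset
          by (induction hs) (auto simp: coroot_lattice_zero intro!: coroot_lattice_add root_coroot_lattice)
        then show ?thesis using Suc by blast
      qed
      ultimately have one: "\<gamma> \<bullet> ?z = 1"
        using Suc.prems(2)[OF gJ] root_coroot_lattice_int[OF gd]
        by (fastforce simp: inner_commute elim!: Ints_cases)
      obtain xs ys where xy: "gs = xs @ \<gamma> # ys" using g by (auto dest: split_list)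
      have r: "sum_list (map coroot (xs @ ys)) = reflection \<gamma> ?z"
        using one by (simp add: reflection_coroot xy)
      have "sum_list (map coroot (xs @ ys)) = 0"
      proof (rule Suc.hyps(1))
        show "n = length (xs @ ys)" using Suc.hyps(2) xy by simp
        show "set (xs @ ys) \<subseteq> roots_of J" using Suc xy by auto
        fix \<epsilon> assume e: "\<epsilon> \<in> roots_of J"
        have "reflection \<gamma> \<epsilon> \<in> roots_of J" using reflection_roots_of J gJ e roots_of_subset by blast
        then have "\<bar>reflection \<gamma> \<epsilon> \<bullet> ?z\<bar> \<le> 1" using Suc.prems(2) by blast
        moreover have "reflection \<gamma> \<epsilon> \<bullet> ?z = \<epsilon> \<bullet> reflection \<gamma> ?z"
          using reflection_inner[of \<gamma> \<epsilon> "reflection \<gamma> ?z"] by simp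
        ultimately show "\<bar>\<epsilon> \<bullet> sum_list (map coroot (xs @ ys))\<bar> \<le> 1" using r by simp
      qed
      then have "reflection \<gamma> ?z = 0" using r by simp
      then have "reflection \<gamma> (reflection \<gamma> ?z) = 0" using linear_0[OF linear_reflection] by simp
      then show False using nz by simp
    qed
  qed simp
  obtain gs where "set gs \<subseteq> roots_of J" "\<zeta> = sum_list (map coroot gs)"
    using coroot_lattice_sum_list[OF J z] by blast
  then show ?thesis using * m by blast
qed

text \<open>Positivity of the images of \<gamma> and -\<gamma> + \<delta> squeezes the pairing of
  \<gamma> with the translation part between -1 and 0. Then \<open>minuscule_zero\<close> removes
  the translation, and the finite part has no inversions: roots of J stay positive by assumption,
  the others because it lies in \<open>weyl J\<close>.\<close>

lemma aff_weyl_pos_trivial: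
  assumes J: "J \<subseteq> I" and z: "z \<in> aff_weyl J" and p: "\<And>\<beta>. \<beta> \<in> aff_pos_roots J \<Longrightarrow> aff_height (aff_act z \<beta>) > 0"
  shows "z = (id, 0)"
proof -
  have zI: "z \<in> aff_weyl I" using aff_weyl_mono J z by blast
  have w: "fst z \<in> weyl I" "snd z \<in> coroot_lattice I" using zI aff_weylD by blast+
  have pos: "- 1 \<le> \<gamma> \<bullet> snd z \<and> (\<gamma> \<bullet> snd z < 0 \<or> \<gamma> \<bullet> snd z = 0 \<and> ht (fst z \<gamma>) > 0)"
    if g: "\<gamma> \<in> roots_of J" "ht \<gamma> > 0" for \<gamma>
  proof -
    have gd: "\<gamma> \<in> \<Delta>" using g roots_of_subset by blast
    have wg: "fst z \<gamma> \<in> \<Delta>" using weyl_root w gd by blast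
    have int: "\<gamma> \<bullet> snd z \<in> \<int>" using root_coroot_lattice_int gd w by blast
    have "(\<gamma>, 0) \<in> aff_pos_roots J" "(- \<gamma>, 1) \<in> aff_pos_roots J"
      using g minus_roots_of J aff_height_pos_iff[OF gd] aff_height_pos_iff[OF minus_root[OF gd]]
      by (simp_all add: aff_pos_roots_iff)
    then have "aff_height (aff_act z (\<gamma>, 0)) > 0" "aff_height (aff_act z (- \<gamma>, 1)) > 0" using p by blast+
    then have "aff_height (fst z \<gamma>, - (\<gamma> \<bullet> snd z)) > 0" "aff_height (- fst z \<gamma>, 1 + \<gamma> \<bullet> snd z) > 0"
      using linear_neg[OF weyl_linear[OF w(1)]] by (simp_all add: aff_act_def)
    then show ?thesis
      using aff_height_pos_iff[OF wg, of "- (\<gamma> \<bullet> snd z)"] aff_height_pos_iff[OF minus_root[OF wg], of "1 + \<gamma> \<bullet> snd z"] int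
      by auto
  qed
  have "snd z = 0"
  proof (rule minuscule_zero[OF J])
    show "snd z \<in> coroot_lattice J" using z aff_weylD by blast
    fix \<gamma> assume g: "\<gamma> \<in> roots_of J"
    then consider "ht \<gamma> > 0" | "ht (- \<gamma>) > 0" using ht_root_nonzero[of \<gamma>] roots_of_subset by fastforce
    then show "\<bar>\<gamma> \<bullet> snd z\<bar> \<le> 1"
      using pos[OF g] pos[OF minus_roots_of[OF J g]] by cases auto
  qed
  moreover have "fst z = id"
  proof (rule inversions_0[OF w(1)])
    have "ht (fst z \<gamma>) > 0" if g: "\<gamma> \<in> pos_roots" for \<gamma>
    proof (cases "\<gamma> \<in> roots_of J")
      case True
      then show ?thesis using pos g \<open>snd z = 0\<close> by (auto simp: pos_roots_iff)
    next
      case False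
      then show ?thesis using weyl_pos_outside[OF aff_weylD(1)[OF z] J] g by (simp add: pos_roots_iff)
    qed
    then have "{\<gamma>\<in>pos_roots. ht (fst z \<gamma>) < 0} = {}" by fastforce
    then show "inversions (fst z) = 0" by (simp only: inversions_def card.empty)
  qed
  ultimately show ?thesis by (simp add: prod_eq_iff)
qed

lemma act_mult:
  assumes "x \<in> aff_weyl I" "z \<in> aff_weyl I"
  shows "aff_act (aff_mult x z) \<beta> = aff_act x (aff_act z \<beta>)"
proof -
  have "fst \<beta> \<bullet> inv (fst z) (snd x) = fst z (fst \<beta>) \<bullet> snd x"
    using weyl_inv_inner[OF aff_weylD(1)[OF assms(2)], of "snd x" "fst \<beta>"] by (simp add: inner_commute)
  then show ?thesis by (simp add: aff_act_def aff_mult_def inner_add_right)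
qed

lemma act_minus: "x \<in> aff_weyl I \<Longrightarrow> aff_act x (- \<beta>) = - aff_act x \<beta>"
  using linear_neg[OF weyl_linear[OF aff_weylD(1)]] by (simp add: aff_act_def prod_eq_iff)

text \<open>Let y = x z. If z made a positive \<beta> of J negative, then x would send -z\<beta> to
  a positive root, and y would send \<beta> to a negative one. So z preserves positivity and is
  trivial.\<close>

lemma same_coset_min_reps_eq:
  assumes J: "J \<subseteq> I" and x: "x \<in> aff_min_reps J" and y: "y \<in> aff_min_reps J" and xy: "same_coset J x y"
  shows "x = y"
proof -
  have xI: "x \<in> aff_weyl I" using x aff_min_reps_iff[OF J] by blast
  obtain z where z: "z \<in> aff_weyl J" "y = aff_mult x z" using same_coset_iff[OF J xI] xy by blast
  have zI: "z \<in> aff_weyl I" using aff_weyl_mono J z by blast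
  have "aff_height (aff_act z \<beta>) > 0" if b: "\<beta> \<in> aff_pos_roots J" for \<beta>
  proof (rule ccontr)
    assume neg: "\<not> ?thesis"
    have bb: "fst \<beta> \<in> roots_of J" "snd \<beta> \<in> \<int>" using b aff_pos_roots_iff[OF J] by auto
    have "aff_act z \<beta> \<in> aff_roots"
      using bb roots_of_subset by (intro act_root[OF zI]) (auto simp: aff_roots_def mem_Times_iff)
    then have "aff_height (- aff_act z \<beta>) > 0" "snd (aff_act z \<beta>) \<in> \<int>"
      using neg aff_root_ht_nonzero by (fastforce simp: aff_roots_def mem_Times_iff)+
    moreover have "fst (aff_act z \<beta>) \<in> roots_of J"
      using bb weyl_roots_of[OF aff_weylD(1)[OF z(1)] J] roots_of_subset by (auto simp: aff_act_def)
    ultimately have "- aff_act z \<beta> \<in> aff_pos_roots J"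
      using minus_roots_of[OF J] by (simp add: aff_pos_roots_iff[OF J])
    then have "aff_height (aff_act x (- aff_act z \<beta>)) > 0" using x aff_min_reps_iff[OF J] by blast
    then have "aff_height (aff_act y \<beta>) < 0" unfolding act_minus[OF xI] z(2) act_mult[OF xI zI] by simp
    then show False using y b aff_min_reps_iff[OF J] by fastforce
  qed
  then have "z = (id, 0)" by (rule aff_weyl_pos_trivial[OF J z(1)])
  then show ?thesis using z(2) by (simp add: aff_mult_def prod_eq_iff)
qed

text \<open>\<open>p\<close> is a point of the fundamental alcove, and \<open>alcove_dist x\<close> the squared distance from \<open>p\<close> to \<open>x\<inverse> p\<close>.\<close>

definition alcove_dist :: "('a \<Rightarrow> 'a) \<times> 'a \<Rightarrow> real" where
  "alcove_dist x = (let p = (1 / coxeter) *\<^sub>R hvec; q = inv (fst x) p - snd x in (q - p) \<bullet> (q - p))"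

text \<open>A uniform lower bound for the drop in \<open>alcove_dist_decrease\<close>. Two affine
  heights of absolute value at least 1 give the squared Coxeter number; 4 over the squared length of
  a root is that of its coroot, smallest for the longest roots.\<close>

definition alcove_gap :: real where
  "alcove_gap = 4 / (coxeter\<^sup>2 * Max ((\<lambda>\<gamma>. \<gamma> \<bullet> \<gamma>) ` \<Delta>))"

lemma root_norm_Max: "\<gamma> \<in> \<Delta> \<Longrightarrow> \<gamma> \<bullet> \<gamma> \<le> Max ((\<lambda>\<gamma>. \<gamma> \<bullet> \<gamma>) ` \<Delta>)"
  using finite_roots by simp

lemma alcove_gap_pos: "alcove_gap > 0"
proof -
  have "highest \<bullet> highest > 0" using highest_root root_nonzero by simp
  then have "Max ((\<lambda>\<gamma>. \<gamma> \<bullet> \<gamma>) ` \<Delta>) > 0" using root_norm_Max[OF highest_root] by linarith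
  then show ?thesis using coxeter_ge by (simp add: alcove_gap_def)
qed

lemma alcove_dist_nonneg: "alcove_dist x \<ge> 0"
  by (simp add: alcove_dist_def Let_def)

text \<open>The wall of \<beta> separates p from q = x^{-1} p: \<beta> takes the positive value r at
  p and the negative value t at q. Replacing x by x s_\<beta> replaces q by its mirror image, and
  the squared distance to p falls by exactly -4tr / (\<gamma> \<bullet> \<gamma>).\<close>

lemma alcove_dist_decrease:
  assumes x: "x \<in> aff_weyl I" and b: "\<beta> \<in> aff_roots" "aff_height \<beta> > 0" and neg: "aff_height (aff_act x \<beta>) < 0"
  shows "alcove_dist (lmul (aff_act x \<beta>) x) \<le> alcove_dist x - alcove_gap"
proof -
  obtain \<gamma> n where bg: "\<beta> = (\<gamma>, n)" by (cases \<beta>)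
  define p where "p = (1 / coxeter) *\<^sub>R hvec"
  define q where "q = inv (fst x) p - snd x"
  define t where "t = \<gamma> \<bullet> q + n"
  define r where "r = \<gamma> \<bullet> p + n"
  let ?y = "lmul (aff_act x \<beta>) x"
  have w: "fst x \<in> weyl I" using x aff_weylD by blast
  have g: "\<gamma> \<in> \<Delta>" using b bg by (auto simp: aff_roots_def)
  have gg: "\<gamma> \<bullet> \<gamma> > 0" using g root_nonzero by simp
  have c: "coxeter > 0" using coxeter_ge by simp
  have "fin_dir x (aff_act x \<beta>) = \<gamma>" using w by (simp add: fin_dir_def aff_act_def bg)
  then have y: "?y = (fst x \<circ> reflection \<gamma>, snd x + (n - \<gamma> \<bullet> snd x) *\<^sub>R coroot \<gamma>)"
    by (simp add: lmul_right[OF x]) (simp add: aff_act_def bg)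
  have "inv (fst x \<circ> reflection \<gamma>) = inv (reflection \<gamma>) \<circ> inv (fst x)"
    by (intro o_inv_distrib weyl_bij[OF w] orthogonal_transformation_bij orthogonal_reflection)
  then have q': "inv (fst ?y) p - snd ?y = q - t *\<^sub>R coroot \<gamma>"
    by (simp add: y inv_reflection reflection_coroot q_def t_def inner_diff_right algebra_simps)
  have hp: "hvec \<bullet> v = coxeter * (v \<bullet> p)" for v using c by (simp add: p_def inner_commute)
  have "coxeter * r = aff_height \<beta>" by (simp add: r_def aff_height_def bg ht_def hp algebra_simps)
  moreover have "aff_height \<beta> \<ge> 1" using aff_height_int[OF b(1)] b(2) by (auto elim!: Ints_cases)
  ultimately have r1: "coxeter * r \<ge> 1" by simp
  have "\<gamma> \<bullet> inv (fst x) p = fst x \<gamma> \<bullet> p" using weyl_inv_inner[OF w, of p \<gamma>] by (simp add: inner_commute)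
  then have "coxeter * t = aff_height (aff_act x \<beta>)"
    by (simp add: t_def q_def aff_height_def bg ht_def hp aff_act_def inner_diff_right algebra_simps)
  moreover have "aff_height (aff_act x \<beta>) \<le> - 1"
    using aff_height_int[OF act_root[OF x b(1)]] neg by (auto elim!: Ints_cases)
  ultimately have t1: "coxeter * (- t) \<ge> 1" by simp
  have "(coxeter * (- t)) * (coxeter * r) \<ge> 1 * 1" using t1 r1 by (intro mult_mono) auto
  then have tr: "coxeter\<^sup>2 * (- t * r) \<ge> 1" by (simp add: power2_eq_square algebra_simps)
  then have trc: "- t * r \<ge> 1 / coxeter\<^sup>2" using c by (simp add: divide_le_eq mult.commute)
  have "alcove_dist ?y = (q - p - t *\<^sub>R coroot \<gamma>) \<bullet> (q - p - t *\<^sub>R coroot \<gamma>)"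
    unfolding alcove_dist_def Let_def p_def[symmetric] q' by (simp add: diff_diff_add add.commute)
  also have "\<dots> = alcove_dist x - 2 * t * (coroot \<gamma> \<bullet> (q - p)) + t * t * (coroot \<gamma> \<bullet> coroot \<gamma>)"
  proof -
    have "alcove_dist x = (q - p) \<bullet> (q - p)"
      by (simp only: alcove_dist_def p_def[symmetric] Let_def q_def[symmetric])
    moreover have "(v - t *\<^sub>R c) \<bullet> (v - t *\<^sub>R c) = v \<bullet> v - 2 * t * (c \<bullet> v) + t * t * (c \<bullet> c)" for v c :: 'a
      by (simp add: inner_diff_left inner_diff_right inner_commute algebra_simps)
    ultimately show ?thesis by simp
  qed
  also have "coroot \<gamma> \<bullet> (q - p) = 2 * (t - r) / (\<gamma> \<bullet> \<gamma>)"
    by (simp add: coroot_def t_def r_def inner_diff_right diff_divide_distrib)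
  also have "coroot \<gamma> \<bullet> coroot \<gamma> = 4 / (\<gamma> \<bullet> \<gamma>)"
    using gg by (simp add: coroot_def field_simps)
  also have "alcove_dist x - 2 * t * (2 * (t - r) / (\<gamma> \<bullet> \<gamma>)) + t * t * (4 / (\<gamma> \<bullet> \<gamma>))
      = alcove_dist x - 4 * (- t * r) / (\<gamma> \<bullet> \<gamma>)"
    using gg by (simp add: field_simps)
  also have "\<dots> \<le> alcove_dist x - alcove_gap"
  proof -
    have "alcove_gap = 4 * (1 / coxeter\<^sup>2) / Max ((\<lambda>\<gamma>. \<gamma> \<bullet> \<gamma>) ` \<Delta>)" by (simp add: alcove_gap_def)
    also have "\<dots> \<le> 4 * (- t * r) / (\<gamma> \<bullet> \<gamma>)"
    proof (rule frac_le)
      have "0 \<le> 1 / coxeter\<^sup>2" by simp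
      then show "0 \<le> 4 * (- t * r)" using trc by linarith
      show "4 * (1 / coxeter\<^sup>2) \<le> 4 * (- t * r)" using trc by linarith
    qed (use gg root_norm_Max[OF g] in auto)
    finally show ?thesis by simp
  qed
  finally show ?thesis .
qed

lemma alcove_induct [case_names less]:
  assumes "\<And>x. (\<And>y. alcove_dist y \<le> alcove_dist x - alcove_gap \<Longrightarrow> P y) \<Longrightarrow> P x"
  shows "P x"
proof (induction "nat \<lfloor>alcove_dist x / alcove_gap\<rfloor>" arbitrary: x rule: less_induct)
  case less
  show ?case
  proof (rule assms)
    fix y assume y: "alcove_dist y \<le> alcove_dist x - alcove_gap"
    then have "alcove_dist y / alcove_gap \<le> alcove_dist x / alcove_gap - 1"
      using alcove_gap_pos by (simp add: field_simps)
    moreover have "0 \<le> alcove_dist y / alcove_gap"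
      using alcove_gap_pos alcove_dist_nonneg[of y] by simp
    ultimately have "nat \<lfloor>alcove_dist y / alcove_gap\<rfloor> < nat \<lfloor>alcove_dist x / alcove_gap\<rfloor>"
      by linarith
    then show "P y" by (rule less)
  qed
qed

text \<open>As long as x makes a positive root \<beta> of J negative, x s_\<beta> is in the same
  coset and closer in \<open>alcove_dist\<close>. The semi-infinite length cannot be the measure:
  for nonempty J it is unbounded below on every coset.\<close>

lemma min_rep_exists:
  assumes J: "J \<subseteq> I" and x: "x \<in> aff_weyl I"
  shows "\<exists>y\<in>aff_min_reps J. same_coset J x y"
  using x
proof (induction x rule: alcove_induct)
  case (less x)
  note x = less.prems
  show ?case
  proof (cases "x \<in> aff_min_reps J")
    case True
    then show ?thesis using same_coset_refl J x by blast
  next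
    case False
    then obtain \<beta> where b: "\<beta> \<in> aff_pos_roots J" "\<not> aff_height (aff_act x \<beta>) > 0"
      using aff_min_reps_iff[OF J] x by blast
    then have bJ: "fst \<beta> \<in> roots_of J" and br: "\<beta> \<in> aff_roots" "aff_height \<beta> > 0"
      using aff_pos_roots_iff[OF J] roots_of_subset[of J] by (auto simp: aff_roots_def mem_Times_iff)
    let ?b = "aff_act x \<beta>"
    have r: "?b \<in> aff_roots" using act_root x br by blast
    then have "aff_height ?b < 0" using b aff_root_ht_nonzero by fastforce
    then have d: "alcove_dist (lmul ?b x) \<le> alcove_dist x - alcove_gap"
      using alcove_dist_decrease x br by blast
    have "fin_dir x ?b = fst \<beta>" using aff_weylD(1)[OF x] by (simp add: fin_dir_def aff_act_def)
    then have s: "same_coset J x (lmul ?b x)" using same_coset_lmul_stable[OF J x r] bJ by simp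
    then obtain y where "y \<in> aff_min_reps J" "same_coset J (lmul ?b x) y"
      using less.IH[OF d] same_coset_weyl by blast
    then show ?thesis using s same_coset_trans J by blast
  qed
qed

lemma proj_eq_iff:
  assumes J: "J \<subseteq> I" and x: "x \<in> aff_weyl I" and y: "y \<in> aff_min_reps J"
  shows "proj J x = y \<longleftrightarrow> same_coset J x y"
proof -
  obtain m where m: "m \<in> aff_min_reps J" "same_coset J x m" using min_rep_exists J x by blast
  have *: "z \<in> aff_min_reps J \<and> (\<exists>x2\<in>aff_weyl J. x = aff_mult z x2) \<longleftrightarrow> z = m" for z
  proof
    assume z: "z \<in> aff_min_reps J \<and> (\<exists>x2\<in>aff_weyl J. x = aff_mult z x2)"
    then have "same_coset J z x" using same_coset_iff[OF J] aff_min_reps_iff[OF J] by blast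
    then show "z = m" using same_coset_min_reps_eq[OF J _ m(1)] same_coset_trans[OF J _ m(2)] z by blast
  next
    assume "z = m"
    then show "z \<in> aff_min_reps J \<and> (\<exists>x2\<in>aff_weyl J. x = aff_mult z x2)"
      using m same_coset_sym[OF J m(2)] same_coset_iff[OF J same_coset_weyl(2)[OF m(2)]] by blast
  qed
  have "proj J x = m" unfolding proj_def * by simp
  then show ?thesis
    using m y same_coset_min_reps_eq[OF J] same_coset_trans[OF J] same_coset_sym[OF J] by blast
qed

subsection \<open>Minimal lifts\<close>

text \<open>The chain of raising simple reflections up to a translation, as an inductive predicate:
  its rule is the outer induction of \<open>lifts_least\<close>.\<close>

inductive rises :: "('a \<Rightarrow> 'a) \<times> 'a \<Rightarrow> bool" where
  base: "fst x = id \<Longrightarrow> rises x"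
| step: "a \<in> aff_simple \<Longrightarrow> ascent a x \<Longrightarrow> rises (lmul a x) \<Longrightarrow> rises x"

text \<open>Twice \<open>hvec\<close>, by \<open>root_two_rho_check\<close>. Written as a sum of
  coroots it visibly lies in the coroot lattice, so translating by it stays in the group.\<close>

definition two_rho_check :: 'a where
  "two_rho_check = (\<Sum>\<gamma>\<in>pos_roots. coroot \<gamma>)"

lemma two_rho_check_lattice: "two_rho_check \<in> coroot_lattice I"
  unfolding two_rho_check_def
  by (intro coroot_lattice_sum order_refl root_coroot_lattice pos_root_root)

text \<open>The simple reflection permutes the positive coroots other than
  \<open>coroot (\<alpha> i)\<close> and negates that one, so it lowers the sum by twice that
  coroot.\<close>

lemma simple_two_rho_check:
  assumes i: "i \<in> I"
  shows "\<alpha> i \<bullet> two_rho_check = 2"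
proof -
  let ?s = "reflection (\<alpha> i)" and ?P = "pos_roots - {\<alpha> i}"
  have p: "\<alpha> i \<in> pos_roots" using i simple_in_roots by (simp add: pos_roots_iff)
  have sP: "?s \<gamma> \<in> ?P" if "\<gamma> \<in> ?P" for \<gamma>
  proof -
    have "?s \<gamma> \<noteq> \<alpha> i"
    proof
      assume "?s \<gamma> = \<alpha> i"
      then have "?s (?s \<gamma>) = - \<alpha> i" by (simp only: reflection_self)
      then show False using that p by (auto simp: pos_roots_iff)
    qed
    then show ?thesis
      using that i simple_in_roots reflection_root simple_reflection_pos by (auto simp: pos_roots_iff)
  qed
  have split: "two_rho_check = coroot (\<alpha> i) + (\<Sum>\<gamma>\<in>?P. coroot \<gamma>)"
    unfolding two_rho_check_def using sum.remove[OF finite_pos_roots p] .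
  have "?s (\<Sum>\<gamma>\<in>?P. coroot \<gamma>) = (\<Sum>\<gamma>\<in>?P. coroot (?s \<gamma>))"
    by (simp add: linear_sum[OF linear_reflection] coroot_reflection)
  also have "\<dots> = (\<Sum>\<gamma>\<in>?P. coroot \<gamma>)"
    by (rule sum.reindex_bij_witness[of _ ?s ?s]) (use sP in auto)
  finally have "?s two_rho_check = two_rho_check - 2 *\<^sub>R coroot (\<alpha> i)"
    unfolding split linear_add[OF linear_reflection]
    by (simp add: coroot_reflection[symmetric] reflection_self coroot_minus scaleR_2)
  then have "(\<alpha> i \<bullet> two_rho_check) *\<^sub>R coroot (\<alpha> i) = 2 *\<^sub>R coroot (\<alpha> i)"
    by (simp add: reflection_coroot)
  moreover have "coroot (\<alpha> i) \<noteq> 0"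
    using i simple_in_roots root_nonzero by (auto simp: coroot_def)
  ultimately show ?thesis by simp
qed

lemma root_two_rho_check: "\<gamma> \<bullet> two_rho_check = 2 * ht \<gamma>"
proof -
  have "\<gamma> \<bullet> two_rho_check = (\<Sum>i\<in>I. (fund_coweight i \<bullet> \<gamma>) * (\<alpha> i \<bullet> two_rho_check))"
    by (subst simple_expansion[of \<gamma>]) (simp add: inner_sum_left)
  then show ?thesis by (simp add: simple_two_rho_check ht_sum sum_distrib_left mult.commute)
qed

lemma act_diff_scale:
  "g \<in> aff_weyl I \<Longrightarrow> aff_act g (u - c *\<^sub>R v) = aff_act g u - c *\<^sub>R aff_act g v"
  using weyl_linear[OF aff_weylD(1)]
  by (simp add: aff_act_def prod_eq_iff linear_diff linear_scale inner_diff_left algebra_simps)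

lemma act_arefl:
  assumes "g \<in> aff_weyl I"
  shows "aff_act g (arefl a \<beta>) = arefl (aff_act g a) (aff_act g \<beta>)"
proof -
  have w: "fst g \<in> weyl I" using aff_weylD assms by blast
  have "fst g (fst \<beta>) \<bullet> coroot (fst g (fst a)) = fst \<beta> \<bullet> coroot (fst a)"
    by (simp only: coroot_orthogonal[OF weyl_orthogonal[OF w]] weyl_inner[OF w])
  then have "fst (aff_act g \<beta>) \<bullet> coroot (fst (aff_act g a)) = fst \<beta> \<bullet> coroot (fst a)"
    by (simp add: aff_act_def)
  then show ?thesis by (simp only: arefl_eq act_diff_scale[OF assms])
qed

lemma act_simple_pos_imp:
  assumes g: "g \<in> aff_weyl I" and s: "\<And>a. a \<in> aff_simple \<Longrightarrow> aff_height (aff_act g a) > 0"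
    and b: "\<beta> \<in> aff_roots" "aff_height \<beta> > 0"
  shows "aff_height (aff_act g \<beta>) > 0"
  using b
proof (induction rule: aff_pos_induct)
  case (step a \<beta>)
  let ?c = "fst \<beta> \<bullet> coroot (fst a)"
  have "aff_act g (arefl a \<beta>) = aff_act g \<beta> - ?c *\<^sub>R aff_act g a"
    by (simp only: arefl_eq act_diff_scale[OF g])
  then have "aff_height (aff_act g \<beta>) = aff_height (aff_act g (arefl a \<beta>)) + ?c * aff_height (aff_act g a)"
    by (simp add: aff_height_diff aff_height_scale)
  then show ?case using step s[OF step(1)] by (simp add: add_pos_pos)
qed (rule s)

text \<open>Walk from the alcove of \<open>x\<close> to that of a translation \<open>z\<close> deep in the dominant direction; the walk is encoded by
  \<open>g = z x\<inverse>\<close>. Every step goes up because no hyperplane separating the two alcoves has \<open>x\<close> on its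
  upper side, which is the last premise.\<close>

lemma rises_walk:
  assumes "g \<in> aff_weyl I" "x \<in> aff_weyl I" "fst z = id"
    and "\<And>\<eta>. aff_act z \<eta> = aff_act g (aff_act x \<eta>)"
    and "\<And>\<eta>. \<eta> \<in> aff_roots \<Longrightarrow> aff_height (aff_act x \<eta>) > 0 \<Longrightarrow> ht (fst \<eta>) < 0 \<Longrightarrow> aff_height (aff_act z \<eta>) > 0"
  shows "rises x"
  using assms(1,2,4,5)
proof (induction g arbitrary: x rule: alcove_induct)
  case (less g)
  note g = less.prems(1) and x = less.prems(2) and gx = less.prems(3) and deep = less.prems(4)
  show ?case
  proof (cases "\<forall>a\<in>aff_simple. aff_height (aff_act g a) > 0")
    case True
    then have "g = (id, 0)"
      using aff_weyl_pos_trivial[OF order_refl g] act_simple_pos_imp[OF g] by (simp add: aff_pos_I_iff)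
    then have "aff_act z (v, 0) = aff_act x (v, 0)" for v
      using gx[of "(v, 0)"] by (simp add: aff_act_def)
    then have "fst x = id" using assms(3) by (auto simp: aff_act_def fun_eq_iff)
    then show ?thesis by (rule rises.base)
  next
    case False
    then obtain a where a: "a \<in> aff_simple" "\<not> aff_height (aff_act g a) > 0" by blast
    have ar: "a \<in> aff_roots" using a aff_simple_root by blast
    have neg: "aff_height (aff_act g a) < 0"
      using a(2) aff_root_ht_nonzero[OF act_root[OF g ar]] by linarith
    \<comment> \<open>\<eta> is x^{-1} a, positive at x and negative at z. By the last premise its
      finite part is then not a negative root, which says that a raises x.\<close>
    define \<eta> where "\<eta> = (fin_dir x a, snd a + fin_dir x a \<bullet> snd x)"
    have xe: "aff_act x \<eta> = a" unfolding \<eta>_def by (rule act_fin_dir[OF x])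
    have d: "fin_dir x a \<in> \<Delta>" using fin_dir_root x ar by blast
    have er: "\<eta> \<in> aff_roots"
      using d ar root_coroot_lattice_int[OF d aff_weylD(2)[OF x]] by (auto simp: \<eta>_def aff_roots_def)
    have "\<not> ht (fst \<eta>) < 0" using deep[OF er] neg aff_height_simple[OF a(1)] gx[of \<eta>] xe by auto
    then have asc: "ascent a x" using ht_root_nonzero[OF d] by (simp add: ascent_def \<eta>_def)
    \<comment> \<open>\<open>?g\<close> is g s_a, so \<open>?g\<close> applied after
      \<open>?x\<close> is still z.\<close>
    let ?g = "lmul (aff_act g a) g" and ?x = "lmul a x"
    have "rises ?x"
    proof (rule less.IH)
      show "alcove_dist ?g \<le> alcove_dist g - alcove_gap"
        using alcove_dist_decrease[OF g ar] aff_height_simple[OF a(1)] neg by simp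
      show "?g \<in> aff_weyl I" "?x \<in> aff_weyl I" using lmul_weyl act_root g ar x by blast+
      show "aff_act z \<epsilon> = aff_act ?g (aff_act ?x \<epsilon>)" for \<epsilon>
        unfolding act_lmul[OF g] act_lmul[OF x] act_arefl[OF g, symmetric] arefl_arefl by (rule gx)
      fix \<epsilon> assume e: "\<epsilon> \<in> aff_roots" "aff_height (aff_act ?x \<epsilon>) > 0" "ht (fst \<epsilon>) < 0"
      have r: "aff_act x \<epsilon> \<in> aff_roots" using act_root x e by blast
      have p: "aff_height (arefl a (aff_act x \<epsilon>)) > 0" using e(2) by (simp add: act_lmul[OF x])
      \<comment> \<open>Passing from x to s_a x changes the sign only of the roots that x sends to a
        or -a. The one that becomes positive is sent to -a, and z makes it positive because g makes
        a negative.\<close>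
      show "aff_height (aff_act z \<epsilon>) > 0"
      proof (cases "aff_act x \<epsilon> = - a")
        case True
        then show ?thesis using gx[of \<epsilon>] neg by (simp add: act_minus[OF g])
      next
        case False
        moreover have "aff_act x \<epsilon> \<noteq> a" using p aff_height_simple[OF a(1)] arefl_self[OF ar] by auto
        ultimately have "aff_height (aff_act x \<epsilon>) > 0" using p arefl_simple_pos_iff[OF a(1) r] by blast
        then show ?thesis using deep e by blast
      qed
    qed
    then show ?thesis using rises.step a asc by blast
  qed
qed

lemma rises_all:
  assumes x: "x \<in> aff_weyl I"
  shows "rises x"
proof -
  have w: "fst x \<in> weyl I" using x aff_weylD by blast
  \<comment> \<open>For a root with negative finite part \<gamma>, the shift by
    \<open>two_rho_check\<close> adds the positive amount -2 ht \<gamma> to the \<delta>-coefficient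
    of the image, which positivity at x already makes nonnegative before the shift.\<close>
  let ?z = "(id, snd x + two_rho_check) :: ('a \<Rightarrow> 'a) \<times> 'a" and ?g = "(inv (fst x), fst x two_rho_check)"
  show ?thesis
  proof (rule rises_walk[of ?g x ?z])
    show "?g \<in> aff_weyl I"
      using weyl_inv[OF w] weyl_coroot_lattice_I[OF w two_rho_check_lattice] by (simp add: aff_weyl_def)
    show "aff_act ?z \<eta> = aff_act ?g (aff_act x \<eta>)" for \<eta>
      using w weyl_inner[OF w] by (simp add: aff_act_def inner_add_right)
    fix \<eta> assume e: "\<eta> \<in> aff_roots" "aff_height (aff_act x \<eta>) > 0" "ht (fst \<eta>) < 0"
    have g: "fst \<eta> \<in> \<Delta>" "snd \<eta> \<in> \<int>" using e by (auto simp: aff_roots_def)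
    have i: "snd \<eta> - fst \<eta> \<bullet> snd x \<in> \<int>"
      using g root_coroot_lattice_int[OF g(1) aff_weylD(2)[OF x]] by simp
    have j: "snd \<eta> - fst \<eta> \<bullet> (snd x + two_rho_check) \<in> \<int>"
      using g root_coroot_lattice_int[OF g(1) coroot_lattice_add[OF order_refl aff_weylD(2)[OF x] two_rho_check_lattice]]
      by simp
    have "snd \<eta> - fst \<eta> \<bullet> snd x \<ge> 0"
      using e(2) aff_height_pos_iff[OF weyl_root[OF w g(1)] i] by (auto simp: aff_act_def)
    then have "snd \<eta> - fst \<eta> \<bullet> (snd x + two_rho_check) > 0"
      using e(3) by (simp add: inner_add_right root_two_rho_check)
    then show "aff_height (aff_act ?z \<eta>) > 0"
      using aff_height_pos_iff[OF g(1) j] by (simp add: aff_act_def)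
  qed (simp_all add: x)
qed

section \<open>The minimal lift of a translation\<close>

lemma si_le_translation_part:
  assumes "si_less_eq x y" "i \<in> I"
  shows "fund_weight i \<bullet> snd x \<le> fund_weight i \<bullet> snd y"
  using assms(1)
proof (induction rule: si_le_induct)
  case (edge y \<beta>)
  let ?g = "fin_dir y \<beta>"
  have g: "?g \<in> pos_roots" using edge fin_dir_root by (simp add: pos_roots_iff)
  \<comment> \<open>By \<open>lmul_right\<close> an edge adds a nonnegative multiple of the coroot
    of a positive root to the translation part.\<close>
  have "fund_weight i \<bullet> coroot ?g \<ge> 0"
    using pos_roots_fund_coweight[OF g assms(2)] by (simp add: fund_weight_def coroot_def)
  moreover have "snd \<beta> \<ge> 0"
    using edge(3,4) aff_height_pos_iff[of "fst \<beta>" "snd \<beta>"] by (auto simp: aff_roots_def)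
  ultimately have "snd \<beta> * (fund_weight i \<bullet> coroot ?g) \<ge> 0" by simp
  then show ?case
    using edge by (simp add: lmul_right inner_add_right)
qed simp

lemma si_le_slen: "si_less_eq x y \<Longrightarrow> slen x \<le> slen y"
  by (induction rule: si_le_induct) simp_all

lemma inversions_right:
  assumes w: "w \<in> weyl I" and i: "i \<in> I" and neg: "ht (w (\<alpha> i)) < 0"
  shows "inversions (w \<circ> reflection (\<alpha> i)) < inversions w"
proof -
  let ?v = "w \<circ> reflection (\<alpha> i)"
  let ?b = "(?v (\<alpha> i), 0 :: real)"
  have v: "?v \<in> weyl I" using w i weyl_comp weyl_simple by blast
  have vi: "?v (\<alpha> i) = - w (\<alpha> i)" using linear_neg[OF weyl_linear[OF w]] by (simp add: reflection_self)
  have vr: "?v (\<alpha> i) \<in> \<Delta>" using weyl_root v i simple_in_roots by blast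
  have b: "?b \<in> aff_roots" "aff_height ?b > 0"
    using vr aff_height_pos_iff[OF vr, of 0] neg vi by (auto simp: aff_roots_def)
  have f: "fin_dir (?v, 0) ?b = \<alpha> i" using v by (simp add: fin_dir_def del: comp_apply)
  have "?v \<circ> reflection (\<alpha> i) = w" by (simp add: fun_eq_iff)
  then have "lmul ?b (?v, 0) = (w, 0)" unfolding lmul_right[OF weyl_aff[OF v]] f by simp
  then have "slen (?v, 0) + 1 \<le> slen (w, 0)"
    using slen_lmul_less[OF weyl_aff[OF v] b] f i by simp
  then show ?thesis by (simp add: slen_eq)
qed

lemma weyl_pos_on:
  assumes J: "J \<subseteq> I" and w: "w \<in> weyl I" and s: "\<And>j. j \<in> J \<Longrightarrow> ht (w (\<alpha> j)) > 0"
    and g: "\<gamma> \<in> roots_of J" "ht \<gamma> > 0"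
  shows "ht (w \<gamma>) > 0"
  using J g
proof (induction rule: pos_root_induct)
  case (step j \<gamma>)
  have "ht (w (reflection (\<alpha> j) \<gamma>)) = ht (w \<gamma>) - (\<gamma> \<bullet> coroot (\<alpha> j)) * ht (w (\<alpha> j))"
    using weyl_linear[OF w] by (simp add: reflection_def linear_diff linear_scale ht_diff ht_scale)
  moreover have "(\<gamma> \<bullet> coroot (\<alpha> j)) * ht (w (\<alpha> j)) > 0" using step s by simp
  ultimately show ?case using step by linarith
qed (rule s)

text \<open>A right descent s_j of u is stripped off: v u arises from v u s_j by a reflection with
  \<delta>-coefficient 0, and it raises because \<open>- u (\<alpha> j)\<close> is a positive root
  of J, which v keeps positive. Without descents u is the identity.\<close>

lemma si_le_coset_min:
  assumes J: "J \<subseteq> I" and v: "v \<in> weyl I" and s: "\<And>j. j \<in> J \<Longrightarrow> ht (v (\<alpha> j)) > 0"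
    and u: "u \<in> weyl J" and xi: "\<xi> \<in> coroot_lattice I"
  shows "si_less_eq (v, \<xi>) (v \<circ> u, \<xi>)"
  using u
proof (induction "inversions u" arbitrary: u rule: less_induct)
  case less
  have uI: "u \<in> weyl I" using weyl_mono J less by blast
  show ?case
  proof (cases "\<exists>j\<in>J. ht (u (\<alpha> j)) < 0")
    case True
    then obtain j where j: "j \<in> J" "ht (u (\<alpha> j)) < 0" by blast
    have jI: "j \<in> I" using j J by blast
    let ?u = "u \<circ> reflection (\<alpha> j)"
    have u': "?u \<in> weyl J" using less j weyl_comp weyl_simple by blast
    have "si_less_eq (v, \<xi>) (v \<circ> ?u, \<xi>)" using less.hyps[OF inversions_right[OF uI jI j(2)] u'] .
    also have "si_less_eq (v \<circ> ?u, \<xi>) (v \<circ> u, \<xi>)"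
    proof -
      have uj: "?u (\<alpha> j) = - u (\<alpha> j)" using linear_neg[OF weyl_linear[OF uI]] by (simp add: reflection_self)
      have "?u (\<alpha> j) \<in> roots_of J"
        using weyl_roots_of[OF u' J simple_in_roots[OF jI]] simple_in_roots_of[OF J j(1)] by blast
      then have p: "ht ((v \<circ> ?u) (\<alpha> j)) > 0" using weyl_pos_on[OF J v s] uj j(2) by simp
      have vu: "v \<circ> ?u \<in> weyl I" using weyl_comp v weyl_mono J u' by blast
      have "\<alpha> j \<in> pos_roots" using jI simple_in_roots by (simp add: pos_roots_iff)
      moreover have "v \<circ> ?u \<circ> reflection (\<alpha> j) = v \<circ> u" by (simp add: fun_eq_iff)
      ultimately show ?thesis using si_le_right_reflection[OF vu xi, of "\<alpha> j" 0] p by simp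
    qed
    finally show ?thesis .
  next
    case False
    have s': "ht (u (\<alpha> j)) > 0" if "j \<in> J" for j
      using False that weyl_root[OF uI] simple_in_roots ht_root_nonzero J by (metis linorder_neqE subsetD)
    have "ht (u \<gamma>) > 0" if "\<gamma> \<in> pos_roots" for \<gamma>
      using weyl_pos_on[OF J uI s', of \<gamma>] weyl_pos_outside[OF less.prems J, of \<gamma>] that
      by (auto simp: pos_roots_iff)
    then have "{\<gamma>\<in>pos_roots. ht (u \<gamma>) < 0} = {}" by fastforce
    then have "inversions u = 0" by (simp only: inversions_def card.empty)
    then have "u = id" using inversions_0 uI by blast
    then show ?thesis using v xi by (simp add: si_le_refl aff_weyl_def)
  qed
qed

lemma coset_min_exists:
  assumes J: "J \<subseteq> I" and w: "w \<in> weyl I"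
  shows "\<exists>u\<in>weyl J. \<forall>j\<in>J. ht ((w \<circ> u) (\<alpha> j)) > 0"
proof -
  obtain u where u: "u \<in> weyl J" "\<And>u'. u' \<in> weyl J \<Longrightarrow> inversions (w \<circ> u) \<le> inversions (w \<circ> u')"
    using ex_has_least_nat[of "\<lambda>u. u \<in> weyl J" id "\<lambda>u. inversions (w \<circ> u)"] weyl_id by blast
  have wu: "w \<circ> u \<in> weyl I" using weyl_comp w weyl_mono J u by blast
  have "ht ((w \<circ> u) (\<alpha> j)) > 0" if j: "j \<in> J" for j
  proof (rule ccontr)
    have jI: "j \<in> I" using j J by blast
    assume "\<not> ?thesis"
    then have "ht ((w \<circ> u) (\<alpha> j)) < 0"
      using weyl_root[OF wu simple_in_roots[OF jI]] ht_root_nonzero by (meson linorder_neqE)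
    then have "inversions (w \<circ> (u \<circ> reflection (\<alpha> j))) < inversions (w \<circ> u)"
      using inversions_right[OF wu jI] by (simp add: comp_assoc)
    moreover have "u \<circ> reflection (\<alpha> j) \<in> weyl J" using weyl_comp weyl_simple u j by blast
    ultimately show False using u(2) by fastforce
  qed
  then show ?thesis using u by blast
qed

text \<open>Unlike \<open>lift_set\<close> this depends only on the coset of y, so y may be replaced
  by s_a y without checking that the result is a minimal representative.\<close>

definition lifts :: "'i set \<Rightarrow> ('a \<Rightarrow> 'a) \<times> 'a \<Rightarrow> ('a \<Rightarrow> 'a) \<times> 'a \<Rightarrow> (('a \<Rightarrow> 'a) \<times> 'a) set" where
  "lifts J x y = {y'. same_coset J y y' \<and> si_less_eq x y'}"

lemma liftsD:
  assumes "y' \<in> lifts J x y"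
  shows "same_coset J y y'" "si_less_eq x y'" "y \<in> aff_weyl I" "y' \<in> aff_weyl I"
  using assms same_coset_weyl[of J y y'] by (simp_all add: lifts_def)

definition has_least :: "(('a \<Rightarrow> 'a) \<times> 'a) set \<Rightarrow> bool" where
  "has_least S \<longleftrightarrow> (\<exists>m\<in>S. \<forall>y\<in>S. si_less_eq m y)"

lemma has_leastI: "m \<in> S \<Longrightarrow> (\<And>y. y \<in> S \<Longrightarrow> si_less_eq m y) \<Longrightarrow> has_least S"
  unfolding has_least_def by blast

lemma has_leastE:
  assumes "has_least S"
  obtains m where "m \<in> S" "\<And>y. y \<in> S \<Longrightarrow> si_less_eq m y"
  using assms unfolding has_least_def by blast

lemma lifts_least_translation:
  assumes J: "J \<subseteq> I" and x: "fst x = id" and ne: "lifts J x y \<noteq> {}"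
  shows "has_least (lifts J x y)"
proof -
  obtain y' where yy': "same_coset J y y'" and xy': "si_less_eq x y'"
    using ne by (auto simp: lifts_def)
  have xI: "x \<in> aff_weyl I" and y'I: "y' \<in> aff_weyl I" using si_le_weyl xy' by blast+
  note mu = aff_weylD(2)[OF xI] and nu = aff_weylD(2)[OF y'I] and w = aff_weylD(1)[OF y'I]
  obtain u where u: "u \<in> weyl J" "\<And>j. j \<in> J \<Longrightarrow> ht ((fst y' \<circ> u) (\<alpha> j)) > 0"
    using coset_min_exists[OF J w] by blast
  define v where "v = fst y' \<circ> u"
  have v: "v \<in> weyl I" unfolding v_def using weyl_comp w weyl_mono J u by blast
  \<comment> \<open>Coordinates outside J are dictated by the coset and copied from
    \<open>y'\<close>; those in J are free, and are put at the bound that x imposes on every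
    lift.\<close>
  define \<zeta> where "\<zeta> = (\<Sum>i\<in>I - J. (fund_weight i \<bullet> (snd y' - snd x)) *\<^sub>R coroot (\<alpha> i))"
  have z1: "fund_weight i \<bullet> \<zeta> = (if i \<in> J then 0 else fund_weight i \<bullet> (snd y' - snd x))" if "i \<in> I" for i
    unfolding \<zeta>_def using that by (subst fund_weight_sum) auto
  have dI: "snd y' - snd x \<in> coroot_lattice I" using coroot_lattice_diff mu nu by blast
  have zI: "\<zeta> \<in> coroot_lattice I"
    using z1 dI by (auto simp: coroot_lattice_iff)
  have nn: "fund_weight i \<bullet> snd x \<le> fund_weight i \<bullet> snd y''" if "si_less_eq x y''" "i \<in> I" for y'' i
    using si_le_translation_part that by blast
  define m where "m = (v, snd x + \<zeta>)"
  have nu0: "snd x + \<zeta> \<in> coroot_lattice I" using coroot_lattice_add mu zI by blast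
  have mI: "m \<in> aff_weyl I" using v nu0 by (simp add: m_def aff_weyl_def)
  have y'm: "same_coset J y' m"
  proof -
    have "snd m - snd y' \<in> coroot_lattice I"
      using coroot_lattice_diff nu nu0 by (simp add: m_def)
    moreover have "fund_weight i \<bullet> (snd m - snd y') = 0" if "i \<in> I - J" for i
      using that z1[of i] by (simp add: m_def inner_diff_right inner_add_right)
    ultimately have "snd m - snd y' \<in> coroot_lattice J"
      using coroot_lattice_iff[OF J] coroot_lattice_iff[OF order_refl] by blast
    then show ?thesis using mI y'I u(1) by (auto simp: same_coset_def m_def v_def)
  qed
  have xm: "si_less_eq x m"
  proof -
    have "x = (id, snd x)" using x by (simp add: prod_eq_iff)
    moreover have "si_less_eq (id, snd x) (id, snd x + \<zeta>)"
      using nn[OF xy'] z1 by (intro si_le_translation weyl_id mu zI) (simp add: inner_diff_right)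
    \<comment> \<open>The identity is the minimal representative of the only coset of the full Weyl
      group, so it lies below v.\<close>
    moreover have "si_less_eq (id, snd x + \<zeta>) (id \<circ> v, snd x + \<zeta>)"
      by (rule si_le_coset_min[OF order_refl weyl_id _ v nu0]) simp
    ultimately show ?thesis unfolding m_def using si_le_trans by (metis id_comp)
  qed
  have least: "si_less_eq m y''" if y'': "y'' \<in> lifts J x y" for y''
  proof -
    have c: "same_coset J y y''" and xy: "si_less_eq x y''" using y'' by (auto simp: lifts_def)
    have y''I: "y'' \<in> aff_weyl I" using c same_coset_weyl by blast
    have "same_coset J m y''"
      using same_coset_trans[OF J same_coset_sym[OF J y'm] same_coset_trans[OF J same_coset_sym[OF J yy'] c]] .
    then obtain u' where u': "u' \<in> weyl J" "fst y'' = v \<circ> u'" and d: "snd y'' - snd m \<in> coroot_lattice J"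
      by (auto simp: same_coset_def m_def)
    \<comment> \<open>On the way to \<open>y''\<close> the finite part grows before the translation
      part; the difference of translations has nonnegative coordinates in J and zero coordinates
      outside.\<close>
    have "si_less_eq (v, snd m) (v \<circ> u', snd m)"
      using si_le_coset_min[OF J v _ u'(1)] u(2) nu0 by (simp add: v_def m_def)
    also have "si_less_eq \<dots> (v \<circ> u', snd m + (snd y'' - snd m))"
    proof (rule si_le_translation)
      show "v \<circ> u' \<in> weyl I" using u' aff_weylD(1)[OF y''I] by simp
      show "snd m \<in> coroot_lattice I" using nu0 by (simp add: m_def)
      show "snd y'' - snd m \<in> coroot_lattice I" using d J coroot_lattice_mono by blast
      fix i assume i: "i \<in> I"
      show "fund_weight i \<bullet> (snd y'' - snd m) \<ge> 0"
      proof (cases "i \<in> J")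
        case True
        then show ?thesis using nn[OF xy i] z1[OF i] by (simp add: m_def inner_diff_right inner_add_right)
      next
        case False
        then show ?thesis using d i J by (simp add: coroot_lattice_iff)
      qed
    qed
    finally show ?thesis using u'(2) by (simp add: m_def prod_eq_iff[of "(_, _)"])
        (metis add_diff_cancel_left' diff_add_cancel prod.collapse)
  qed
  have "m \<in> lifts J x y" using xm same_coset_trans[OF J yy' y'm] by (simp add: lifts_def)
  then show ?thesis using least by (rule has_leastI)
qed

text \<open>The inner induction carries a lift \<open>y'\<close> along, since y merely names its
  coset: \<open>slen y' - slen x\<close> is nonnegative for every lift, while y itself may lie
  anywhere in the coset.\<close>

lemma lifts_least_step:
  assumes J: "J \<subseteq> I" and x: "x \<in> aff_weyl I" and a: "a \<in> aff_simple" and asc: "ascent a x"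
    and IH: "\<And>y. lifts J (lmul a x) y \<noteq> {} \<Longrightarrow> has_least (lifts J (lmul a x) y)"
    and y': "y' \<in> lifts J x y"
  shows "has_least (lifts J x y)"
  using y'
proof (induction "nat \<lfloor>slen y' - slen x\<rfloor>" arbitrary: y y' rule: less_induct)
  case less
  have ar: "a \<in> aff_roots" using a aff_simple_root by blast
  have yI: "y \<in> aff_weyl I" using liftsD(3)[OF less.prems] .
  have lx: "lower a x = x" "upper a x = lmul a x" using asc by (simp_all add: lower_def upper_def)
  have lax: "lower a (lmul a x) = x" using lower_lmul[OF x a] lx by simp
  have co: "z \<in> aff_weyl I \<and> same_coset J (lmul a y) (lmul a z)" if "same_coset J y z" for z
    using that same_coset_weyl same_coset_lmul[OF J that ar] by blast
  have oc: "z \<in> aff_weyl I \<and> same_coset J y (lmul a z)" if "same_coset J (lmul a y) z" for z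
    using that same_coset_weyl same_coset_lmul[OF J that ar] yI by simp
  have ascz: "ascent a z \<longleftrightarrow> ascent a y" if "same_coset J y z" "fin_dir y a \<notin> roots_of J" for z
    using same_coset_ascent[OF J that(1) a that(2)] .
  have ascz': "ascent a z \<longleftrightarrow> \<not> ascent a y" if "same_coset J (lmul a y) z" "fin_dir y a \<notin> roots_of J" for z
    using ascz[of "lmul a z"] oc[OF that(1)] that(2) ascent_lmul[of z a] a by blast
  show ?case
  proof (cases "fin_dir y a \<in> roots_of J")
    case True
    have st: "same_coset J y (lmul a z)" if z: "same_coset J y z" for z
    proof -
      have "fin_dir z a \<in> roots_of J" using same_coset_fin_dir(1)[OF J z ar] True by blast
      then have "same_coset J z (lmul a z)" using same_coset_lmul_stable J same_coset_weyl[OF z] ar by blast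
      then show ?thesis using same_coset_trans J z by blast
    qed
    \<comment> \<open>On a stable coset \<open>upper a\<close> sends lifts of x to lifts of s_a x,
      and \<open>lower a\<close> leads back; neither leaves the coset.\<close>
    have up: "upper a z \<in> lifts J (lmul a x) y" if "z \<in> lifts J x y" for z
      using that st lifting(2)[of x z a] a lx by (auto simp: lifts_def upper_def)
    have "has_least (lifts J (lmul a x) y)" using IH up[OF less.prems] by blast
    then obtain m where m: "m \<in> lifts J (lmul a x) y" "\<And>z. z \<in> lifts J (lmul a x) y \<Longrightarrow> si_less_eq m z"
      by (rule has_leastE) blast
    have "si_less_eq x (lower a m)" using m(1) lifting(1)[of "lmul a x" m a] a lax by (simp add: lifts_def)
    then have "lower a m \<in> lifts J x y" using m(1) st by (auto simp: lifts_def lower_def)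
    moreover have "si_less_eq (lower a m) z" if z: "z \<in> lifts J x y" for z
    proof -
      have zI: "z \<in> aff_weyl I" using liftsD(4)[OF z] .
      have "si_less_eq (lower a m) (lower a (upper a z))" using lifting(1)[OF m(2)[OF up[OF z]] a] .
      moreover have "lower a (upper a z) = lower a z" using lower_lmul[OF zI a] by (simp add: upper_def)
      ultimately show ?thesis using lower_le[OF zI a] si_le_trans by simp
    qed
    ultimately show ?thesis by (rule has_leastI)
  next
    case out: False
    show ?thesis
    proof (cases "ascent a y")
      case True
      have up: "lmul a z \<in> lifts J (lmul a x) (lmul a y)" if z: "z \<in> lifts J x y" for z
      proof -
        have c: "same_coset J y z" "si_less_eq x z" using liftsD[OF z] by blast+
        have "ascent a z" using ascz[OF c(1) out] True by simp
        then show ?thesis using lifting(2)[OF c(2) a] co[OF c(1)] lx by (simp add: lifts_def upper_def)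
      qed
      have "has_least (lifts J (lmul a x) (lmul a y))" using IH up[OF less.prems] by blast
      then obtain m where m: "m \<in> lifts J (lmul a x) (lmul a y)"
        "\<And>z. z \<in> lifts J (lmul a x) (lmul a y) \<Longrightarrow> si_less_eq m z"
        by (rule has_leastE) blast
      have mc: "same_coset J (lmul a y) m" "si_less_eq (lmul a x) m" using m(1) by (auto simp: lifts_def)
      have lm: "lower a m = lmul a m" using ascz'[OF mc(1) out] True by (simp add: lower_def)
      have "lmul a m \<in> lifts J x y"
        using oc[OF mc(1)] lifting(1)[OF mc(2) a] lax lm by (simp add: lifts_def)
      moreover have "si_less_eq (lmul a m) z" if z: "z \<in> lifts J x y" for z
      proof -
        have c: "same_coset J y z" "z \<in> aff_weyl I" using liftsD[OF z] by blast+
        have "lower a (lmul a z) = z"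
          using lower_lmul[OF c(2) a] ascz[OF c(1) out] True by (simp add: lower_def)
        then show ?thesis using lifting(1)[OF m(2)[OF up[OF z]] a] lm by simp
      qed
      ultimately show ?thesis by (rule has_leastI)
    next
      case False
      \<comment> \<open>Here s_a lowers the coset and x stays in place: each lift goes down to the
        lowered coset and remains above \<open>lower a x\<close>, which is x.\<close>
      have down: "lmul a z \<in> lifts J x (lmul a y)" if z: "z \<in> lifts J x y" for z
      proof -
        have c: "same_coset J y z" "si_less_eq x z" using liftsD[OF z] by blast+
        have "\<not> ascent a z" using ascz[OF c(1) out] False by simp
        then show ?thesis using lifting(1)[OF c(2) a] co[OF c(1)] lx by (simp add: lifts_def lower_def)
      qed
      have c': "same_coset J y y'" "y' \<in> aff_weyl I" using liftsD[OF less.prems] by blast+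
      have "slen y' = slen (lmul a y') + 1"
        using slen_ascent(2)[OF c'(2) a] ascz[OF c'(1) out] False by blast
      moreover have "slen x \<le> slen (lmul a y')"
        using down[OF less.prems] si_le_slen by (auto simp: lifts_def)
      \<comment> \<open>The gap drops by one and is still nonnegative because x lies below s_a y',
        so \<open>nat\<close> does not hide the decrease.\<close>
      ultimately have "nat \<lfloor>slen (lmul a y') - slen x\<rfloor> < nat \<lfloor>slen y' - slen x\<rfloor>" by linarith
      then have "has_least (lifts J x (lmul a y))" using less.hyps[OF _ down[OF less.prems]] by blast
      then obtain m where m: "m \<in> lifts J x (lmul a y)"
        "\<And>z. z \<in> lifts J x (lmul a y) \<Longrightarrow> si_less_eq m z"
        by (rule has_leastE) blast
      have mc: "same_coset J (lmul a y) m" "si_less_eq x m" using m(1) by (auto simp: lifts_def)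
      have mI: "m \<in> aff_weyl I" using mc si_le_weyl by blast
      have um: "upper a m = lmul a m" using ascz'[OF mc(1) out] False by (simp add: upper_def)
      have "lmul a m \<in> lifts J x y"
        using oc[OF mc(1)] si_le_trans[OF mc(2) upper_ge[OF mI a]] um by (simp add: lifts_def)
      moreover have "si_less_eq (lmul a m) z" if z: "z \<in> lifts J x y" for z
      proof -
        have c: "same_coset J y z" "z \<in> aff_weyl I" using liftsD[OF z] by blast+
        have "upper a (lmul a z) = z"
          using upper_lmul[OF c(2) a] ascz[OF c(1) out] False by (simp add: upper_def)
        then show ?thesis using lifting(2)[OF m(2)[OF down[OF z]] a] um by simp
      qed
      ultimately show ?thesis by (rule has_leastI)
    qed
  qed
qed

lemma lifts_least:
  assumes J: "J \<subseteq> I" and x: "x \<in> aff_weyl I" and ne: "lifts J x y \<noteq> {}"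
  shows "has_least (lifts J x y)"
  using rises_all[OF x] x ne
proof (induction arbitrary: y rule: rises.induct)
  case (base x)
  then show ?case using lifts_least_translation J by blast
next
  case (step a x)
  then obtain y' where "y' \<in> lifts J x y" by blast
  then show ?case
    using lifts_least_step[OF J step(5) step(1,2)] step(4) lmul_weyl[OF aff_simple_root[OF step(1)] step(5)]
    by blast
qed

text \<open>An edge of the quotient graph acts on the current lift by the same reflection. Its
  direction is outside \<open>roots_of J\<close>, for otherwise it would join two distinct minimal
  representatives of one coset; so it raises the lift as well. The length of the lift may jump by
  more than one, whence \<open>si_le_reflection\<close>.\<close>

lemma lifts_nonempty:
  assumes J: "J \<subseteq> I" and le: "si_le J x' y" and c: "same_coset J x x'"
  shows "lifts J x y \<noteq> {}"
proof -
  have x: "x \<in> aff_weyl I" using c same_coset_weyl by blast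
  have "(x', y) \<in> (si_edges J)\<^sup>*" using le by (simp add: si_le_def)
  then show ?thesis
  proof (induction rule: rtrancl_induct)
    case base
    have "x \<in> lifts J x x'" using same_coset_sym[OF J c] si_le_refl x by (simp add: lifts_def)
    then show ?case by blast
  next
    case (step y z)
    from step(2) obtain \<beta> where z: "z = lmul \<beta> y" and b: "\<beta> \<in> aff_roots" "aff_height \<beta> > 0"
      and ym: "y \<in> aff_min_reps J" and zm: "z \<in> aff_min_reps J" and l: "si_len z = si_len y + 1"
      by (auto simp: si_edges_def aff_pos_I_iff)
    have y: "y \<in> aff_weyl I" using ym aff_min_reps_iff[OF J] by blast
    obtain y' where y': "same_coset J y y'" "si_less_eq x y'" using step.IH by (auto simp: lifts_def)
    have p: "ht (fin_dir y \<beta>) > 0" using edge_fin_dir[OF y b] l z by simp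
    have "fin_dir y \<beta> \<notin> roots_of J"
    proof
      assume "fin_dir y \<beta> \<in> roots_of J"
      then have "same_coset J y z" unfolding z by (rule same_coset_lmul_stable[OF J y b(1)])
      then have "y = z" using same_coset_min_reps_eq J ym zm by blast
      then show False using l by simp
    qed
    then have "ht (fin_dir y' \<beta>) > 0" using same_coset_fin_dir(2)[OF J y'(1) b(1)] p by blast
    then have "si_less_eq y' (lmul \<beta> y')" using si_le_reflection b same_coset_weyl[OF y'(1)] by blast
    then have "lmul \<beta> y' \<in> lifts J x z"
      unfolding lifts_def z using same_coset_lmul[OF J y'(1) b(1)] y'(2) si_le_trans by blast
    then show ?case by blast
  qed
qed

lemma lift_set_least:
  assumes J: "J \<subseteq> I" and x: "x \<in> aff_weyl I" and y: "y \<in> aff_min_reps J" and le: "si_le J (proj J x) y"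
  shows "\<exists>m\<in>lift_set J x y. \<forall>y'\<in>lift_set J x y. si_less_eq m y'"
proof -
  have "proj J x \<in> aff_min_reps J" using le by (simp add: si_le_def)
  then have c: "same_coset J x (proj J x)" using proj_eq_iff[OF J x] by blast
  have "y' \<in> lift_set J x y \<longleftrightarrow> y' \<in> lifts J x y" for y'
    using proj_eq_iff[OF J _ y] same_coset_sym[OF J] same_coset_weyl
    unfolding lift_set_def lifts_def by blast
  then have "lift_set J x y = lifts J x y" by blast
  then show ?thesis using lifts_least[OF J x lifts_nonempty[OF J le c]] by (simp add: has_least_def)
qed

end

theorem proposition2p4:
  fixes \<Delta> :: "'a::euclidean_space set"
    and I J :: "'i set"
    and \<alpha> :: "'i \<Rightarrow> 'a"
    and x y :: "('a \<Rightarrow> 'a) \<times> 'a"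
  assumes "simple_root_datum \<Delta> I \<alpha>"
    and "J \<subseteq> I"
    and "x \<in> simple_root_datum.aff_weyl \<alpha> I"
    and "y \<in> simple_root_datum.aff_min_reps \<Delta> I \<alpha> J"
    and "simple_root_datum.si_le \<Delta> I \<alpha> J (simple_root_datum.proj \<Delta> I \<alpha> J x) y"
  shows "\<exists>m \<in> simple_root_datum.lift_set \<Delta> I \<alpha> J x y.
           \<forall>y' \<in> simple_root_datum.lift_set \<Delta> I \<alpha> J x y.
             simple_root_datum.si_le \<Delta> I \<alpha> {} m y'"
  using assms by (rule simple_root_datum.lift_set_least)

end
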